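(* Let $(A,\mathfrak{m})$ be a Noetherian local ring with infinite residue field, let $M$ be a finitely generated $A$-module, let $J$ be an $\mathfrak{m}$-primary ideal and $\mathbf{I}=I_1,\ldots,I_d$ ideals of $A$, and let $(k_0,\mathbf{k})\in\mathbb{N}^{d+1}$. The following statements are equivalent: (i) There exists a weak-(FC)-sequence of $\mathbf{I},J$ with respect to $M$ of the type $(\mathbf{k},k_0+1)$ which is a joint reduction of $\mathbf{I},J$ with respect to $M$. (ii) There exists a joint reduction of $\mathbf{I},J$ with respect to $M$ of the type $(\mathbf{k},k_0+1)$. (iii) $\bigtriangleup^{(k_0,\mathbf{k})}P(n_0,\mathbf{n},J,\mathbf{I},M)$ is a constant.
   Context: Notation: $\mathbf{n}=(n_1,\ldots,n_d)$, $\mathbf{k}=(k_1,\ldots,k_d)\in\mathbb{N}^d$ ($0\in\mathbb{N}$), $\mathbf{e}_i$ is the $i$th standard unit vector, $\mathbb{I}^{\mathbf{n}}=I_1^{n_1}\cdots I_d^{n_d}$, $I=I_1\cdots I_d$. "For all large $n_0,\mathbf{n}$" means whenever all coordinates are sufficiently large. $P(n_0,\mathbf{n},J,\mathbf{I},M)$ is the polynomial that agrees with $\ell_A\big(J^{n_0}\mathbb{I}^{\mathbf{n}}M/J^{n_0+1}\mathbb{I}^{\mathbf{n}}M\big)$ for all large $n_0,\mathbf{n}$. Differences: for a numerical polynomial $f(\mathbf{n})$, $\bigtriangleup^{\mathbf{0}}f=f$, $\bigtriangleup^{\mathbf{e}_i}f(\mathbf{n})=f(\mathbf{n})-f(\mathbf{n}-\mathbf{e}_i)$,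 and $\bigtriangleup^{\mathbf{k}}f=\bigtriangleup^{\mathbf{e}_i}(\bigtriangleup^{\mathbf{k}-\mathbf{e}_i}f)$ for $\mathbf{k}\ge\mathbf{e}_i$; likewise in the variables $(n_0,\mathbf{n})$. A constant may be zero. Joint reductions: let $\mathfrak{I}_i$ be a sequence of $k_i$ elements of $I_i$ ($1\le i\le d$) and $\mathfrak{I}_0$ a sequence of $h$ elements of $J$ (the empty sequence generates the zero ideal). The sequence $\mathfrak{I}_1,\ldots,\mathfrak{I}_d,\mathfrak{I}_0$ is a joint reduction of $\mathbf{I},J$ with respect to $M$ of the type $(\mathbf{k},h)$ if $J^{n_0}\mathbb{I}^{\mathbf{n}}M=(\mathfrak{I}_0)J^{n_0-1}\mathbb{I}^{\mathbf{n}}M+\sum_{i=1}^d(\mathfrak{I}_i)J^{n_0}\mathbb{I}^{\mathbf{n}-\mathbf{e}_i}M$ for all large $n_0,\mathbf{n}$. Weak-(FC)-sequences: an element $x\in A$ is a weak-(FC)-element of $\mathbf{I},J$ with respect to $M$ if (FC1) either $x\in I_i$ for some $1\le i\le d$ and $xM\cap J^{n_0}\mathbb{I}^{\mathbf{n}}M=xJ^{n_0}\mathbb{I}^{\mathbf{n}-\mathbf{e}_i}M$ for all large $n_0,\mathbf{n}$, or $x\in J$ and $xM\cap J^{n_0}\mathbb{I}^{\mathbf{n}}M=xJ^{n_0-1}\mathbb{I}^{\mathbf{n}}M$ for all large $n_0,\mathbf{n}$; and (FC2) $0_M:x\subseteq 0_M:(IJ)^\infty$, where $0_M:\mathfrak{a}^\infty=\bigcup_{m}(0_M:\mathfrak{a}^m)$.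 A sequence $x_1,\ldots,x_t$ is a weak-(FC)-sequence of $\mathbf{I},J$ with respect to $M$ if $x_{i+1}$ is a weak-(FC)-element of $\mathbf{I},J$ with respect to $M/(x_1,\ldots,x_i)M$ for all $0\le i\le t-1$; it is of the type $(\mathbf{k},h)$ if it consists of $k_i$ elements of $I_i$ ($1\le i\le d$) and $h$ elements of $J$. *)

theory Defs
  imports "HOL-Algebra.Ring_Divisibility" "HOL-Algebra.Ideal_Product" "HOL-Algebra.QuotRing"
    "HOL-Algebra.Module" "HOL-Library.Extended_Nat" "HOL-Library.Multiset"
begin

text \<open>
  Conventions. A multi-index \<open>(n\<^sub>0, n\<^sub>1, \<dots>, n\<^sub>d)\<close> is a function on \<open>nat\<close> of which only the
  values at \<open>0, \<dots>, d\<close> matter. The ideals \<open>J, I\<^sub>1, \<dots>, I\<^sub>d\<close> are likewise given as one family \<open>F\<close>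
  with \<open>F 0 = J\<close> and \<open>F i = I\<^sub>i\<close> for \<open>1 \<le> i \<le> d\<close>, so that index \<open>0\<close> always belongs to \<open>J\<close>.
\<close>

section \<open>Rings\<close>

definition local_ring :: "('a, 'm) ring_scheme \<Rightarrow> 'a set \<Rightarrow> bool" where
  "local_ring R \<mm> \<longleftrightarrow> cring R \<and> (\<forall>I. maximalideal I R \<longleftrightarrow> I = \<mm>)"

definition primary_ideal :: "('a, 'm) ring_scheme \<Rightarrow> 'a set \<Rightarrow> bool" where
  "primary_ideal R Q \<longleftrightarrow> ideal Q R \<and> Q \<noteq> carrier R \<and>
     (\<forall>a\<in>carrier R. \<forall>b\<in>carrier R. a \<otimes>\<^bsub>R\<^esub> b \<in> Q \<longrightarrow> a \<in> Q \<or> (\<exists>n::nat. b [^]\<^bsub>R\<^esub> n \<in> Q))"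

definition ideal_radical :: "('a, 'm) ring_scheme \<Rightarrow> 'a set \<Rightarrow> 'a set" where
  "ideal_radical R Q = {a \<in> carrier R. \<exists>n::nat. a [^]\<^bsub>R\<^esub> n \<in> Q}"

definition primary_to :: "('a, 'm) ring_scheme \<Rightarrow> 'a set \<Rightarrow> 'a set \<Rightarrow> bool" where
  "primary_to R \<pp> Q \<longleftrightarrow> primary_ideal R Q \<and> ideal_radical R Q = \<pp>"

text \<open>\<open>J\<^bsup>n\<^sub>0\<^esup> I\<^sub>1\<^bsup>n\<^sub>1\<^esup> \<cdots> I\<^sub>d\<^bsup>n\<^sub>d\<^esup>\<close>; powers and products are those of the commutative monoid of ideals.\<close>

definition multi_power ::
    "('a, 'm) ring_scheme \<Rightarrow> nat \<Rightarrow> (nat \<Rightarrow> 'a set) \<Rightarrow> (nat \<Rightarrow> nat) \<Rightarrow> 'a set" where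
  "multi_power R d F n = (\<Otimes>\<^bsub>ideals_set R\<^esub>i\<in>{..d}. F i [^]\<^bsub>ideals_set R\<^esub> n i)"

section \<open>Modules\<close>

definition gen_submodule ::
    "('a, 'm) ring_scheme \<Rightarrow> ('a, 'b, 'n) module_scheme \<Rightarrow> 'b set \<Rightarrow> 'b set" where
  "gen_submodule R M S = \<Inter>{H. submodule H R M \<and> S \<subseteq> H}"

definition fin_gen_module ::
    "('a, 'm) ring_scheme \<Rightarrow> ('a, 'b, 'n) module_scheme \<Rightarrow> bool" where
  "fin_gen_module R M \<longleftrightarrow> module R M \<and>
     (\<exists>S. finite S \<and> S \<subseteq> carrier M \<and> gen_submodule R M S = carrier M)"

text \<open>The submodule \<open>\<aa>N\<close> for an ideal \<open>\<aa>\<close> and a submodule \<open>N\<close>.\<close>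

definition ideal_smult ::
    "('a, 'm) ring_scheme \<Rightarrow> ('a, 'b, 'n) module_scheme \<Rightarrow> 'a set \<Rightarrow> 'b set \<Rightarrow> 'b set" where
  "ideal_smult R M \<aa> N = gen_submodule R M {a \<odot>\<^bsub>M\<^esub> v |a v. a \<in> \<aa> \<and> v \<in> N}"

text \<open>A module record also has the (meaningless) ring fields \<open>mult\<close> and \<open>one\<close>, which the locale
  \<open>module\<close> never uses.\<close>

definition quot_module ::
    "('a, 'b, 'n) module_scheme \<Rightarrow> 'b set \<Rightarrow> ('a, 'b set) module" where
  "quot_module M N =
     \<lparr>carrier = a_rcosets\<^bsub>M\<^esub> N, mult = undefined, one = undefined, zero = N, add = set_add M,
      smult = (\<lambda>a V. \<Union>v\<in>V. N +>\<^bsub>M\<^esub> (a \<odot>\<^bsub>M\<^esub> v))\<rparr>"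

definition module_length ::
    "('a, 'm) ring_scheme \<Rightarrow> ('a, 'b, 'n) module_scheme \<Rightarrow> enat" where
  "module_length R M = Sup {enat l |l. \<exists>C :: nat \<Rightarrow> 'b set.
     (\<forall>i\<le>l. submodule (C i) R M) \<and> (\<forall>i<l. C i \<subset> C (Suc i))}"

text \<open>\<open>0\<^sub>M : S\<close> and \<open>0\<^sub>M : \<aa>\<^sup>\<infinity>\<close>.\<close>

definition zero_colon ::
    "('a, 'b, 'n) module_scheme \<Rightarrow> 'a set \<Rightarrow> 'b set" where
  "zero_colon M S = {v \<in> carrier M. \<forall>a\<in>S. a \<odot>\<^bsub>M\<^esub> v = \<zero>\<^bsub>M\<^esub>}"

definition zero_colon_inf ::
    "('a, 'm) ring_scheme \<Rightarrow> ('a, 'b, 'n) module_scheme \<Rightarrow> 'a set \<Rightarrow> 'b set" where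
  "zero_colon_inf R M \<aa> = (\<Union>m::nat. zero_colon M (\<aa> [^]\<^bsub>ideals_set R\<^esub> m))"

text \<open>\<open>J\<^bsup>n\<^sub>0\<^esup> I\<^sub>1\<^bsup>n\<^sub>1\<^esup> \<cdots> I\<^sub>d\<^bsup>n\<^sub>d\<^esup> M\<close>\<close>

definition multi_power_mod ::
    "('a, 'm) ring_scheme \<Rightarrow> ('a, 'b, 'n) module_scheme \<Rightarrow> nat \<Rightarrow> (nat \<Rightarrow> 'a set) \<Rightarrow>
     (nat \<Rightarrow> nat) \<Rightarrow> 'b set" where
  "multi_power_mod R M d F n = ideal_smult R M (multi_power R d F n) (carrier M)"

section \<open>Large multi-indices and numerical polynomials\<close>

definition for_all_large :: "nat \<Rightarrow> ((nat \<Rightarrow> nat) \<Rightarrow> bool) \<Rightarrow> bool" where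
  "for_all_large d Q \<longleftrightarrow> (\<exists>N. \<forall>n. (\<forall>i\<le>d. N \<le> n i) \<longrightarrow> Q n)"

text \<open>The truncated subtraction is harmless, since this is only used for large \<open>n\<close>.\<close>

definition dec :: "nat \<Rightarrow> (nat \<Rightarrow> nat) \<Rightarrow> nat \<Rightarrow> nat" where
  "dec i n = n(i := n i - 1)"

text \<open>Polynomials in the variables \<open>n\<^sub>0, \<dots>, n\<^sub>d\<close> are identified with the functions on integral
  multi-indices they induce.\<close>

definition polynomial_fun :: "nat \<Rightarrow> ((nat \<Rightarrow> int) \<Rightarrow> rat) \<Rightarrow> bool" where
  "polynomial_fun d f \<longleftrightarrow> (\<exists>E c. finite E \<and>
     f = (\<lambda>n. \<Sum>e\<in>E. c e * (\<Prod>i\<le>d. rat_of_int (n i) ^ (e i :: nat))))"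

definition difference ::
    "nat \<Rightarrow> ((nat \<Rightarrow> int) \<Rightarrow> rat) \<Rightarrow> (nat \<Rightarrow> int) \<Rightarrow> rat" where
  "difference i f n = f n - f (n(i := n i - 1))"

text \<open>The operators \<open>difference i\<close> commute, so the order in which they are applied is
  immaterial; see \<open>multi_difference_zero\<close> and \<open>multi_difference_step\<close> below.\<close>

definition multi_difference ::
    "nat \<Rightarrow> (nat \<Rightarrow> nat) \<Rightarrow> ((nat \<Rightarrow> int) \<Rightarrow> rat) \<Rightarrow> (nat \<Rightarrow> int) \<Rightarrow> rat" where
  "multi_difference d k f = fold (\<lambda>i. difference i ^^ k i) [0..<Suc d] f"

lemma difference_commute: "difference i (difference j f) = difference j (difference i f)"
  by (cases "i = j") (auto simp: difference_def fun_eq_iff fun_upd_twist)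

lemma difference_funpow_commute:
  "(difference i ^^ m) (difference j f) = difference j ((difference i ^^ m) f)"
  by (induction m) (simp_all add: difference_commute)

lemma multi_difference_zero: "multi_difference d (\<lambda>_. 0) f = f"
  by (induction d) (simp_all add: multi_difference_def)

lemma multi_difference_step:
  assumes "i \<le> d" "1 \<le> k i"
  shows "multi_difference d k f = difference i (multi_difference d (k(i := k i - 1)) f)"
proof -
  have aux: "fold (\<lambda>i. difference i ^^ k i) xs f =
      difference i (fold (\<lambda>l. difference l ^^ (k(i := k i - 1)) l) xs f)"
    if "i \<in> set xs" "distinct xs" for xs
    using that
  proof (induction xs rule: rev_induct)
    case Nil
    then show ?case by simp
  next
    case (snoc j xs)
    show ?case
    proof (cases "j = i")
      case True
      have eq: "fold (\<lambda>i. difference i ^^ k i) xs f =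
          fold (\<lambda>l. difference l ^^ (k(i := k i - 1)) l) xs f"
        using snoc.prems True by (intro fold_cong) auto
      obtain m where "k i = Suc m" using assms(2) by (cases "k i") auto
      then show ?thesis using True eq by simp
    next
      case False
      then show ?thesis using snoc by (simp add: difference_funpow_commute)
    qed
  qed
  show ?thesis
    unfolding multi_difference_def using assms(1) by (intro aux) auto
qed

text \<open>\<open>P(n\<^sub>0, \<^bold>n, J, \<^bold>I, M)\<close>: the polynomial taking the value
  \<open>\<ell>(J\<^bsup>n\<^sub>0\<^esup> \<I>\<^bsup>\<^bold>n\<^esup> M / J\<^bsup>n\<^sub>0 + 1\<^esup> \<I>\<^bsup>\<^bold>n\<^esup> M)\<close> for all large \<open>n\<^sub>0, \<^bold>n\<close>. A polynomial is determined by its values at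
  all large multi-indices, so the description is unique.\<close>

definition hilbert_polynomial ::
    "('a, 'm) ring_scheme \<Rightarrow> ('a, 'b, 'n) module_scheme \<Rightarrow> nat \<Rightarrow> (nat \<Rightarrow> 'a set) \<Rightarrow>
     (nat \<Rightarrow> int) \<Rightarrow> rat" where
  "hilbert_polynomial R M d F = (THE P. polynomial_fun d P \<and>
     for_all_large d (\<lambda>n. \<exists>l.
       module_length R (quot_module (M\<lparr>carrier := multi_power_mod R M d F n\<rparr>)
                          (multi_power_mod R M d F (n(0 := n 0 + 1)))) = enat l \<and>
       P (\<lambda>i. int (n i)) = of_nat l))"

section \<open>Joint reductions and weak-(FC)-sequences\<close>

text \<open>\<open>Y i\<close> is the sequence \<open>\<II>\<^sub>i\<close>, for \<open>0 \<le> i \<le> d\<close>; the type \<open>(\<^bold>k, h)\<close> is the multi-index \<open>k\<close>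
  with \<open>k 0 = h\<close>. A sum of submodules is the submodule generated by their union.\<close>

definition parts_of_type ::
    "nat \<Rightarrow> (nat \<Rightarrow> 'a set) \<Rightarrow> (nat \<Rightarrow> nat) \<Rightarrow> (nat \<Rightarrow> 'a list) \<Rightarrow> bool" where
  "parts_of_type d F k Y \<longleftrightarrow> (\<forall>i\<le>d. set (Y i) \<subseteq> F i \<and> length (Y i) = k i)"

definition joint_reduction ::
    "('a, 'm) ring_scheme \<Rightarrow> ('a, 'b, 'n) module_scheme \<Rightarrow> nat \<Rightarrow> (nat \<Rightarrow> 'a set) \<Rightarrow>
     (nat \<Rightarrow> nat) \<Rightarrow> (nat \<Rightarrow> 'a list) \<Rightarrow> bool" where
  "joint_reduction R M d F k Y \<longleftrightarrow> parts_of_type d F k Y \<and>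
     for_all_large d (\<lambda>n. multi_power_mod R M d F n =
       gen_submodule R M
         (\<Union>i\<le>d. ideal_smult R M (Idl\<^bsub>R\<^esub> (set (Y i))) (multi_power_mod R M d F (dec i n))))"

definition FC1 ::
    "('a, 'm) ring_scheme \<Rightarrow> ('a, 'b, 'n) module_scheme \<Rightarrow> nat \<Rightarrow> (nat \<Rightarrow> 'a set) \<Rightarrow> 'a \<Rightarrow> bool" where
  "FC1 R M d F x \<longleftrightarrow> (\<exists>i\<le>d. x \<in> F i \<and>
     for_all_large d (\<lambda>n.
       (\<lambda>v. x \<odot>\<^bsub>M\<^esub> v) ` carrier M \<inter> multi_power_mod R M d F n =
       (\<lambda>v. x \<odot>\<^bsub>M\<^esub> v) ` multi_power_mod R M d F (dec i n)))"

definition FC2 ::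
    "('a, 'm) ring_scheme \<Rightarrow> ('a, 'b, 'n) module_scheme \<Rightarrow> nat \<Rightarrow> (nat \<Rightarrow> 'a set) \<Rightarrow> 'a \<Rightarrow> bool" where
  "FC2 R M d F x \<longleftrightarrow>
     zero_colon M {x} \<subseteq> zero_colon_inf R M (\<Otimes>\<^bsub>ideals_set R\<^esub>i\<in>{..d}. F i)"

definition weak_FC_element ::
    "('a, 'm) ring_scheme \<Rightarrow> ('a, 'b, 'n) module_scheme \<Rightarrow> nat \<Rightarrow> (nat \<Rightarrow> 'a set) \<Rightarrow> 'a \<Rightarrow> bool" where
  "weak_FC_element R M d F x \<longleftrightarrow> x \<in> carrier R \<and> FC1 R M d F x \<and> FC2 R M d F x"

definition weak_FC_sequence ::
    "('a, 'm) ring_scheme \<Rightarrow> ('a, 'b, 'n) module_scheme \<Rightarrow> nat \<Rightarrow> (nat \<Rightarrow> 'a set) \<Rightarrow>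
     'a list \<Rightarrow> bool" where
  "weak_FC_sequence R M d F xs \<longleftrightarrow> (\<forall>i<length xs.
     weak_FC_element R
       (quot_module M (ideal_smult R M (Idl\<^bsub>R\<^esub> (set (take i xs))) (carrier M))) d F (xs ! i))"

text \<open>\<open>xs\<close> is a weak-(FC)-sequence consisting, in some order, of the elements of
  \<open>Y 0, \<dots>, Y d\<close>, and hence of \<open>k i\<close> elements of \<open>F i\<close> for each \<open>i \<le> d\<close>.\<close>

definition weak_FC_sequence_of_type ::
    "('a, 'm) ring_scheme \<Rightarrow> ('a, 'b, 'n) module_scheme \<Rightarrow> nat \<Rightarrow> (nat \<Rightarrow> 'a set) \<Rightarrow>
     (nat \<Rightarrow> nat) \<Rightarrow> 'a list \<Rightarrow> (nat \<Rightarrow> 'a list) \<Rightarrow> bool" where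
  "weak_FC_sequence_of_type R M d F k xs Y \<longleftrightarrow>
     weak_FC_sequence R M d F xs \<and> parts_of_type d F k Y \<and> mset xs = (\<Sum>i\<le>d. mset (Y i))"

end

theory Submission
  imports Defs "HOL-Computational_Algebra.Polynomial"
begin

text \<open>
  Write \<open>W n = J\<^bsup>n\<^sub>0\<^esup> I\<^sub>1\<^bsup>n\<^sub>1\<^esup> \<cdots> I\<^sub>d\<^bsup>n\<^sub>d\<^esup> M\<close> and replace the quotients \<open>M/N\<close> by their kernels \<open>N\<close>, so that everything
  happens in the lattice of submodules of \<open>M\<close>. Hilbert's basis theorem, in the form of the ascending chain
  condition for graded submodules of \<open>\<Oplus> W n\<close>, gives an Artin--Rees lemma and, as the residue field is infinite,
  elements \<open>x \<in> I\<^sub>i\<close> that are filter-regular with respect to any finite set of such graded quotients.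
  If \<open>x\<close> is filter-regular for \<open>W\<close> and for the \<open>W n / W (n + e\<^sub>j)\<close>, all taken modulo \<open>N\<close>, then \<open>x\<close> is a
  weak-(FC)-element for \<open>M/N\<close> and the Hilbert function of \<open>M/(N + xM)\<close> is the difference in direction \<open>i\<close> of
  that of \<open>M/N\<close>. Noetherian induction on \<open>N\<close> then shows that the Hilbert functions are eventually polynomial.

  If the difference in (iii) is constant, one more difference in direction \<open>0\<close> vanishes; by Nakayama's lemma
  \<open>W n\<close> is contained in \<open>(x\<^sub>1, \<dots>, x\<^sub>t)M\<close> for a weak-(FC)-sequence of type \<open>(k, k\<^sub>0 + 1)\<close>, and property (FC1) turns
  this into a joint reduction. Conversely, in a joint reduction \<open>y\<^sub>1, \<dots>, y\<^sub>t\<close> the element \<open>y\<^sub>1\<close> can be exchanged for a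
  filter-regular \<open>x\<close>: between the graded pieces of \<open>\<Oplus> W n / (J W n + \<Sum>\<^sub>j\<^sub>\<ge>\<^sub>2 y\<^sub>j W (n - e\<^bsub>i\<^sub>j\<^esub>))\<close> multiplication by
  \<open>y\<^sub>1\<close> is onto and by \<open>x\<close> is injective, so lengths agree and \<open>x\<close> is onto too. By induction the difference of type
  \<open>(k, k\<^sub>0 + 1)\<close> vanishes, so that of type \<open>(k, k\<^sub>0)\<close>, the Hilbert function of some \<open>M/N\<close>, does not depend on \<open>n\<^sub>0\<close>.
  It is decreasing in the other variables by Artin--Rees, and increasing because its differences are again lengths.
\<close>

section \<open>Ascending chains\<close>

text \<open>Kernels replace quotients because an iterated \<open>quot_module\<close> lives in ever
  new types of sets of sets, so that no induction along a sequence of elements could be stated with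
  it. With kernels only the submodule \<open>N\<close> grows; the translation back to
  \<open>quot_module\<close> comes at the end. Regularity is required for large multi-indices only,
  as an ideal \<open>F i\<close> need not contain a nonzerodivisor on \<open>M\<close> and may even
  be nilpotent. The saturation \<open>sat\<close> collects what a filter-regular element is allowed
  to kill, and it disappears in large degrees. Regularity on the pieces
  \<open>W n / W (n + e_j)\<close> makes the Hilbert functions subtract exactly and not just up to
  an error term. The exchange of \<open>y_1\<close> for \<open>x\<close> compares lengths, and
  quotients of \<open>W n\<close> by the remaining terms need not have finite length. Adding
  \<open>J W n\<close> makes the lengths finite; Nakayama's lemma removes this term again. A
  vanishing difference of type \<open>(k, k_0 + 1)\<close> says only that the one of type
  \<open>(k, k_0)\<close> is independent of \<open>n_0\<close>. Constancy in the other variables is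
  a separate statement, and it needs that difference to be a Hilbert function.\<close>

definition acc_on :: "('x::order) set \<Rightarrow> bool" where
  "acc_on S \<longleftrightarrow> (\<forall>C::nat \<Rightarrow> 'x. range C \<subseteq> S \<longrightarrow> mono C \<longrightarrow> (\<exists>n. \<forall>m\<ge>n. C m = C n))"

lemma acc_onD:
  assumes "acc_on S" "\<And>n. C n \<in> S" "\<And>n. C n \<le> C (Suc n)"
  shows "\<exists>n. \<forall>m\<ge>n. C m = C n"
proof -
  have "mono C" using assms(3) by (simp add: mono_iff_le_Suc)
  then show ?thesis using assms unfolding acc_on_def by blast
qed

lemma acc_on_wf:
  assumes "acc_on S"
  shows "wf {(y, x). x \<in> S \<and> y \<in> S \<and> x < y}"
  unfolding wf_iff_no_infinite_down_chain
proof
  assume "\<exists>f. \<forall>i. (f (Suc i), f i) \<in> {(y, x). x \<in> S \<and> y \<in> S \<and> x < y}"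
  then obtain f where f: "\<forall>i. f i \<in> S \<and> f (Suc i) \<in> S \<and> f i < f (Suc i)" by blast
  then have le: "f i \<le> f (Suc i)" for i by (blast intro: less_imp_le)
  have fS: "f i \<in> S" for i using f by blast
  obtain n where "\<forall>m\<ge>n. f m = f n"
    using acc_onD[of S f, OF assms fS le] by blast
  then have "f (Suc n) = f n" using le_SucI by blast
  then show False using f by (metis less_irrefl)
qed

text \<open>Maximal annihilators, maximal proper submodules and the top stage of a directed
  filtration are all obtained from this form of the chain condition.\<close>

lemma acc_on_max:
  assumes "acc_on S" "X \<subseteq> S" "X \<noteq> {}"
  obtains m where "m \<in> X" "\<And>x. x \<in> X \<Longrightarrow> m \<le> x \<Longrightarrow> x = m"
proof -
  obtain x where "x \<in> X" using assms(3) by blast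
  obtain m where m: "m \<in> X" "\<And>y. (y, m) \<in> {(y, x). x \<in> S \<and> y \<in> S \<and> x < y} \<Longrightarrow> y \<notin> X"
    using wfE_min[OF acc_on_wf[OF assms(1)] \<open>x \<in> X\<close>] by blast
  show ?thesis
  proof (rule that[OF m(1)])
    fix y assume "y \<in> X" "m \<le> y"
    then show "y = m" using m assms(2) by (auto simp: order_le_less)
  qed
qed

lemma acc_on_induct [consumes 2, case_names step]:
  assumes "acc_on S" "x \<in> S"
    and step: "\<And>x. x \<in> S \<Longrightarrow> (\<And>y. y \<in> S \<Longrightarrow> x < y \<Longrightarrow> P y) \<Longrightarrow> P x"
  shows "P x"
  using acc_on_wf[OF assms(1)] assms(2)
proof (induction x rule: wf_induct_rule)
  case (less x)
  then show ?case using step by blast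
qed

text \<open>The diagonal becomes stationary at some \<open>K\<close>. For \<open>s > K\<close> and
  \<open>k >= K\<close> the value \<open>C k s\<close> lies between \<open>C K K\<close> and a
  diagonal value, so all these values agree; the finitely many columns with \<open>s <= K\<close>
  stabilise separately. The bound must not depend on \<open>s\<close>, because in Hilbert's argument
  \<open>s\<close> runs over all degrees in the new variable.\<close>

lemma acc_on_double:
  assumes "acc_on S" and inS: "\<And>k s. C k s \<in> S"
    and m1: "\<And>k s. C k s \<le> C (Suc k) s" and m2: "\<And>k s. C k s \<le> C k (Suc s)"
  obtains K where "\<And>k s. k \<ge> K \<Longrightarrow> C k s = C K s"
proof -
  have mono1: "C k s \<le> C k' s" if "k \<le> k'" for k k' s
    using lift_Suc_mono_le[of "\<lambda>k. C k s", OF m1 that] .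
  have mono2: "C k s \<le> C k s'" if "s \<le> s'" for k s s'
    using lift_Suc_mono_le[of "\<lambda>s. C k s", OF m2 that] .
  have "C k k \<le> C (Suc k) (Suc k)" for k using m1 m2 by (meson order_trans)
  then obtain K where "\<forall>m\<ge>K. C m m = C K K"
    using acc_onD[OF assms(1), of "\<lambda>k. C k k"] inS by blast
  then have K: "\<And>m. m \<ge> K \<Longrightarrow> C m m = C K K" by blast
  have "\<exists>N. \<forall>k\<ge>N. C k s = C N s" for s
    using acc_onD[OF assms(1), of "\<lambda>k. C k s"] inS m1 by blast
  then obtain N where N: "\<And>s k. k \<ge> N s \<Longrightarrow> C k s = C (N s) s" by metis
  define L where "L = Max (insert K (N ` {..K}))"
  have LK: "K \<le> L" and LN: "s \<le> K \<Longrightarrow> N s \<le> L" for s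
    unfolding L_def by (simp, intro Max_ge) auto
  show thesis
  proof (rule that[of L])
    fix k s assume "L \<le> k"
    show "C k s = C L s"
    proof (cases "s \<le> K")
      case True
      then show ?thesis using N[of s k] N[of s L] LN[of s] \<open>L \<le> k\<close> by simp
    next
      case False
      have eq: "C j s = C K K" if "j \<ge> K" for j
      proof (rule antisym)
        have "C j s \<le> C (max j s) (max j s)"
          using mono1[of j "max j s" s] mono2[of s "max j s" "max j s"] by (meson max.cobounded1 max.cobounded2 order_trans)
        then show "C j s \<le> C K K" using K[of "max j s"] that by simp
        show "C K K \<le> C j s"
          using mono1[OF that, of K] mono2[of K s j] False by (meson nle_le order_trans)
      qed
      show ?thesis using eq[of k] eq[of L] LK \<open>L \<le> k\<close> by simp
    qed
  qed
qed

section \<open>Submodules\<close>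

context module
begin

lemma submod_carr: "submodule N R M \<Longrightarrow> v \<in> N \<Longrightarrow> v \<in> carrier M"
  using submoduleE(1) by blast

lemma submod_zero: "submodule N R M \<Longrightarrow> \<zero>\<^bsub>M\<^esub> \<in> N"
  using subgroup.one_closed[OF submodule.axioms(1)] by fastforce

lemma submod_diff: "submodule N R M \<Longrightarrow> v \<in> N \<Longrightarrow> w \<in> N \<Longrightarrow> v \<ominus>\<^bsub>M\<^esub> w \<in> N"
  by (simp add: M.minus_eq submoduleE(3) submoduleE(5))

lemmas submod = submod_carr submod_zero submod_diff submoduleE(3-5)

lemma submod_add_cancel:
  assumes "submodule N R M" "v \<in> N" "w \<in> carrier M" "v \<oplus>\<^bsub>M\<^esub> w \<in> N"
  shows "w \<in> N"
proof -
  have "w = (v \<oplus>\<^bsub>M\<^esub> w) \<ominus>\<^bsub>M\<^esub> v"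
    using assms submod_carr[OF assms(1,2)]
    by (simp add: M.minus_eq M.a_comm M.a_assoc M.r_neg1 M.r_neg)
  then show ?thesis using submod_diff assms by metis
qed

lemma submod_add_cancel_iff:
  assumes "submodule N R M" "v \<in> N" "w \<in> carrier M"
  shows "v \<oplus>\<^bsub>M\<^esub> w \<in> N \<longleftrightarrow> w \<in> N" "w \<oplus>\<^bsub>M\<^esub> v \<in> N \<longleftrightarrow> w \<in> N"
  using assms submod_add_cancel submoduleE(5) submod_carr by (metis M.a_comm)+

lemma submod_Int: "submodule N R M \<Longrightarrow> submodule P R M \<Longrightarrow> submodule (N \<inter> P) R M"
  by (intro submoduleI) (auto intro: submod)

lemma zero_submod: "submodule {\<zero>\<^bsub>M\<^esub>} R M"
  by (intro submoduleI) auto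

lemma mem_sum: "v \<in> N <+>\<^bsub>M\<^esub> P \<longleftrightarrow> (\<exists>a\<in>N. \<exists>b\<in>P. v = a \<oplus>\<^bsub>M\<^esub> b)"
  unfolding set_add_def' by auto

lemma sumI: "a \<in> N \<Longrightarrow> b \<in> P \<Longrightarrow> a \<oplus>\<^bsub>M\<^esub> b \<in> N <+>\<^bsub>M\<^esub> P"
  unfolding mem_sum by blast

lemma submod_sum:
  assumes N: "submodule N R M" and P: "submodule P R M"
  shows "submodule (N <+>\<^bsub>M\<^esub> P) R M"
proof (intro submoduleI)
  show "N <+>\<^bsub>M\<^esub> P \<subseteq> carrier M"
    using submod_carr[OF N] submod_carr[OF P] by (auto simp: mem_sum)
  have "\<zero>\<^bsub>M\<^esub> = \<zero>\<^bsub>M\<^esub> \<oplus>\<^bsub>M\<^esub> \<zero>\<^bsub>M\<^esub>" by simp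
  then show "\<zero>\<^bsub>M\<^esub> \<in> N <+>\<^bsub>M\<^esub> P" using submod_zero[OF N] submod_zero[OF P] unfolding mem_sum by blast
next
  fix a assume "a \<in> N <+>\<^bsub>M\<^esub> P"
  then obtain x y where xy: "x \<in> N" "y \<in> P" "a = x \<oplus>\<^bsub>M\<^esub> y" unfolding mem_sum by blast
  then have "\<ominus>\<^bsub>M\<^esub> a = \<ominus>\<^bsub>M\<^esub> x \<oplus>\<^bsub>M\<^esub> \<ominus>\<^bsub>M\<^esub> y"
    using assms submod_carr by (simp add: M.minus_add)
  then show "\<ominus>\<^bsub>M\<^esub> a \<in> N <+>\<^bsub>M\<^esub> P" using xy assms submoduleE(3) unfolding mem_sum by blast
next
  fix a b assume "a \<in> N <+>\<^bsub>M\<^esub> P" "b \<in> N <+>\<^bsub>M\<^esub> P"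
  then obtain x y x' y' where xy: "x \<in> N" "y \<in> P" "a = x \<oplus>\<^bsub>M\<^esub> y" "x' \<in> N" "y' \<in> P" "b = x' \<oplus>\<^bsub>M\<^esub> y'"
    unfolding mem_sum by blast
  then have "a \<oplus>\<^bsub>M\<^esub> b = (x \<oplus>\<^bsub>M\<^esub> x') \<oplus>\<^bsub>M\<^esub> (y \<oplus>\<^bsub>M\<^esub> y')"
    using submod_carr[OF N] submod_carr[OF P] by (simp add: M.add.m_assoc M.add.m_lcomm)
  then show "a \<oplus>\<^bsub>M\<^esub> b \<in> N <+>\<^bsub>M\<^esub> P" using xy assms submoduleE(5) unfolding mem_sum by blast
next
  fix r a assume r: "r \<in> carrier R" and "a \<in> N <+>\<^bsub>M\<^esub> P"
  then obtain x y where xy: "x \<in> N" "y \<in> P" "a = x \<oplus>\<^bsub>M\<^esub> y" unfolding mem_sum by blast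
  then have "r \<odot>\<^bsub>M\<^esub> a = r \<odot>\<^bsub>M\<^esub> x \<oplus>\<^bsub>M\<^esub> r \<odot>\<^bsub>M\<^esub> y"
    using submod_carr[OF N] submod_carr[OF P] r by (simp add: smult_r_distr)
  then show "r \<odot>\<^bsub>M\<^esub> a \<in> N <+>\<^bsub>M\<^esub> P" using xy r assms submoduleE(4) unfolding mem_sum by blast
qed

lemma sum_upper1:
  assumes "submodule N R M" "submodule P R M" shows "N \<subseteq> N <+>\<^bsub>M\<^esub> P"
proof
  fix v assume "v \<in> N"
  then have "v = v \<oplus>\<^bsub>M\<^esub> \<zero>\<^bsub>M\<^esub>" using assms submod_carr by simp
  then show "v \<in> N <+>\<^bsub>M\<^esub> P" using \<open>v \<in> N\<close> assms submod_zero unfolding mem_sum by blast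
qed

lemma sum_upper2:
  assumes "submodule N R M" "submodule P R M" shows "P \<subseteq> N <+>\<^bsub>M\<^esub> P"
proof
  fix v assume "v \<in> P"
  then have "v = \<zero>\<^bsub>M\<^esub> \<oplus>\<^bsub>M\<^esub> v" using assms submod_carr by simp
  then show "v \<in> N <+>\<^bsub>M\<^esub> P" using \<open>v \<in> P\<close> assms submod_zero unfolding mem_sum by blast
qed

lemma sum_least:
  assumes "submodule K R M" "N \<subseteq> K" "P \<subseteq> K" shows "N <+>\<^bsub>M\<^esub> P \<subseteq> K"
  using assms by (auto simp: mem_sum subset_iff intro!: submoduleE(5)[OF assms(1)])

lemma sum_mono: "N \<subseteq> N' \<Longrightarrow> P \<subseteq> P' \<Longrightarrow> N <+>\<^bsub>M\<^esub> P \<subseteq> N' <+>\<^bsub>M\<^esub> P'"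
  unfolding mem_sum[abs_def] subset_iff by blast

lemma sum_absorb:
  assumes "submodule N R M" "submodule P R M" "P \<subseteq> N"
  shows "N <+>\<^bsub>M\<^esub> P = N" "P <+>\<^bsub>M\<^esub> N = N"
  using assms sum_least[OF assms(1)] sum_upper1 sum_upper2 by (metis order_refl subset_antisym)+

lemma sum_comm: "submodule N R M \<Longrightarrow> submodule P R M \<Longrightarrow> N <+>\<^bsub>M\<^esub> P = P <+>\<^bsub>M\<^esub> N"
  unfolding mem_sum[abs_def] set_eq_iff using M.a_comm submod_carr by metis

lemma sum_assoc:
  assumes "submodule N R M" "submodule P R M" "submodule Q R M"
  shows "(N <+>\<^bsub>M\<^esub> P) <+>\<^bsub>M\<^esub> Q = N <+>\<^bsub>M\<^esub> (P <+>\<^bsub>M\<^esub> Q)"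
  using assms
  by (intro subset_antisym sum_least submod_sum)
     (meson sum_upper1 sum_upper2 submod_sum order_trans)+

lemma submod_modular:
  assumes "submodule N R M" "submodule P R M" "submodule K R M" "N \<subseteq> K"
  shows "K \<inter> (N <+>\<^bsub>M\<^esub> P) = N <+>\<^bsub>M\<^esub> (K \<inter> P)"
proof
  show "K \<inter> (N <+>\<^bsub>M\<^esub> P) \<subseteq> N <+>\<^bsub>M\<^esub> (K \<inter> P)"
  proof
    fix v assume v: "v \<in> K \<inter> (N <+>\<^bsub>M\<^esub> P)"
    then have "v \<in> N <+>\<^bsub>M\<^esub> P" by blast
    then obtain a b where ab: "a \<in> N" "b \<in> P" "v = a \<oplus>\<^bsub>M\<^esub> b" unfolding mem_sum by blast
    then have "b \<in> K" using v assms submod_add_cancel[OF assms(3), of a b] submod_carr by blast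
    then show "v \<in> N <+>\<^bsub>M\<^esub> (K \<inter> P)" using ab unfolding mem_sum by blast
  qed
  show "N <+>\<^bsub>M\<^esub> (K \<inter> P) \<subseteq> K \<inter> (N <+>\<^bsub>M\<^esub> P)"
    using assms by (intro sum_least submod_Int submod_sum) (auto intro: sum_upper1[THEN subsetD] sum_upper2[THEN subsetD])
qed

lemma submod_image:
  assumes x: "x \<in> carrier R" and N: "submodule N R M"
  shows "submodule ((\<odot>\<^bsub>M\<^esub>) x ` N) R M"
proof (intro submoduleI)
  show "(\<odot>\<^bsub>M\<^esub>) x ` N \<subseteq> carrier M" using x submod_carr[OF N] by auto
  show "\<zero>\<^bsub>M\<^esub> \<in> (\<odot>\<^bsub>M\<^esub>) x ` N" using x submod_zero[OF N] by (metis image_eqI smult_r_null)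
next
  fix a assume "a \<in> (\<odot>\<^bsub>M\<^esub>) x ` N"
  then obtain v where v: "v \<in> N" "a = x \<odot>\<^bsub>M\<^esub> v" by blast
  then have "\<ominus>\<^bsub>M\<^esub> a = x \<odot>\<^bsub>M\<^esub> (\<ominus>\<^bsub>M\<^esub> v)" using x submod_carr[OF N] by (simp add: smult_r_minus)
  then show "\<ominus>\<^bsub>M\<^esub> a \<in> (\<odot>\<^bsub>M\<^esub>) x ` N" using v submoduleE(3)[OF N] by blast
next
  fix a b assume "a \<in> (\<odot>\<^bsub>M\<^esub>) x ` N" "b \<in> (\<odot>\<^bsub>M\<^esub>) x ` N"
  then obtain v w where v: "v \<in> N" "a = x \<odot>\<^bsub>M\<^esub> v" "w \<in> N" "b = x \<odot>\<^bsub>M\<^esub> w" by blast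
  then have "a \<oplus>\<^bsub>M\<^esub> b = x \<odot>\<^bsub>M\<^esub> (v \<oplus>\<^bsub>M\<^esub> w)" using x submod_carr[OF N] by (simp add: smult_r_distr)
  then show "a \<oplus>\<^bsub>M\<^esub> b \<in> (\<odot>\<^bsub>M\<^esub>) x ` N" using v submoduleE(5)[OF N] by blast
next
  fix r a assume r: "r \<in> carrier R" and "a \<in> (\<odot>\<^bsub>M\<^esub>) x ` N"
  then obtain v where v: "v \<in> N" "a = x \<odot>\<^bsub>M\<^esub> v" by blast
  then have "r \<odot>\<^bsub>M\<^esub> a = x \<odot>\<^bsub>M\<^esub> (r \<odot>\<^bsub>M\<^esub> v)"
    using x r submod_carr[OF N] by (metis R.m_comm smult_assoc1)
  then show "r \<odot>\<^bsub>M\<^esub> a \<in> (\<odot>\<^bsub>M\<^esub>) x ` N" using v r submoduleE(4)[OF N] by blast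
qed

lemma smult_comm:
  "x \<in> carrier R \<Longrightarrow> y \<in> carrier R \<Longrightarrow> v \<in> carrier M \<Longrightarrow> x \<odot>\<^bsub>M\<^esub> (y \<odot>\<^bsub>M\<^esub> v) = y \<odot>\<^bsub>M\<^esub> (x \<odot>\<^bsub>M\<^esub> v)"
  by (metis R.m_comm smult_assoc1)

lemma smult_diff:
  "x \<in> carrier R \<Longrightarrow> v \<in> carrier M \<Longrightarrow> w \<in> carrier M \<Longrightarrow>
    x \<odot>\<^bsub>M\<^esub> (v \<ominus>\<^bsub>M\<^esub> w) = x \<odot>\<^bsub>M\<^esub> v \<ominus>\<^bsub>M\<^esub> x \<odot>\<^bsub>M\<^esub> w"
  by (simp add: M.minus_eq smult_r_distr smult_r_minus)

lemma submod_colon: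
  assumes x: "x \<in> carrier R" and N: "submodule N R M"
  shows "submodule {v \<in> carrier M. x \<odot>\<^bsub>M\<^esub> v \<in> N} R M"
  using x by (intro submoduleI)
    (auto simp: smult_r_distr smult_r_minus smult_comm[OF x] intro: submod[OF N])

lemma submod_all:
  assumes "\<And>f. f \<in> S \<Longrightarrow> submodule (P f) R M"
  shows "submodule {v \<in> carrier M. \<forall>f\<in>S. v \<in> P f} R M"
  using assms by (intro submoduleI) (auto intro: submod)

text \<open>With \<open>I = carrier R\<close> this is a full annihilator modulo \<open>N\<close>;
  with \<open>I = F i\<close> it is the trace of an annihilator on \<open>F i\<close>, the kind of
  ideal that a regular element has to avoid.\<close>

lemma ideal_ann:
  assumes v: "v \<in> carrier M" and N: "submodule N R M" and I: "ideal I R"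
  shows "ideal {x \<in> I. x \<odot>\<^bsub>M\<^esub> v \<in> N} R"
proof (rule idealI[OF R.ring_axioms])
  interpret ideal I R by fact
  note IC = a_subset
  have "\<zero> \<odot>\<^bsub>M\<^esub> v \<in> N" using v submod_zero[OF N] by (simp only: smult_l_null)
  then have "{x \<in> I. x \<odot>\<^bsub>M\<^esub> v \<in> N} \<noteq> {}" using zero_closed by blast
  then show "subgroup {x \<in> I. x \<odot>\<^bsub>M\<^esub> v \<in> N} (add_monoid R)"
    using v IC
    by (intro R.add.subgroupI)
       (auto simp: smult_l_distr smult_l_minus subset_iff simp flip: a_inv_def
             intro: submod[OF N])
next
  interpret ideal I R by fact
  fix a x assume ax: "a \<in> {x \<in> I. x \<odot>\<^bsub>M\<^esub> v \<in> N}" "x \<in> carrier R"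
  then have "a \<in> carrier R" using a_subset by blast
  then show "x \<otimes> a \<in> {x \<in> I. x \<odot>\<^bsub>M\<^esub> v \<in> N}" "a \<otimes> x \<in> {x \<in> I. x \<odot>\<^bsub>M\<^esub> v \<in> N}"
    using ax v by (auto simp: smult_assoc1 smult_comm[of a x] intro: I_l_closed I_r_closed submod[OF N])
qed

end

section \<open>Graded families of submodules\<close>

context module
begin

definition submods :: "'c set set" where
  "submods = {N. submodule N R M}"

text \<open>A pair \<open>(i, a)\<close> in \<open>gs\<close> stands for the ring element \<open>a\<close> placed in degree \<open>e\<^sub>i\<close>.\<close>

definition families :: "(nat \<times> 'a) list \<Rightarrow> ((nat \<Rightarrow> nat) \<Rightarrow> 'c set) \<Rightarrow> ((nat \<Rightarrow> nat) \<Rightarrow> 'c set) set" where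
  "families gs W = {N. (\<forall>n. submodule (N n) R M \<and> N n \<subseteq> W n) \<and>
     (\<forall>(i, a)\<in>set gs. \<forall>n. \<forall>u\<in>N n. a \<odot>\<^bsub>M\<^esub> u \<in> N (n(i := n i + 1)))}"

lemma familiesI:
  assumes "\<And>n. submodule (N n) R M" "\<And>n. N n \<subseteq> W n"
    and "\<And>i a n u. (i, a) \<in> set gs \<Longrightarrow> u \<in> N n \<Longrightarrow> a \<odot>\<^bsub>M\<^esub> u \<in> N (n(i := n i + 1))"
  shows "N \<in> families gs W"
  unfolding families_def using assms by blast

lemma familiesD:
  assumes "N \<in> families gs W"
  shows "submodule (N n) R M" "N n \<subseteq> W n"
    and "(i, a) \<in> set gs \<Longrightarrow> u \<in> N n \<Longrightarrow> a \<odot>\<^bsub>M\<^esub> u \<in> N (n(i := n i + 1))"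
  using assms unfolding families_def by blast+

text \<open>The component of degree \<open>n\<close> of the polynomials of degree less than
  \<open>s\<close> in \<open>a\<close> with coefficients from \<open>W\<close>, evaluated in
  \<open>M\<close>: the sum of \<open>a [^] t\<close> times \<open>W (n - t e_i)\<close> over
  \<open>t < s\<close>. The test \<open>s <= n i\<close> drops the terms whose coefficient would
  have negative degree; truncated subtraction would otherwise read them at coordinate zero.\<close>

fun low :: "nat \<Rightarrow> 'a \<Rightarrow> ((nat \<Rightarrow> nat) \<Rightarrow> 'c set) \<Rightarrow> nat \<Rightarrow> (nat \<Rightarrow> nat) \<Rightarrow> 'c set" where
  "low i a W 0 n = {\<zero>\<^bsub>M\<^esub>}"
| "low i a W (Suc s) n =
    (if s \<le> n i then (\<odot>\<^bsub>M\<^esub>) (a [^] s) ` W (n(i := n i - s)) <+>\<^bsub>M\<^esub> low i a W s n else low i a W s n)"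

lemma submod_low:
  assumes "a \<in> carrier R" "\<And>n. submodule (W n) R M"
  shows "submodule (low i a W s n) R M"
  by (induction s) (auto intro: zero_submod submod_sum submod_image assms)

lemma low_stable:
  assumes a: "a \<in> carrier R" and b: "b \<in> carrier R" and W: "\<And>n. submodule (W n) R M"
    and bW: "\<And>n u. u \<in> W n \<Longrightarrow> b \<odot>\<^bsub>M\<^esub> u \<in> W (n(j := n j + 1))"
    and u: "u \<in> low i a W s n"
  shows "b \<odot>\<^bsub>M\<^esub> u \<in> low i a W s (n(j := n j + 1))"
  using u
proof (induction s arbitrary: u)
  case 0
  then show ?case using b by simp
next
  case (Suc s)
  let ?n = "n(j := n j + 1)"
  have sub: "submodule (low i a W s ?n) R M" "submodule ((\<odot>\<^bsub>M\<^esub>) (a [^] s) ` W (?n(i := ?n i - s))) R M"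
    using a W by (auto intro!: submod_low submod_image)
  show ?case
  proof (cases "s \<le> n i")
    case True
    then obtain w v where wv: "w \<in> W (n(i := n i - s))" "v \<in> low i a W s n" "u = a [^] s \<odot>\<^bsub>M\<^esub> w \<oplus>\<^bsub>M\<^esub> v"
      using Suc.prems by (auto simp: mem_sum)
    have c: "w \<in> carrier M" "v \<in> carrier M"
      using wv submod_carr[OF W] submod_carr[OF submod_low[of a W, OF a W]] by blast+
    have eq: "(n(i := n i - s))(j := (n(i := n i - s)) j + 1) = ?n(i := ?n i - s)"
      using True by (auto simp: fun_eq_iff)
    have "b \<odot>\<^bsub>M\<^esub> w \<in> W (?n(i := ?n i - s))" using bW[OF wv(1)] unfolding eq .
    moreover have "b \<odot>\<^bsub>M\<^esub> u = a [^] s \<odot>\<^bsub>M\<^esub> (b \<odot>\<^bsub>M\<^esub> w) \<oplus>\<^bsub>M\<^esub> b \<odot>\<^bsub>M\<^esub> v"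
      using wv(3) a b c by (simp add: smult_r_distr smult_comm[of b])
    moreover have "b \<odot>\<^bsub>M\<^esub> v \<in> low i a W s ?n" using Suc.IH[OF wv(2)] .
    moreover have "s \<le> ?n i" by (rule order_trans[OF True]) simp
    ultimately show ?thesis unfolding low.simps by (auto intro!: sumI simp del: fun_upd_apply)
  next
    case False
    then have "u \<in> low i a W s n" using Suc.prems by simp
    then have "b \<odot>\<^bsub>M\<^esub> u \<in> low i a W s ?n" by (rule Suc.IH)
    then show ?thesis using sum_upper2[OF sub(2,1)] by (auto simp del: fun_upd_apply)
  qed
qed

text \<open>Multiplication by \<open>a\<close> raises the power of \<open>a\<close> and the degree
  in direction \<open>i\<close> together, so the test in \<open>low\<close> is preserved term by
  term.\<close>

lemma low_shift:
  assumes a: "a \<in> carrier R" and W: "\<And>n. submodule (W n) R M"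
    and u: "u \<in> low i a W s n"
  shows "a \<odot>\<^bsub>M\<^esub> u \<in> low i a W (Suc s) (n(i := n i + 1))"
  using u
proof (induction s arbitrary: u)
  case 0
  then show ?case
    using a submod_zero[OF submod_low[of a W, OF a W]] by (simp del: low.simps(2))
next
  case (Suc s)
  let ?n = "n(i := n i + 1)"
  have sub: "submodule (low i a W (Suc s) ?n) R M" "submodule ((\<odot>\<^bsub>M\<^esub>) (a [^] Suc s) ` W (?n(i := ?n i - Suc s))) R M"
    using a W by (blast intro: submod_low submod_image nat_pow_closed)+
  show ?case
  proof (cases "s \<le> n i")
    case True
    then obtain w v where wv: "w \<in> W (n(i := n i - s))" "v \<in> low i a W s n" "u = a [^] s \<odot>\<^bsub>M\<^esub> w \<oplus>\<^bsub>M\<^esub> v"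
      using Suc.prems by (auto simp: mem_sum)
    have c: "w \<in> carrier M" "v \<in> carrier M"
      using wv submod_carr[OF W] submod_carr[OF submod_low[of a W, OF a W]] by blast+
    have "a \<odot>\<^bsub>M\<^esub> u = a [^] Suc s \<odot>\<^bsub>M\<^esub> w \<oplus>\<^bsub>M\<^esub> a \<odot>\<^bsub>M\<^esub> v"
      using wv(3) a c by (simp add: smult_r_distr smult_assoc1 m_comm smult_comm[of a])
    moreover have "a \<odot>\<^bsub>M\<^esub> v \<in> low i a W (Suc s) ?n" using Suc.IH[OF wv(2)] .
    moreover have "w \<in> W (?n(i := ?n i - Suc s))" using wv(1) by simp
    ultimately have "a \<odot>\<^bsub>M\<^esub> u \<in> (\<odot>\<^bsub>M\<^esub>) (a [^] Suc s) ` W (?n(i := ?n i - Suc s)) <+>\<^bsub>M\<^esub> low i a W (Suc s) ?n"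
      by (auto intro!: sumI simp del: low.simps)
    then show ?thesis using True by (subst low.simps) simp
  next
    case False
    then have "u \<in> low i a W s n" using Suc.prems by simp
    then have "a \<odot>\<^bsub>M\<^esub> u \<in> low i a W (Suc s) ?n" by (rule Suc.IH)
    then show ?thesis using False by (subst low.simps) (simp del: low.simps(2) fun_upd_apply add: fun_upd_same)
  qed
qed

text \<open>Leading coefficients of degree \<open>s\<close> in \<open>a\<close>. An element of
  \<open>M\<close> may have many expressions as a polynomial in \<open>a\<close>, so its degree is
  not well defined; the coefficient is only required to be right up to lower terms.\<close>

definition lead :: "nat \<Rightarrow> 'a \<Rightarrow> ((nat \<Rightarrow> nat) \<Rightarrow> 'c set) \<Rightarrow> ((nat \<Rightarrow> nat) \<Rightarrow> 'c set) \<Rightarrow> nat \<Rightarrow> (nat \<Rightarrow> nat) \<Rightarrow> 'c set" where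
  "lead i a W N s n = {w \<in> W n. a [^] s \<odot>\<^bsub>M\<^esub> w \<in> N (n(i := n i + s)) <+>\<^bsub>M\<^esub> low i a W s (n(i := n i + s))}"

lemma submod_lead:
  assumes a: "a \<in> carrier R" and W: "\<And>n. submodule (W n) R M" and N: "\<And>n. submodule (N n) R M"
  shows "submodule (lead i a W N s n) R M"
proof -
  have "lead i a W N s n = W n \<inter> {w \<in> carrier M. a [^] s \<odot>\<^bsub>M\<^esub> w \<in> N (n(i := n i + s)) <+>\<^bsub>M\<^esub> low i a W s (n(i := n i + s))}"
    unfolding lead_def using submod_carr[OF W] by blast
  then show ?thesis
    using a W N by (simp add: submod_Int submod_colon submod_sum submod_low)
qed

text \<open>Multiplying by a member of \<open>gs\<close> acts on the coefficient and on the lower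
  terms alike, while multiplying by \<open>a\<close> turns a coefficient at \<open>a [^] s\<close>
  into one at the next power. Along a chain of families the leading coefficients therefore increase
  in both indices, as \<open>acc_on_double\<close> demands.\<close>

lemma lead_families:
  assumes a: "a \<in> carrier R" and gs: "snd ` set gs \<subseteq> carrier R"
    and W: "W \<in> families gs W" and N: "N \<in> families ((i, a) # gs) W'"
  shows "lead i a W N s \<in> families gs W" and "lead i a W N s n \<subseteq> lead i a W N (Suc s) n"
proof -
  have Ws: "submodule (W n) R M" for n using W by (auto simp: families_def)
  have Ns: "submodule (N n) R M" for n using N by (auto simp: families_def)
  note carr = submod_carr[OF Ws] submod_carr[OF Ns] submod_carr[OF submod_low[of a W, OF a Ws]]
  have "b \<odot>\<^bsub>M\<^esub> w \<in> lead i a W N s (n(j := n j + 1))" if jb: "(j, b) \<in> set gs" and w: "w \<in> lead i a W N s n" for j b n w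
  proof -
    have b: "b \<in> carrier R" using jb gs by force
    let ?n = "n(i := n i + s)"
    obtain x v where xv: "x \<in> N ?n" "v \<in> low i a W s ?n" "a [^] s \<odot>\<^bsub>M\<^esub> w = x \<oplus>\<^bsub>M\<^esub> v"
      using w by (auto simp: lead_def mem_sum)
    have w': "w \<in> W n" using w by (simp add: lead_def)
    have bW: "\<And>n u. u \<in> W n \<Longrightarrow> b \<odot>\<^bsub>M\<^esub> u \<in> W (n(j := n j + 1))"
      using jb W by (auto simp: families_def)
    have "a [^] s \<odot>\<^bsub>M\<^esub> (b \<odot>\<^bsub>M\<^esub> w) = b \<odot>\<^bsub>M\<^esub> x \<oplus>\<^bsub>M\<^esub> b \<odot>\<^bsub>M\<^esub> v"
      using carr xv w' a b by (simp add: smult_comm[of _ b] smult_r_distr)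
    moreover have "b \<odot>\<^bsub>M\<^esub> x \<in> N (?n(j := ?n j + 1))" using jb N xv(1) by (fastforce simp: families_def)
    moreover have "b \<odot>\<^bsub>M\<^esub> v \<in> low i a W s (?n(j := ?n j + 1))"
      using low_stable[of a b W j, OF a b Ws bW xv(2)] .
    moreover have "(n(j := n j + 1))(i := (n(j := n j + 1)) i + s) = ?n(j := ?n j + 1)"
      by (auto simp: fun_eq_iff)
    ultimately show ?thesis
      using bW[OF w'] unfolding lead_def by (auto intro!: sumI simp del: fun_upd_apply)
  qed
  then show "lead i a W N s \<in> families gs W"
    by (intro familiesI submod_lead[of a W N, OF a Ws Ns]) (simp_all add: lead_def)
  show "lead i a W N s n \<subseteq> lead i a W N (Suc s) n"
  proof
    fix w assume w: "w \<in> lead i a W N s n"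
    let ?n = "n(i := n i + s)"
    obtain x v where xv: "x \<in> N ?n" "v \<in> low i a W s ?n" "a [^] s \<odot>\<^bsub>M\<^esub> w = x \<oplus>\<^bsub>M\<^esub> v"
      using w by (auto simp: lead_def mem_sum)
    have w': "w \<in> W n" using w by (simp add: lead_def)
    have "a [^] Suc s \<odot>\<^bsub>M\<^esub> w = a \<odot>\<^bsub>M\<^esub> x \<oplus>\<^bsub>M\<^esub> a \<odot>\<^bsub>M\<^esub> v"
      using carr xv w' a by (simp add: smult_assoc1 smult_comm[of "a [^] s" a] smult_r_distr)
    moreover have "a \<odot>\<^bsub>M\<^esub> x \<in> N (?n(i := ?n i + 1))" by (rule familiesD(3)[where N = N and u = x, OF N]) (simp_all add: xv(1))
    moreover have "a \<odot>\<^bsub>M\<^esub> v \<in> low i a W (Suc s) (?n(i := ?n i + 1))"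
      using low_shift[of a W, OF a Ws xv(2)] .
    moreover have "?n(i := ?n i + 1) = n(i := n i + Suc s)" by auto
    ultimately show "w \<in> lead i a W N (Suc s) n"
      using w' unfolding lead_def by (auto intro!: sumI simp del: fun_upd_apply low.simps)
  qed
qed

text \<open>The key step of Hilbert's basis theorem: adjoining one more variable \<open>a\<close> of degree \<open>e\<^sub>i\<close>, the leading
  coefficients with respect to \<open>a\<close> determine a family among the larger ones.\<close>

lemma lead_determines:
  assumes a: "a \<in> carrier R" and W: "\<And>n. submodule (W n) R M"
    and N: "\<And>n. submodule (N n) R M" and N': "\<And>n. submodule (N' n) R M"
    and le: "\<And>n. N n \<subseteq> N' n" and lead: "\<And>s n. lead i a W N s n = lead i a W N' s n"
  shows "u \<in> N' n \<Longrightarrow> u \<in> low i a W s n \<Longrightarrow> u \<in> N n"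
proof (induction s arbitrary: u)
  case 0
  then show ?case using submod_zero[OF N] by simp
next
  case (Suc s)
  note carr = submod_carr[OF W] submod_carr[OF N] submod_carr[OF submod_low[of a W, OF a W]]
  show ?case
  proof (cases "s \<le> n i")
    case True
    then obtain w v where wv: "w \<in> W (n(i := n i - s))" "v \<in> low i a W s n" "u = a [^] s \<odot>\<^bsub>M\<^esub> w \<oplus>\<^bsub>M\<^esub> v"
      using Suc.prems by (auto simp: mem_sum)
    have c: "w \<in> carrier M" "v \<in> carrier M" "u \<in> carrier M" "a [^] s \<odot>\<^bsub>M\<^esub> w \<in> carrier M"
      using wv carr a by (auto intro!: smult_closed)
    have eq: "(n(i := n i - s))(i := (n(i := n i - s)) i + s) = n" using True by auto
    have "a [^] s \<odot>\<^bsub>M\<^esub> w = u \<oplus>\<^bsub>M\<^esub> \<ominus>\<^bsub>M\<^esub> v"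
      using wv(3) c by (simp add: M.a_assoc M.r_neg)
    \<comment> \<open>The coefficient of \<open>u\<close> at \<open>a [^] s\<close> is a leading
      coefficient for \<open>N'\<close>, hence for \<open>N\<close>. The element \<open>x\<close> of
      \<open>N\<close> that realises it differs from \<open>u\<close> only by lower terms, to which
      the induction hypothesis applies.\<close>
    then have "w \<in> lead i a W N' s (n(i := n i - s))"
      unfolding lead_def eq using wv(1) Suc.prems(1) submoduleE(3)[OF submod_low[of a W, OF a W] wv(2)]
      by (auto intro!: sumI)
    then have "w \<in> lead i a W N s (n(i := n i - s))" using lead by simp
    then obtain x v' where xv: "x \<in> N n" "v' \<in> low i a W s n" "a [^] s \<odot>\<^bsub>M\<^esub> w = x \<oplus>\<^bsub>M\<^esub> v'"
      unfolding lead_def eq by (auto simp: mem_sum)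
    have c': "x \<in> carrier M" "v' \<in> carrier M" using xv carr by auto
    have u: "u = x \<oplus>\<^bsub>M\<^esub> (v' \<oplus>\<^bsub>M\<^esub> v)" using wv(3) xv(3) c c' by (simp add: M.a_assoc)
    have "v' \<oplus>\<^bsub>M\<^esub> v \<in> N' n"
      using submod_add_cancel[OF N', of x n "v' \<oplus>\<^bsub>M\<^esub> v"] Suc.prems(1) u xv(1) le c c' by blast
    moreover have "v' \<oplus>\<^bsub>M\<^esub> v \<in> low i a W s n"
      using xv(2) wv(2) submoduleE(5)[OF submod_low[of a W, OF a W]] by blast
    ultimately have "v' \<oplus>\<^bsub>M\<^esub> v \<in> N n" using Suc.IH by blast
    then show ?thesis using u xv(1) submoduleE(5)[OF N] by blast
  next
    case False
    then show ?thesis using Suc by simp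
  qed
qed

text \<open>\<open>Suc (n i)\<close> is the number of powers of \<open>a\<close> that fit into
  degree \<open>n\<close>, so \<open>low\<close> is here the full extension of \<open>W\<close> by
  the variable \<open>a\<close>.\<close>

lemma hilbert_basis_step:
  assumes a: "a \<in> carrier R" and gs: "snd ` set gs \<subseteq> carrier R"
    and W: "W \<in> families gs W" and acc: "acc_on (families gs W)"
  shows "acc_on (families ((i, a) # gs) (\<lambda>n. low i a W (Suc (n i)) n))"
  unfolding acc_on_def
proof (intro allI impI)
  let ?W = "\<lambda>n. low i a W (Suc (n i)) n"
  fix C :: "nat \<Rightarrow> (nat \<Rightarrow> nat) \<Rightarrow> 'c set"
  assume "range C \<subseteq> families ((i, a) # gs) ?W" and "mono C"
  then have C: "C k \<in> families ((i, a) # gs) ?W" for k by blast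
  have Ck: "C k n \<subseteq> C k' n" if "k \<le> k'" for k k' n
    using monoD[OF \<open>mono C\<close> that] by (simp add: le_fun_def)
  have Ws: "submodule (W n) R M" for n using W by (auto simp: families_def)
  have Cs: "submodule (C k n) R M" for k n using C[of k] by (auto simp: families_def)
  obtain K where K: "\<And>k s. k \<ge> K \<Longrightarrow> lead i a W (C k) s = lead i a W (C K) s"
  proof (rule acc_on_double[OF acc, of "\<lambda>k s. lead i a W (C k) s"])
    show "lead i a W (C k) s \<in> families gs W" for k s
      by (rule lead_families(1)[OF a gs W C])
    show "lead i a W (C k) s \<le> lead i a W (C k) (Suc s)" for k s
      using lead_families(2)[OF a gs W C] by (simp add: le_fun_def)
    show "lead i a W (C k) s \<le> lead i a W (C (Suc k)) s" for k s
      unfolding le_fun_def lead_def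
      using sum_mono[OF Ck[of k "Suc k"] order_refl] by fastforce
  qed blast
  have "C k n = C K n" if "k \<ge> K" for k n
  proof
    show "C K n \<subseteq> C k n" using Ck that .
    show "C k n \<subseteq> C K n"
    proof
      fix u assume u: "u \<in> C k n"
      moreover have "u \<in> ?W n" using u C[of k] unfolding families_def by blast
      moreover have "lead i a W (C K) s n = lead i a W (C k) s n" for s n by (simp add: K[OF that])
      ultimately show "u \<in> C K n"
        using lead_determines[of a W "C K" "C k" i u n "Suc (n i)", OF a] Ws Cs Ck[OF that] by blast
    qed
  qed
  then show "\<exists>n. \<forall>m\<ge>n. C m = C n" by blast
qed

lemma low_families:
  assumes a: "a \<in> carrier R" and gs: "snd ` set gs \<subseteq> carrier R" and W: "W \<in> families gs W"
  shows "(\<lambda>n. low i a W (Suc (n i)) n) \<in> families ((i, a) # gs) (\<lambda>n. low i a W (Suc (n i)) n)"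
proof -
  have Ws: "submodule (W n) R M" for n using W by (auto simp: families_def)
  have "b \<odot>\<^bsub>M\<^esub> u \<in> low i a W (Suc ((n(j := n j + 1)) i)) (n(j := n j + 1))"
    if jb: "(j, b) \<in> set gs" and u: "u \<in> low i a W (Suc (n i)) n" for j b n u
  proof -
    let ?n = "n(j := n j + 1)"
    have b: "b \<in> carrier R" using jb gs by force
    have "b \<odot>\<^bsub>M\<^esub> u \<in> low i a W (Suc (n i)) ?n"
      using low_stable[of a b W j, OF a b Ws _ u] jb W by (auto simp: families_def)
    moreover have "low i a W (Suc (n i)) ?n \<subseteq> low i a W (Suc (?n i)) ?n"
    proof (cases "i = j")
      case True
      then have "?n i = Suc (n i)" by simp
      then show ?thesis
        unfolding \<open>?n i = Suc (n i)\<close> low.simps(2)[of i a W "Suc (n i)"]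
        using sum_upper2[OF submod_image[OF nat_pow_closed[OF a, of "Suc (n i)"] Ws] submod_low[of a W, OF a Ws]]
        by (simp del: low.simps)
    qed simp
    ultimately show ?thesis by blast
  qed
  moreover have "a \<odot>\<^bsub>M\<^esub> u \<in> low i a W (Suc ((n(i := n i + 1)) i)) (n(i := n i + 1))"
    if u: "u \<in> low i a W (Suc (n i)) n" for n u
    using low_shift[of a W, OF a Ws u] by simp
  ultimately show ?thesis
    by (intro familiesI submod_low[of a W, OF a Ws]) (auto simp del: low.simps fun_upd_apply)
qed

text \<open>The Rees module, built from \<open>M\<close> in degree zero by adjoining one generator
  after the other. Degrees are functions on all of \<open>nat\<close> here, and the starting degree
  must vanish in every coordinate; \<open>acc_gfams\<close> has to account for this.\<close>

fun rees :: "(nat \<times> 'a) list \<Rightarrow> (nat \<Rightarrow> nat) \<Rightarrow> 'c set" where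
  "rees [] = (\<lambda>n. if n = (\<lambda>_. 0) then carrier M else {\<zero>\<^bsub>M\<^esub>})"
| "rees ((i, a) # gs) = (\<lambda>n. low i a (rees gs) (Suc (n i)) n)"

lemma rees_families:
  assumes "snd ` set gs \<subseteq> carrier R" and acc: "acc_on submods"
  shows "rees gs \<in> families gs (rees gs) \<and> acc_on (families gs (rees gs))"
  using assms(1)
proof (induction gs)
  case Nil
  have "rees [] \<in> families [] (rees [])"
    by (auto simp: families_def carrier_is_submodule zero_submod)
  moreover have "acc_on (families [] (rees []))"
    unfolding acc_on_def
  proof (intro allI impI)
    fix C :: "nat \<Rightarrow> (nat \<Rightarrow> nat) \<Rightarrow> 'c set"
    assume "range C \<subseteq> families [] (rees [])" and "mono C"
    then have C: "C k \<in> families [] (rees [])" for k by blast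
    have "C k (\<lambda>_. 0) \<in> submods" for k using C by (auto simp: families_def submods_def)
    moreover have "C k (\<lambda>_. 0) \<subseteq> C (Suc k) (\<lambda>_. 0)" for k
      using \<open>mono C\<close> by (simp add: mono_iff_le_Suc le_fun_def)
    ultimately obtain K where K: "\<forall>k\<ge>K. C k (\<lambda>_. 0) = C K (\<lambda>_. 0)"
      using acc_onD[OF acc, of "\<lambda>k. C k (\<lambda>_. 0)"] by blast
    have "C k n = {\<zero>\<^bsub>M\<^esub>}" if "n \<noteq> (\<lambda>_. 0)" for k n
    proof -
      have "submodule (C k n) R M" "C k n \<subseteq> rees [] n" using C[of k] by (auto simp: families_def)
      then show ?thesis using that submod_zero by auto
    qed
    then have "C k = C K" if "k \<ge> K" for k
      using K that by (metis (full_types) ext)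
    then show "\<exists>n. \<forall>m\<ge>n. C m = C n" by (intro exI[of _ K]) blast
  qed
  ultimately show ?case by blast
next
  case (Cons g gs)
  obtain i a where g: "g = (i, a)" by force
  have a: "a \<in> carrier R" and gs: "snd ` set gs \<subseteq> carrier R" using Cons.prems g by auto
  have IH: "rees gs \<in> families gs (rees gs)" "acc_on (families gs (rees gs))" using Cons.IH gs by auto
  show ?case
    unfolding g rees.simps
    using low_families[OF a gs IH(1), of i] hilbert_basis_step[OF a gs IH, of i] by blast
qed

end

section \<open>Products of ideals and submodules\<close>

context module
begin

lemma gen_submodule_upper: "S \<subseteq> gen_submodule R M S"
  unfolding gen_submodule_def by blast

lemma gen_submodule_least: "submodule K R M \<Longrightarrow> S \<subseteq> K \<Longrightarrow> gen_submodule R M S \<subseteq> K"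
  unfolding gen_submodule_def by blast

lemma gen_submodule_submod:
  assumes "S \<subseteq> carrier M"
  shows "submodule (gen_submodule R M S) R M"
  using assms carrier_is_submodule unfolding gen_submodule_def
  by (intro submoduleI) (auto intro: submod)

lemma ideal_carr: "ideal I R \<Longrightarrow> a \<in> I \<Longrightarrow> a \<in> carrier R"
  using ideal.Icarr by metis

lemma ideal_smult_submod:
  assumes "\<aa> \<subseteq> carrier R" "N \<subseteq> carrier M"
  shows "submodule (ideal_smult R M \<aa> N) R M"
  unfolding ideal_smult_def using assms by (intro gen_submodule_submod) (auto simp: subset_iff)

lemma ideal_smult_I: "a \<in> \<aa> \<Longrightarrow> v \<in> N \<Longrightarrow> a \<odot>\<^bsub>M\<^esub> v \<in> ideal_smult R M \<aa> N"
  unfolding ideal_smult_def by (intro subsetD[OF gen_submodule_upper]) blast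

lemma ideal_smult_least:
  "submodule K R M \<Longrightarrow> (\<And>a v. a \<in> \<aa> \<Longrightarrow> v \<in> N \<Longrightarrow> a \<odot>\<^bsub>M\<^esub> v \<in> K) \<Longrightarrow> ideal_smult R M \<aa> N \<subseteq> K"
  unfolding ideal_smult_def by (intro gen_submodule_least) auto

lemma ideal_smult_mono:
  assumes "\<aa>' \<subseteq> carrier R" "N' \<subseteq> carrier M" "\<aa> \<subseteq> \<aa>'" "N \<subseteq> N'"
  shows "ideal_smult R M \<aa> N \<subseteq> ideal_smult R M \<aa>' N'"
  using assms by (intro ideal_smult_least ideal_smult_submod) (auto intro: ideal_smult_I)

lemma ideal_smult_le:
  assumes "submodule N R M" "\<aa> \<subseteq> carrier R"
  shows "ideal_smult R M \<aa> N \<subseteq> N"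
  using assms by (intro ideal_smult_least) (auto intro: submod)

lemma ideal_smult_carrier:
  assumes "submodule N R M"
  shows "ideal_smult R M (carrier R) N = N"
proof
  show "N \<subseteq> ideal_smult R M (carrier R) N"
  proof
    fix v assume "v \<in> N"
    then show "v \<in> ideal_smult R M (carrier R) N"
      using ideal_smult_I[of "\<one>" "carrier R" v N] submod_carr[OF assms] by simp
  qed
qed (simp add: ideal_smult_le assms)

lemma ideal_smult_prod:
  assumes \<aa>: "ideal \<aa> R" and \<bb>: "ideal \<bb> R" and N: "submodule N R M"
  shows "ideal_smult R M (ideal_prod R \<aa> \<bb>) N = ideal_smult R M \<aa> (ideal_smult R M \<bb> N)"
proof
  have sb: "submodule (ideal_smult R M \<bb> N) R M"
    using ideal_carr[OF \<bb>] submod_carr[OF N] by (intro ideal_smult_submod) auto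
  have sab: "submodule (ideal_smult R M \<aa> (ideal_smult R M \<bb> N)) R M"
    using ideal_carr[OF \<aa>] submod_carr[OF sb] by (intro ideal_smult_submod) auto
  have sp: "submodule (ideal_smult R M (ideal_prod R \<aa> \<bb>) N) R M"
    using ideal_prod_in_carrier[OF \<aa> \<bb>] submod_carr[OF N] by (intro ideal_smult_submod) auto
  show "ideal_smult R M (ideal_prod R \<aa> \<bb>) N \<subseteq> ideal_smult R M \<aa> (ideal_smult R M \<bb> N)"
  proof (rule ideal_smult_least[OF sab])
    fix f v assume "f \<in> ideal_prod R \<aa> \<bb>" and v: "v \<in> N"
    then show "f \<odot>\<^bsub>M\<^esub> v \<in> ideal_smult R M \<aa> (ideal_smult R M \<bb> N)"
    proof (induction f rule: ideal_prod.induct)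
      case (prod i j)
      then show ?case
        using ideal_carr[OF \<aa>] ideal_carr[OF \<bb>] submod_carr[OF N v] v
        by (simp add: smult_assoc1 ideal_smult_I)
    next
      case (sum s t)
      have "s \<in> carrier R" "t \<in> carrier R" using sum ideal_prod_in_carrier[OF \<aa> \<bb>] by auto
      then show ?case using sum submod_carr[OF N v] submoduleE(5)[OF sab] by (simp add: smult_l_distr)
    qed
  qed
  show "ideal_smult R M \<aa> (ideal_smult R M \<bb> N) \<subseteq> ideal_smult R M (ideal_prod R \<aa> \<bb>) N"
  proof (rule ideal_smult_least[OF sp])
    fix a w assume a: "a \<in> \<aa>" and w: "w \<in> ideal_smult R M \<bb> N"
    have ac: "a \<in> carrier R" using a ideal_carr[OF \<aa>] by blast
    have "ideal_smult R M \<bb> N \<subseteq> {w \<in> carrier M. a \<odot>\<^bsub>M\<^esub> w \<in> ideal_smult R M (ideal_prod R \<aa> \<bb>) N}"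
    proof (rule ideal_smult_least[OF submod_colon[OF ac sp]])
      fix b v assume b: "b \<in> \<bb>" and v: "v \<in> N"
      have "a \<odot>\<^bsub>M\<^esub> (b \<odot>\<^bsub>M\<^esub> v) = (a \<otimes> b) \<odot>\<^bsub>M\<^esub> v"
        using ac ideal_carr[OF \<bb> b] submod_carr[OF N v] by (simp add: smult_assoc1)
      then show "b \<odot>\<^bsub>M\<^esub> v \<in> {w \<in> carrier M. a \<odot>\<^bsub>M\<^esub> w \<in> ideal_smult R M (ideal_prod R \<aa> \<bb>) N}"
        using ideal_smult_I[OF ideal_prod.prod[OF a b] v] ideal_carr[OF \<bb> b] submod_carr[OF N v] by auto
    qed
    then show "a \<odot>\<^bsub>M\<^esub> w \<in> ideal_smult R M (ideal_prod R \<aa> \<bb>) N" using w by blast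
  qed
qed

lemma ideal_image_submod:
  assumes I: "ideal I R" and u: "u \<in> carrier M"
  shows "submodule ((\<lambda>g. g \<odot>\<^bsub>M\<^esub> u) ` I) R M"
proof -
  interpret ideal I R by fact
  have c: "a \<in> carrier R" if "a \<in> I" for a using that by (rule Icarr)
  show ?thesis
  proof (intro submoduleI)
    show "(\<lambda>g. g \<odot>\<^bsub>M\<^esub> u) ` I \<subseteq> carrier M" using c u by auto
    show "\<zero>\<^bsub>M\<^esub> \<in> (\<lambda>g. g \<odot>\<^bsub>M\<^esub> u) ` I"
      using u by (intro image_eqI[of _ _ \<zero>]) auto
  next
    fix x assume "x \<in> (\<lambda>g. g \<odot>\<^bsub>M\<^esub> u) ` I"
    then obtain g where g: "g \<in> I" "x = g \<odot>\<^bsub>M\<^esub> u" by blast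
    show "\<ominus>\<^bsub>M\<^esub> x \<in> (\<lambda>g. g \<odot>\<^bsub>M\<^esub> u) ` I"
      using g c u by (intro image_eqI[of _ _ "\<ominus> g"]) (auto simp: smult_l_minus)
  next
    fix x y assume "x \<in> (\<lambda>g. g \<odot>\<^bsub>M\<^esub> u) ` I" "y \<in> (\<lambda>g. g \<odot>\<^bsub>M\<^esub> u) ` I"
    then obtain g h where g: "g \<in> I" "x = g \<odot>\<^bsub>M\<^esub> u" "h \<in> I" "y = h \<odot>\<^bsub>M\<^esub> u" by blast
    show "x \<oplus>\<^bsub>M\<^esub> y \<in> (\<lambda>g. g \<odot>\<^bsub>M\<^esub> u) ` I"
      using g c u by (intro image_eqI[of _ _ "g \<oplus> h"]) (auto simp: smult_l_distr)
  next
    fix r x assume r: "r \<in> carrier R" and "x \<in> (\<lambda>g. g \<odot>\<^bsub>M\<^esub> u) ` I"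
    then obtain g where g: "g \<in> I" "x = g \<odot>\<^bsub>M\<^esub> u" by blast
    show "r \<odot>\<^bsub>M\<^esub> x \<in> (\<lambda>g. g \<odot>\<^bsub>M\<^esub> u) ` I"
      using g c u r by (intro image_eqI[of _ _ "r \<otimes> g"]) (auto simp: smult_assoc1 intro: I_l_closed)
  qed
qed

lemma ideal_conductor:
  assumes N: "submodule N R M" and K: "submodule K R M"
  shows "ideal {r \<in> carrier R. \<forall>v\<in>N. r \<odot>\<^bsub>M\<^esub> v \<in> K} R"
proof (rule idealI[OF R.ring_axioms])
  have "\<zero> \<odot>\<^bsub>M\<^esub> v \<in> K" if "v \<in> N" for v using submod_zero[OF K] submod_carr[OF N that] by simp
  then have "{r \<in> carrier R. \<forall>v\<in>N. r \<odot>\<^bsub>M\<^esub> v \<in> K} \<noteq> {}" using R.zero_closed by blast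
  then show "subgroup {r \<in> carrier R. \<forall>v\<in>N. r \<odot>\<^bsub>M\<^esub> v \<in> K} (add_monoid R)"
    using submod_carr[OF N]
    by (intro R.add.subgroupI)
       (auto simp: smult_l_distr smult_l_minus simp flip: a_inv_def intro: submod[OF K])
next
  fix a x assume ax: "a \<in> {r \<in> carrier R. \<forall>v\<in>N. r \<odot>\<^bsub>M\<^esub> v \<in> K}" "x \<in> carrier R"
  then show "x \<otimes> a \<in> {r \<in> carrier R. \<forall>v\<in>N. r \<odot>\<^bsub>M\<^esub> v \<in> K}" "a \<otimes> x \<in> {r \<in> carrier R. \<forall>v\<in>N. r \<odot>\<^bsub>M\<^esub> v \<in> K}"
    using submod_carr[OF N] by (auto simp: smult_assoc1 smult_comm[of a x] intro: submod[OF K])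
qed

text \<open>The ring elements that carry \<open>N\<close> into \<open>K\<close> form an ideal, so it
  suffices to test generators.\<close>

lemma Idl_smult_mem:
  assumes G: "G \<subseteq> carrier R" and r: "r \<in> Idl G" and N: "submodule N R M" and K: "submodule K R M"
    and gen: "\<And>a v. a \<in> G \<Longrightarrow> v \<in> N \<Longrightarrow> a \<odot>\<^bsub>M\<^esub> v \<in> K" and v: "v \<in> N"
  shows "r \<odot>\<^bsub>M\<^esub> v \<in> K"
proof -
  have "Idl G \<subseteq> {r \<in> carrier R. \<forall>v\<in>N. r \<odot>\<^bsub>M\<^esub> v \<in> K}"
    using G gen by (intro genideal_minimal ideal_conductor N K) blast
  then show ?thesis using r v by blast
qed

text \<open>Among nested submodules of \<open>Rv + V\<close>, a submodule \<open>C\<close> is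
  determined by the ideal of all \<open>g\<close> with \<open>g v\<close> in \<open>C + V\<close>
  together with the intersection of \<open>C\<close> and \<open>V\<close>. Both stabilise along a
  chain.\<close>

lemma acc_on_submods_sum:
  assumes acc: "acc_on {I. ideal I R}" and v: "v \<in> carrier M" and V: "submodule V R M"
    and accV: "acc_on {N. submodule N R M \<and> N \<subseteq> V}"
  shows "acc_on {N. submodule N R M \<and> N \<subseteq> (\<lambda>g. g \<odot>\<^bsub>M\<^esub> v) ` carrier R <+>\<^bsub>M\<^esub> V}"
  unfolding acc_on_def
proof (intro allI impI)
  fix C :: "nat \<Rightarrow> 'c set"
  assume "range C \<subseteq> {N. submodule N R M \<and> N \<subseteq> (\<lambda>g. g \<odot>\<^bsub>M\<^esub> v) ` carrier R <+>\<^bsub>M\<^esub> V}" and "mono C"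
  then have C: "submodule (C k) R M" "C k \<subseteq> (\<lambda>g. g \<odot>\<^bsub>M\<^esub> v) ` carrier R <+>\<^bsub>M\<^esub> V" for k by auto
  have Ck: "C k \<subseteq> C k'" if "k \<le> k'" for k k' using monoD[OF \<open>mono C\<close> that] .
  define D where "D k = {g \<in> carrier R. g \<odot>\<^bsub>M\<^esub> v \<in> C k <+>\<^bsub>M\<^esub> V}" for k
  have "ideal (D k) R" for k
    unfolding D_def using ideal_ann[OF v submod_sum[OF C(1) V] oneideal] .
  moreover have "D k \<subseteq> D (Suc k)" for k
    unfolding D_def using sum_mono[OF Ck[of k "Suc k"], of V V] by auto
  ultimately obtain K1 where K1: "\<forall>k\<ge>K1. D k = D K1"
    using acc_onD[OF acc, of D] by blast
  have "submodule (C k \<inter> V) R M" "C k \<inter> V \<subseteq> C (Suc k) \<inter> V" for k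
    using Ck[of k "Suc k"] submod_Int[OF C(1) V] by auto
  then obtain K2 where K2: "\<forall>k\<ge>K2. C k \<inter> V = C K2 \<inter> V"
    using acc_onD[OF accV, of "\<lambda>k. C k \<inter> V"] by blast
  define K where "K = max K1 K2"
  have "C k = C K" if k: "k \<ge> K" for k
  proof
    show "C K \<subseteq> C k" using Ck k .
    show "C k \<subseteq> C K"
    proof
      fix u assume u: "u \<in> C k"
      then obtain g w where gw: "g \<in> carrier R" "w \<in> V" "u = g \<odot>\<^bsub>M\<^esub> v \<oplus>\<^bsub>M\<^esub> w"
        using C(2)[of k] by (auto simp: mem_sum subset_iff)
      have c: "u \<in> carrier M" "w \<in> carrier M" "g \<odot>\<^bsub>M\<^esub> v \<in> carrier M"
        using u gw v submod_carr[OF C(1)] submod_carr[OF V] by auto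
      have "g \<odot>\<^bsub>M\<^esub> v = u \<oplus>\<^bsub>M\<^esub> \<ominus>\<^bsub>M\<^esub> w" using gw c by (simp add: M.a_assoc M.r_neg)
      then have "g \<in> D k" unfolding D_def using gw(1) sumI[OF u submoduleE(3)[OF V gw(2)]] by auto
      moreover have "D k = D K" using K1 k unfolding K_def by (metis max.boundedE max.cobounded1)
      ultimately have "g \<in> D K" by simp
      then obtain x w' where xw: "x \<in> C K" "w' \<in> V" "g \<odot>\<^bsub>M\<^esub> v = x \<oplus>\<^bsub>M\<^esub> w'"
        unfolding D_def by (auto simp: mem_sum)
      have c': "x \<in> carrier M" "w' \<in> carrier M" using xw submod_carr[OF C(1)] submod_carr[OF V] by auto
      have u2: "u = x \<oplus>\<^bsub>M\<^esub> (w' \<oplus>\<^bsub>M\<^esub> w)" using gw(3) xw(3) c c' by (simp add: M.a_assoc)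
      have "w' \<oplus>\<^bsub>M\<^esub> w \<in> C k"
        using submod_add_cancel[OF C(1), of x k "w' \<oplus>\<^bsub>M\<^esub> w"] u u2 xw(1) Ck[OF k] c c' by blast
      moreover have "w' \<oplus>\<^bsub>M\<^esub> w \<in> V" using xw gw submoduleE(5)[OF V] by blast
      moreover have "C k \<inter> V = C K \<inter> V" using K2 k unfolding K_def by (metis max.boundedE max.cobounded2)
      ultimately have "w' \<oplus>\<^bsub>M\<^esub> w \<in> C K" by blast
      then show "u \<in> C K" using u2 xw(1) submoduleE(5)[OF C(1)] by blast
    qed
  qed
  then show "\<exists>n. \<forall>m\<ge>n. C m = C n" by blast
qed

text \<open>Generators are added one at a time to a submodule \<open>V\<close> that inherits the
  chain condition; once \<open>V\<close> contains all of them it is the whole module.\<close>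

lemma fin_gen_acc:
  assumes acc: "acc_on {I. ideal I R}" and fg: "fin_gen_module R M"
  shows "acc_on submods"
proof -
  obtain S where S: "finite S" "S \<subseteq> carrier M" "gen_submodule R M S = carrier M"
    using fg unfolding fin_gen_module_def by blast
  have "\<exists>V. submodule V R M \<and> S \<subseteq> V \<and> acc_on {N. submodule N R M \<and> N \<subseteq> V}"
    using S(1,2)
  proof (induction S)
    case empty
    have "acc_on {N. submodule N R M \<and> N \<subseteq> {\<zero>\<^bsub>M\<^esub>}}"
    proof -
      have "{N. submodule N R M \<and> N \<subseteq> {\<zero>\<^bsub>M\<^esub>}} \<subseteq> {{\<zero>\<^bsub>M\<^esub>}}"
        using submod_zero by blast
      then have "C m = C 0" if "range C \<subseteq> {N. submodule N R M \<and> N \<subseteq> {\<zero>\<^bsub>M\<^esub>}}" for C :: "nat \<Rightarrow> 'c set" and m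
      proof -
        have "C k \<in> {{\<zero>\<^bsub>M\<^esub>}}" for k
          using that \<open>{N. submodule N R M \<and> N \<subseteq> {\<zero>\<^bsub>M\<^esub>}} \<subseteq> {{\<zero>\<^bsub>M\<^esub>}}\<close> by blast
        then show ?thesis by simp
      qed
      then show ?thesis unfolding acc_on_def by (intro allI impI exI[of _ 0])
    qed
    then show ?case using zero_submod by blast
  next
    case (insert v S)
    then obtain V where V: "submodule V R M" "S \<subseteq> V" "acc_on {N. submodule N R M \<and> N \<subseteq> V}" by blast
    have v: "v \<in> carrier M" using insert by auto
    let ?V = "(\<lambda>g. g \<odot>\<^bsub>M\<^esub> v) ` carrier R <+>\<^bsub>M\<^esub> V"
    have sv: "submodule ((\<lambda>g. g \<odot>\<^bsub>M\<^esub> v) ` carrier R) R M" by (rule ideal_image_submod[OF oneideal v])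
    have "v \<in> (\<lambda>g. g \<odot>\<^bsub>M\<^esub> v) ` carrier R" using v by (intro image_eqI[of _ _ \<one>]) auto
    then have "insert v S \<subseteq> ?V"
      using sum_upper1[OF sv V(1)] sum_upper2[OF sv V(1)] V(2) by blast
    then show ?case using acc_on_submods_sum[OF acc v V(1,3)] submod_sum[OF sv V(1)] by blast
  qed
  then obtain V where V: "submodule V R M" "S \<subseteq> V" "acc_on {N. submodule N R M \<and> N \<subseteq> V}" by blast
  have "carrier M \<subseteq> V" using S(3) gen_submodule_least[OF V(1,2)] by simp
  then have "{N. submodule N R M \<and> N \<subseteq> V} = submods"
    unfolding submods_def using submod_carr by blast
  then show ?thesis using V(3) by simp
qed

end

lemma (in noetherian_ring) acc_on_ideals: "acc_on {I. ideal I R}"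
  unfolding acc_on_def
proof (intro allI impI)
  fix C :: "nat \<Rightarrow> 'a set"
  assume C: "range C \<subseteq> {I. ideal I R}" and "mono C"
  have "subset.chain {I. ideal I R} (range C)"
    unfolding pred_on.chain_def
  proof (intro conjI ballI)
    fix X Y assume "X \<in> range C" "Y \<in> range C"
    then obtain i j where "X = C i" "Y = C j" by blast
    then have "X \<subseteq> Y \<or> Y \<subseteq> X"
      using monoD[OF \<open>mono C\<close>, of i j] monoD[OF \<open>mono C\<close>, of j i] linorder_le_cases[of i j] by auto
    then show "(\<subset>)\<^sup>=\<^sup>= X Y \<or> (\<subset>)\<^sup>=\<^sup>= Y X" by auto
  qed (use C in blast)
  then have "\<Union>(range C) \<in> range C" by (intro ideal_chain_is_trivial) auto
  then obtain K where K: "\<Union>(range C) = C K" by blast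
  have "C k = C K" if "k \<ge> K" for k
    using K monoD[OF \<open>mono C\<close> that] by blast
  then show "\<exists>n. \<forall>m\<ge>n. C m = C n" by (intro exI[of _ K] allI impI)
qed

section \<open>Multigraded families for a system of ideals\<close>

abbreviation madd :: "(nat \<Rightarrow> nat) \<Rightarrow> (nat \<Rightarrow> nat) \<Rightarrow> nat \<Rightarrow> nat" (infixl "[+]" 65) where
  "n [+] m \<equiv> \<lambda>i. n i + m i"

abbreviation inc :: "nat \<Rightarrow> (nat \<Rightarrow> nat) \<Rightarrow> nat \<Rightarrow> nat" where
  "inc i n \<equiv> n(i := n i + 1)"

abbreviation unitv :: "nat \<Rightarrow> nat \<Rightarrow> nat" where
  "unitv i \<equiv> \<lambda>j. if j = i then 1 else 0"

lemma inc_eq_madd: "inc i n = n [+] unitv i"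
  by auto

text \<open>Induction on the sum of the coordinates up to \<open>d\<close>. The other coordinates
  are unconstrained, so the base case has to cover every \<open>n\<close> that vanishes on this
  range.\<close>

lemma multi_index_induct [case_names zero inc]:
  fixes d :: nat and n :: "nat \<Rightarrow> nat"
  assumes zero: "\<And>n. (\<And>i. i \<le> d \<Longrightarrow> n i = 0) \<Longrightarrow> P n"
    and inc: "\<And>n i. i \<le> d \<Longrightarrow> P n \<Longrightarrow> P (inc i n)"
  shows "P n"
proof (induction "\<Sum>i\<le>d. n i" arbitrary: n)
  case 0
  then show ?case by (intro zero) simp
next
  case (Suc s)
  then obtain i where i: "i \<le> d" "n i \<noteq> 0"
    by (metis Zero_not_Suc atMost_iff sum.neutral)
  let ?m = "n(i := n i - 1)"
  have "(\<Sum>j\<le>d. n j) = n i + (\<Sum>j\<in>{..d} - {i}. n j)"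
    using i by (simp add: sum.remove)
  moreover have "(\<Sum>j\<le>d. ?m j) = ?m i + (\<Sum>j\<in>{..d} - {i}. ?m j)"
    using i by (simp add: sum.remove)
  moreover have "(\<Sum>j\<in>{..d} - {i}. ?m j) = (\<Sum>j\<in>{..d} - {i}. n j)" by (intro sum.cong) auto
  ultimately have "s = (\<Sum>j\<le>d. ?m j)" using Suc(2) i by simp
  then have "P ?m" by (rule Suc(1))
  then have "P (inc i ?m)" by (rule inc[OF i(1)])
  moreover have "inc i ?m = n" using i by auto
  ultimately show ?case by simp
qed

locale multi_ideals = module R M for R (structure) and M (structure) +
  fixes d :: nat and F :: "nat \<Rightarrow> 'a set"
  assumes noetherian: "noetherian_ring R" and fin_gen: "fin_gen_module R M"
    and F_ideal: "i \<le> d \<Longrightarrow> ideal (F i) R"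
begin

abbreviation "\<F> \<equiv> multi_power R d F"
abbreviation "W \<equiv> multi_power_mod R M d F"

lemma acc_ideals: "acc_on {I. ideal I R}"
  by (rule noetherian_ring.acc_on_ideals[OF noetherian])

lemma acc_submods: "acc_on submods"
  by (rule fin_gen_acc[OF acc_ideals fin_gen])

interpretation IS: comm_monoid "ideals_set R"
  by (rule ideals_set_is_comm_monoid)

lemma IS_simps: "carrier (ideals_set R) = {I. ideal I R}" "mult (ideals_set R) = ideal_prod R"
  "one (ideals_set R) = carrier R"
  by (simp_all add: ideals_set_def)

lemma F_pow: "i \<le> d \<Longrightarrow> F i [^]\<^bsub>ideals_set R\<^esub> (k::nat) \<in> carrier (ideals_set R)"
  using F_ideal by (intro IS.nat_pow_closed) (simp add: IS_simps)

lemma multi_power_ideal: "ideal (\<F> n) R"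
proof -
  have "\<F> n \<in> carrier (ideals_set R)"
    unfolding multi_power_def using F_pow by (intro IS.finprod_closed) auto
  then show ?thesis by (simp add: IS_simps)
qed

lemma multi_power_carr: "f \<in> \<F> n \<Longrightarrow> f \<in> carrier R"
  by (rule ideal_carr[OF multi_power_ideal])

lemma multi_power_subset: "\<F> n \<subseteq> carrier R"
  using multi_power_carr by blast

lemma multi_power_cong: "(\<And>i. i \<le> d \<Longrightarrow> n i = m i) \<Longrightarrow> \<F> n = \<F> m"
  unfolding multi_power_def using F_pow by (intro IS.finprod_cong) (auto simp: simp_implies_def)

lemma multi_power_add: "\<F> (n [+] m) = ideal_prod R (\<F> n) (\<F> m)"
proof -
  have "\<F> (n [+] m) = (\<Otimes>\<^bsub>ideals_set R\<^esub>i\<in>{..d}. F i [^]\<^bsub>ideals_set R\<^esub> n i \<otimes>\<^bsub>ideals_set R\<^esub> F i [^]\<^bsub>ideals_set R\<^esub> m i)"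
    unfolding multi_power_def using F_pow F_ideal
    by (intro IS.finprod_cong) (simp_all add: simp_implies_def IS.nat_pow_mult IS_simps(1))
  also have "\<dots> = \<F> n \<otimes>\<^bsub>ideals_set R\<^esub> \<F> m"
    unfolding multi_power_def using F_pow by (intro IS.finprod_multf) auto
  finally show ?thesis by (simp add: IS_simps)
qed

lemma multi_power_zero: "(\<And>i. i \<le> d \<Longrightarrow> n i = 0) \<Longrightarrow> \<F> n = carrier R"
proof -
  assume "\<And>i. i \<le> d \<Longrightarrow> n i = 0"
  then have "\<F> n = (\<Otimes>\<^bsub>ideals_set R\<^esub>i\<in>{..d}. \<one>\<^bsub>ideals_set R\<^esub>)"
    unfolding multi_power_def by (intro IS.finprod_cong) (auto simp: simp_implies_def)
  then show ?thesis by (simp add: IS.finprod_one_eqI IS_simps)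
qed

lemma multi_power_unit: "i \<le> d \<Longrightarrow> \<F> (unitv i) = F i"
proof -
  assume i: "i \<le> d"
  have "F j [^]\<^bsub>ideals_set R\<^esub> (1::nat) = F j" if "j \<le> d" for j
    using F_ideal[OF that] by (intro IS.nat_pow_eone) (simp add: IS_simps)
  then have "\<F> (unitv i) = (\<Otimes>\<^bsub>ideals_set R\<^esub>j\<in>{..d}. if i = j then F j else \<one>\<^bsub>ideals_set R\<^esub>)"
    unfolding multi_power_def using F_ideal
    by (intro IS.finprod_cong) (auto simp: simp_implies_def IS_simps(1) IS_simps(3) oneideal simp del: IS.nat_pow_Suc)
  then show ?thesis using IS.finprod_singleton[of i "{..d}" F] i F_ideal by (simp add: IS_simps Pi_def)
qed

lemma multi_power_inc: "i \<le> d \<Longrightarrow> \<F> (inc i n) = ideal_prod R (F i) (\<F> n)"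
  unfolding inc_eq_madd multi_power_add
  using ideal_prod_commute[OF multi_power_ideal multi_power_ideal, of n "unitv i"] by (simp add: multi_power_unit)

lemma F_carr: "i \<le> d \<Longrightarrow> a \<in> F i \<Longrightarrow> a \<in> carrier R"
  using ideal_carr F_ideal by blast

lemma W_eq: "W n = ideal_smult R M (\<F> n) (carrier M)"
  by (simp add: multi_power_mod_def)

lemma W_submod: "submodule (W n) R M"
  unfolding W_eq by (intro ideal_smult_submod multi_power_subset) simp

lemma W_carr: "u \<in> W n \<Longrightarrow> u \<in> carrier M"
  by (rule submod_carr[OF W_submod])

lemma W_cong: "(\<And>i. i \<le> d \<Longrightarrow> n i = m i) \<Longrightarrow> W n = W m"
  unfolding W_eq using multi_power_cong by metis

lemma W_madd: "W (n [+] m) = ideal_smult R M (\<F> m) (W n)"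
proof -
  have "W (n [+] m) = W (m [+] n)" by (intro W_cong) simp
  then show ?thesis
    unfolding W_eq by (simp only: multi_power_add ideal_smult_prod[OF multi_power_ideal multi_power_ideal carrier_is_submodule])
qed

lemma W_inc: "i \<le> d \<Longrightarrow> W (inc i n) = ideal_smult R M (F i) (W n)"
  unfolding inc_eq_madd W_madd by (simp add: multi_power_unit)

lemma multi_power_W: "f \<in> \<F> m \<Longrightarrow> u \<in> W n \<Longrightarrow> f \<odot>\<^bsub>M\<^esub> u \<in> W (n [+] m)"
  unfolding W_madd by (rule ideal_smult_I)

lemma F_W: "i \<le> d \<Longrightarrow> a \<in> F i \<Longrightarrow> u \<in> W n \<Longrightarrow> a \<odot>\<^bsub>M\<^esub> u \<in> W (inc i n)"
  by (simp only: W_inc ideal_smult_I)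

lemma W_madd_subset: "W (n [+] m) \<subseteq> W n"
  unfolding W_madd by (rule ideal_smult_le[OF W_submod multi_power_subset])

lemma W_antimono:
  assumes "\<And>i. i \<le> d \<Longrightarrow> m i \<le> n i"
  shows "W n \<subseteq> W m"
proof -
  have "W n = W (m [+] (\<lambda>i. n i - m i))" using assms by (intro W_cong) auto
  then show ?thesis using W_madd_subset by simp
qed

text \<open>Graded submodules of the Rees module of \<open>M\<close>. In contrast to
  \<open>families\<close>, stability is under all of \<open>F i\<close> and not under a list of
  generators; the last clause makes a member blind to the coordinates beyond
  \<open>d\<close>.\<close>

definition gfams :: "((nat \<Rightarrow> nat) \<Rightarrow> 'c set) set" where
  "gfams = {N. (\<forall>n. submodule (N n) R M \<and> N n \<subseteq> W n) \<and>
     (\<forall>i\<le>d. \<forall>a\<in>F i. \<forall>n. \<forall>u\<in>N n. a \<odot>\<^bsub>M\<^esub> u \<in> N (inc i n)) \<and>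
     (\<forall>n m. (\<forall>i\<le>d. n i = m i) \<longrightarrow> N n = N m)}"

lemma gfamsI:
  assumes "\<And>n. submodule (N n) R M" "\<And>n. N n \<subseteq> W n"
    and "\<And>i a n u. i \<le> d \<Longrightarrow> a \<in> F i \<Longrightarrow> u \<in> N n \<Longrightarrow> a \<odot>\<^bsub>M\<^esub> u \<in> N (inc i n)"
    and "\<And>n m. (\<And>i. i \<le> d \<Longrightarrow> n i = m i) \<Longrightarrow> N n = N m"
  shows "N \<in> gfams"
  unfolding gfams_def using assms by blast

lemma gfamsD:
  assumes "N \<in> gfams"
  shows "submodule (N n) R M" "N n \<subseteq> W n"
    and "i \<le> d \<Longrightarrow> a \<in> F i \<Longrightarrow> u \<in> N n \<Longrightarrow> a \<odot>\<^bsub>M\<^esub> u \<in> N (inc i n)"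
    and "(\<And>i. i \<le> d \<Longrightarrow> n i = m i) \<Longrightarrow> N n = N m"
  using assms unfolding gfams_def by blast+

lemma gfams_multi_power:
  assumes N: "N \<in> gfams"
  shows "f \<in> \<F> m \<Longrightarrow> u \<in> N n \<Longrightarrow> f \<odot>\<^bsub>M\<^esub> u \<in> N (n [+] m)"
proof (induction m arbitrary: f rule: multi_index_induct[of d])
  case (zero m)
  then have "f \<odot>\<^bsub>M\<^esub> u \<in> N n" using multi_power_carr submoduleE(4)[OF gfamsD(1)[OF N]] by blast
  moreover have "N n = N (n [+] m)" using zero by (intro gfamsD(4)[OF N]) auto
  ultimately show ?case by simp
next
  case (inc m i)
  have eq: "n [+] inc i m = inc i (n [+] m)" by auto
  note sub = gfamsD(1)[OF N]
  have u: "u \<in> carrier M" using inc.prems(2) submod_carr[OF sub] by blast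
  have "f \<in> ideal_prod R (F i) (\<F> m)" using inc.prems(1) inc.hyps by (simp only: multi_power_inc)
  then show ?case
    unfolding eq
  proof (induction f rule: ideal_prod.induct)
    case (prod a g)
    have "(a \<otimes> g) \<odot>\<^bsub>M\<^esub> u = a \<odot>\<^bsub>M\<^esub> (g \<odot>\<^bsub>M\<^esub> u)"
      using prod F_carr[OF inc.hyps] multi_power_carr u by (simp add: smult_assoc1)
    moreover have "g \<odot>\<^bsub>M\<^esub> u \<in> N (n [+] m)" by (rule inc.IH[OF prod(2) inc.prems(2)])
    then have "a \<odot>\<^bsub>M\<^esub> (g \<odot>\<^bsub>M\<^esub> u) \<in> N (inc i (n [+] m))"
      using gfamsD(3)[OF N inc.hyps prod(1), where n = "n [+] m"] by blast
    ultimately show ?case by (simp only:)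
  next
    case (sum s t)
    have "s \<in> carrier R" "t \<in> carrier R"
      using sum ideal_prod_in_carrier[OF F_ideal[OF inc.hyps] multi_power_ideal] by auto
    then have "(s \<oplus> t) \<odot>\<^bsub>M\<^esub> u = s \<odot>\<^bsub>M\<^esub> u \<oplus>\<^bsub>M\<^esub> t \<odot>\<^bsub>M\<^esub> u" using u by (rule smult_l_distr)
    then show ?case using submoduleE(5)[OF sub] sum by simp
  qed
qed

lemma gfams_ism: "N \<in> gfams \<Longrightarrow> ideal_smult R M (\<F> m) (N n) \<subseteq> N (n [+] m)"
proof (rule ideal_smult_least)
  assume N: "N \<in> gfams"
  show "submodule (N (n [+] m)) R M" by (rule gfamsD(1)[OF N])
  show "f \<odot>\<^bsub>M\<^esub> v \<in> N (n [+] m)" if "f \<in> \<F> m" "v \<in> N n" for f v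
    using gfams_multi_power[OF N, OF that] .
qed

text \<open>Finite generating sets of the ideals give a list \<open>gs\<close> whose Rees module
  contains every \<open>W n\<close> with \<open>n\<close> supported on \<open>{..d}\<close>, so the
  chain condition for \<open>families\<close> can be transferred.\<close>

lemma acc_gfams: "acc_on gfams"
proof -
  have "\<exists>G. \<forall>i\<le>d. G i \<subseteq> carrier R \<and> finite (G i) \<and> F i = Idl (G i)"
    using noetherian_ring.finetely_gen[OF noetherian F_ideal] by metis
  then obtain G where G: "G i \<subseteq> carrier R" "finite (G i)" "F i = Idl (G i)" if "i \<le> d" for i by blast
  obtain gs where gs: "set gs = Sigma {..d} G"
    using finite_list[of "Sigma {..d} G"] G(2) by auto
  have gsR: "snd ` set gs \<subseteq> carrier R" using gs G(1) by (auto simp: subset_iff)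
  have r: "rees gs \<in> families gs (rees gs)" "acc_on (families gs (rees gs))"
    using rees_families[OF gsR acc_submods] by auto
  have rs: "submodule (rees gs n) R M" for n by (rule familiesD(1)[OF r(1)])
  have G_F: "a \<in> F i" if "i \<le> d" "a \<in> G i" for i a
    using that G genideal_self by blast
  have r0: "carrier M \<subseteq> rees gs' (\<lambda>_. 0)" if "snd ` set gs' \<subseteq> carrier R" for gs'
    using that
  proof (induction gs')
    case (Cons g gs')
    obtain i a where g: "g = (i, a)" by force
    have a: "a \<in> carrier R" using Cons.prems g by auto
    have "v \<in> rees (g # gs') (\<lambda>_. 0)" if "v \<in> carrier M" for v
    proof -
      have "v \<in> rees gs' (\<lambda>_. 0)" using Cons that by auto
      moreover have "v = \<one> \<odot>\<^bsub>M\<^esub> v \<oplus>\<^bsub>M\<^esub> \<zero>\<^bsub>M\<^esub>" using that by simp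
      ultimately show ?thesis unfolding g mem_sum rees.simps low.simps by (auto simp: mem_sum fun_upd_def)
    qed
    then show ?case by blast
  qed simp
  have Wr: "(\<forall>i>d. n i = 0) \<Longrightarrow> W n \<subseteq> rees gs n" for n
  proof (induction n rule: multi_index_induct[of d])
    case (zero n)
    then have "n = (\<lambda>_. 0)" by (auto simp: fun_eq_iff) (metis not_le)
    then show ?case using r0[OF gsR] submod_carr[OF W_submod] by auto
  next
    case (inc n i)
    then have "n j = 0" if "j > d" for j using that by (metis fun_upd_other not_le)
    then have IH: "W n \<subseteq> rees gs n" using inc.IH by blast
    show ?case
      unfolding W_inc[OF inc.hyps]
    proof (rule ideal_smult_least[OF rs])
      fix a v assume a: "a \<in> F i" and v: "v \<in> W n"
      show "a \<odot>\<^bsub>M\<^esub> v \<in> rees gs (inc i n)"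
      proof (rule Idl_smult_mem[of "G i" a "rees gs n"])
        show "b \<odot>\<^bsub>M\<^esub> w \<in> rees gs (inc i n)" if "b \<in> G i" "w \<in> rees gs n" for b w
          using familiesD(3)[OF r(1), of i b w n] that gs inc.hyps by auto
      qed (use G inc.hyps a v IH rs in auto)
    qed
  qed
  \<comment> \<open>\<open>rees\<close> is of use only in degrees that vanish beyond
    \<open>d\<close>. Cutting off elsewhere loses nothing, because a member of \<open>gfams\<close>
    is recovered from its values in these degrees.\<close>
  let ?r = "\<lambda>N n. if \<forall>i>d. n i = 0 then N n else {\<zero>\<^bsub>M\<^esub>}"
  have fam: "?r N \<in> families gs (rees gs)" if N: "N \<in> gfams" for N
  proof (rule familiesI)
    fix n
    show "submodule (?r N n) R M" using gfamsD(1)[OF N] zero_submod by simp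
    show "?r N n \<subseteq> rees gs n"
      using gfamsD(2)[OF N] Wr[of n] submod_zero[OF rs] by auto
  next
    fix i a n u assume ia: "(i, a) \<in> set gs" and u: "u \<in> ?r N n"
    have i: "i \<le> d" "a \<in> F i" using ia gs G_F by auto
    have "(\<forall>j>d. inc i n j = 0) \<longleftrightarrow> (\<forall>j>d. n j = 0)" using i by auto
    then show "a \<odot>\<^bsub>M\<^esub> u \<in> ?r N (inc i n)"
      using u gfamsD(3)[OF N, OF i, of u n] F_carr[OF i] by (auto split: if_splits simp del: fun_upd_apply)
  qed
  show ?thesis
    unfolding acc_on_def
  proof (intro allI impI)
    fix C :: "nat \<Rightarrow> (nat \<Rightarrow> nat) \<Rightarrow> 'c set"
    assume "range C \<subseteq> gfams" and "mono C"
    then have C: "C k \<in> gfams" for k by blast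
    have le: "?r (C k) \<le> ?r (C (Suc k))" for k
      using \<open>mono C\<close> by (auto simp: mono_iff_le_Suc le_fun_def)
    obtain K where K: "\<forall>k\<ge>K. ?r (C k) = ?r (C K)"
      using acc_onD[OF r(2), of "\<lambda>k. ?r (C k)", OF fam[OF C] le] by blast
    have "C k n = C K n" if "k \<ge> K" for k n
    proof -
      let ?n = "\<lambda>i. if i \<le> d then n i else 0"
      have "?r (C k) ?n = ?r (C K) ?n" using fun_cong[OF K[rule_format, OF that], of ?n] .
      moreover have "C k n = C k ?n" for k by (intro gfamsD(4)[OF C]) auto
      ultimately show ?thesis by simp
    qed
    then have "\<forall>k\<ge>K. C k = C K" by (auto intro!: ext)
    then show "\<exists>n. \<forall>m\<ge>n. C m = C n" ..
  qed
qed

text \<open>\<open>G c\<close> is the graded submodule generated by the components of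
  \<open>N\<close> in degrees bounded by \<open>c\<close>. It grows with \<open>c\<close> and hence
  stabilises, and it reaches \<open>N n\<close> as soon as \<open>c\<close> bounds the coordinates
  of \<open>n\<close>.\<close>

lemma artin_rees:
  assumes N: "N \<in> gfams"
  obtains c where "\<And>n. N n \<subseteq> ideal_smult R M (\<F> (\<lambda>i. n i - min (n i) c)) (N (\<lambda>i. min (n i) c))"
proof -
  define G where "G c n = ideal_smult R M (\<F> (\<lambda>i. n i - min (n i) c)) (N (\<lambda>i. min (n i) c))" for c n
  note Ns = gfamsD(1)[OF N]
  have Nc: "N n \<subseteq> carrier M" for n using submod_carr[OF Ns] by blast
  have Gs: "submodule (G c n) R M" for c n
    unfolding G_def by (intro ideal_smult_submod multi_power_subset Nc)
  have Gc: "G c n = G c m" if "\<And>i. i \<le> d \<Longrightarrow> n i = m i" for c n m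
  proof -
    have "N (\<lambda>i. min (n i) c) = N (\<lambda>i. min (m i) c)" using that by (intro gfamsD(4)[OF N]) auto
    moreover have "\<F> (\<lambda>i. n i - min (n i) c) = \<F> (\<lambda>i. m i - min (m i) c)" using that by (intro multi_power_cong) auto
    ultimately show ?thesis unfolding G_def by simp
  qed
  have GN: "G c n \<subseteq> N n" for c n
  proof -
    have "(\<lambda>i. min (n i) c) [+] (\<lambda>i. n i - min (n i) c) = n" by auto
    then show ?thesis unfolding G_def using gfams_ism[OF N] by metis
  qed
  have Ggf: "G c \<in> gfams" for c
  proof (rule gfamsI)
    show "submodule (G c n) R M" for n by (rule Gs)
    show "G c n \<subseteq> W n" for n using GN gfamsD(2)[OF N] by blast
    show "G c n = G c m" if "\<And>i. i \<le> d \<Longrightarrow> n i = m i" for n m using Gc[OF that] .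
    fix i a n u assume i: "i \<le> d" and a: "a \<in> F i" and u: "u \<in> G c n"
    have ac: "a \<in> carrier R" using F_carr i a by blast
    have "G c n \<subseteq> {u \<in> carrier M. a \<odot>\<^bsub>M\<^esub> u \<in> G c (inc i n)}"
      unfolding G_def[of c n]
    proof (rule ideal_smult_least[OF submod_colon[OF ac Gs]])
      fix f v assume f: "f \<in> \<F> (\<lambda>i. n i - min (n i) c)" and v: "v \<in> N (\<lambda>i. min (n i) c)"
      have c: "f \<in> carrier R" "v \<in> carrier M" using f v multi_power_carr Nc by auto
      have "a \<odot>\<^bsub>M\<^esub> (f \<odot>\<^bsub>M\<^esub> v) \<in> G c (inc i n)"
      \<comment> \<open>Below the bound the new factor \<open>a\<close> raises the degree of the
        generator \<open>v\<close>; from the bound on it joins the coefficient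
        \<open>f\<close>.\<close>
      proof (cases "n i < c")
        case True
        have "inc i (\<lambda>i. min (n i) c) = (\<lambda>j. min (inc i n j) c)" using True by auto
        then have "a \<odot>\<^bsub>M\<^esub> v \<in> N (\<lambda>j. min (inc i n j) c)" using gfamsD(3)[OF N, OF i a v] by simp
        moreover have "(\<lambda>i. n i - min (n i) c) = (\<lambda>j. inc i n j - min (inc i n j) c)" using True by auto
        moreover have "a \<odot>\<^bsub>M\<^esub> (f \<odot>\<^bsub>M\<^esub> v) = f \<odot>\<^bsub>M\<^esub> (a \<odot>\<^bsub>M\<^esub> v)" using smult_comm ac c by blast
        ultimately show ?thesis using f ideal_smult_I unfolding G_def by metis
      next
        case False
        have "inc i (\<lambda>i. n i - min (n i) c) = (\<lambda>j. inc i n j - min (inc i n j) c)"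
          using False by (auto simp: fun_eq_iff)
        moreover have "(\<lambda>i. min (n i) c) = (\<lambda>j. min (inc i n j) c)" using False by auto
        moreover have "a \<odot>\<^bsub>M\<^esub> (f \<odot>\<^bsub>M\<^esub> v) = (a \<otimes> f) \<odot>\<^bsub>M\<^esub> v" using smult_assoc1 ac c by metis
        moreover have "a \<otimes> f \<in> \<F> (inc i (\<lambda>i. n i - min (n i) c))"
          unfolding multi_power_inc[OF i, of "\<lambda>i. n i - min (n i) c"] using a f by (rule ideal_prod.prod)
        ultimately show ?thesis using v ideal_smult_I unfolding G_def by metis
      qed
      then show "f \<odot>\<^bsub>M\<^esub> v \<in> {u \<in> carrier M. a \<odot>\<^bsub>M\<^esub> u \<in> G c (inc i n)}" using c by simp
    qed
    then show "a \<odot>\<^bsub>M\<^esub> u \<in> G c (inc i n)" using u by blast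
  qed
  have Gmono: "G c \<le> G (Suc c)" for c
    unfolding le_fun_def
  proof
    fix n
    let ?p = "\<lambda>i::nat. n i - min (n i) (Suc c)" and ?q = "\<lambda>i::nat. min (n i) (Suc c) - min (n i) c"
    have eq: "(\<lambda>i. n i - min (n i) c) = ?p [+] ?q" "(\<lambda>i. min (n i) c) [+] ?q = (\<lambda>i. min (n i) (Suc c))"
      by auto
    have "G c n = ideal_smult R M (\<F> ?p) (ideal_smult R M (\<F> ?q) (N (\<lambda>i. min (n i) c)))"
      unfolding G_def eq(1) multi_power_add by (rule ideal_smult_prod[OF multi_power_ideal multi_power_ideal Ns])
    also have "\<dots> \<subseteq> G (Suc c) n"
      unfolding G_def using gfams_ism[OF N, of ?q "\<lambda>i. min (n i) c"] unfolding eq(2)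
      by (intro ideal_smult_mono multi_power_subset Nc order_refl)
    finally show "G c n \<subseteq> G (Suc c) n" .
  qed
  obtain K where K: "\<forall>c\<ge>K. G c = G K"
    using acc_onD[OF acc_gfams, of G, OF Ggf Gmono] by blast
  have "N n \<subseteq> G K n" for n
  proof -
    define c where "c = K + (\<Sum>i\<le>d. n i)"
    have "n i \<le> c" if "i \<le> d" for i
      unfolding c_def using member_le_sum[of i "{..d}" n] that by simp
    then have "N (\<lambda>i. min (n i) c) = N n" "\<F> (\<lambda>i. n i - min (n i) c) = carrier R"
      by (auto intro!: gfamsD(4)[OF N] multi_power_zero)
    then have "G c n = N n" unfolding G_def by (simp add: ideal_smult_carrier[OF Ns])
    moreover have "G c = G K" using K unfolding c_def by (metis le_add1)
    ultimately show ?thesis by simp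
  qed
  then show thesis using that unfolding G_def by blast
qed

end

section \<open>Saturation and filter-regular elements\<close>

context multi_ideals
begin

text \<open>The elements that a whole graded piece \<open>\<F> m\<close> of the Rees algebra carries
  into \<open>N\<close>: the saturation with respect to the irrelevant ideal of the multigraded
  ring.\<close>

definition sat :: "((nat \<Rightarrow> nat) \<Rightarrow> 'c set) \<Rightarrow> (nat \<Rightarrow> nat) \<Rightarrow> 'c set" where
  "sat N n = {u \<in> W n. \<exists>m. \<forall>f\<in>\<F> m. f \<odot>\<^bsub>M\<^esub> u \<in> N (n [+] m)}"

text \<open>A degree \<open>m\<close> that carries \<open>u\<close> into \<open>N\<close> may be
  enlarged. Finitely many such degrees can therefore be replaced by their sum.\<close>

lemma sat_step:
  assumes N: "N \<in> gfams" and u: "u \<in> carrier M"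
    and h: "\<And>f. f \<in> \<F> m \<Longrightarrow> f \<odot>\<^bsub>M\<^esub> u \<in> N (n [+] m)" and g: "g \<in> \<F> (\<lambda>i. m i + l i)"
  shows "g \<odot>\<^bsub>M\<^esub> u \<in> N (\<lambda>i. n i + m i + l i)"
proof -
  have "g \<in> ideal_prod R (\<F> l) (\<F> m)"
    using g unfolding multi_power_add using ideal_prod_commute[OF multi_power_ideal multi_power_ideal] by blast
  then show ?thesis
  proof (induction g rule: ideal_prod.induct)
    case (prod a b)
    have "(a \<otimes> b) \<odot>\<^bsub>M\<^esub> u = a \<odot>\<^bsub>M\<^esub> (b \<odot>\<^bsub>M\<^esub> u)"
      using prod multi_power_carr u by (simp add: smult_assoc1)
    moreover have "a \<odot>\<^bsub>M\<^esub> (b \<odot>\<^bsub>M\<^esub> u) \<in> N (\<lambda>i. (n [+] m) i + l i)"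
      using gfams_multi_power[OF N, of a l "b \<odot>\<^bsub>M\<^esub> u" "n [+] m"] h prod by blast
    ultimately show ?case by simp
  next
    case (sum s t)
    have "s \<in> carrier R" "t \<in> carrier R"
      using sum ideal_prod_in_carrier[OF multi_power_ideal multi_power_ideal] by auto
    then have "(s \<oplus> t) \<odot>\<^bsub>M\<^esub> u = s \<odot>\<^bsub>M\<^esub> u \<oplus>\<^bsub>M\<^esub> t \<odot>\<^bsub>M\<^esub> u" using u by (rule smult_l_distr)
    then show ?case using submoduleE(5)[OF gfamsD(1)[OF N]] sum by simp
  qed
qed

lemma subset_sat:
  assumes N: "N \<in> gfams"
  shows "N n \<subseteq> sat N n"
proof
  fix u assume u: "u \<in> N n"
  have "f \<odot>\<^bsub>M\<^esub> u \<in> N (n [+] (\<lambda>_. 0))" if "f \<in> \<F> (\<lambda>_. 0)" for f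
    by (rule gfams_multi_power[OF N, of f "\<lambda>_. 0" u n, OF that u])
  then show "u \<in> sat N n" unfolding sat_def using gfamsD(2)[OF N] u by blast
qed

lemma sat_gfams:
  assumes N: "N \<in> gfams"
  shows "sat N \<in> gfams"
proof (rule gfamsI)
  fix n
  note sub = gfamsD(1)[OF N]
  show "submodule (sat N n) R M"
  proof (rule submoduleI)
    show "sat N n \<subseteq> carrier M" unfolding sat_def using W_carr by blast
    show "\<zero>\<^bsub>M\<^esub> \<in> sat N n" using subset_sat[OF N] submod_zero[OF sub] by blast
  next
    fix a assume "a \<in> sat N n"
    then obtain m where m: "a \<in> W n" "\<forall>f\<in>\<F> m. f \<odot>\<^bsub>M\<^esub> a \<in> N (n [+] m)" unfolding sat_def by blast
    have "f \<odot>\<^bsub>M\<^esub> (\<ominus>\<^bsub>M\<^esub> a) \<in> N (n [+] m)" if "f \<in> \<F> m" for f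
      using m that multi_power_carr[OF that] W_carr[OF m(1)] submoduleE(3)[OF sub] by (simp add: smult_r_minus)
    then show "\<ominus>\<^bsub>M\<^esub> a \<in> sat N n" unfolding sat_def using m(1) submoduleE(3)[OF W_submod] by blast
  next
    fix a b assume "a \<in> sat N n" "b \<in> sat N n"
    then obtain m l where m: "a \<in> W n" "\<forall>f\<in>\<F> m. f \<odot>\<^bsub>M\<^esub> a \<in> N (n [+] m)"
      and l: "b \<in> W n" "\<forall>f\<in>\<F> l. f \<odot>\<^bsub>M\<^esub> b \<in> N (n [+] l)" unfolding sat_def by blast
    have "f \<odot>\<^bsub>M\<^esub> (a \<oplus>\<^bsub>M\<^esub> b) \<in> N (n [+] (m [+] l))" if f: "f \<in> \<F> (m [+] l)" for f
    proof -
      have "f \<odot>\<^bsub>M\<^esub> a \<in> N (\<lambda>i. n i + m i + l i)"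
        using sat_step[OF N W_carr[OF m(1)], of m n f l] m(2) f by blast
      moreover have "f \<in> \<F> (l [+] m)" using f by (simp add: add.commute)
      then have "f \<odot>\<^bsub>M\<^esub> b \<in> N (\<lambda>i. n i + l i + m i)"
        using sat_step[OF N W_carr[OF l(1)], of l n f m] l(2) by blast
      ultimately have "f \<odot>\<^bsub>M\<^esub> a \<in> N (n [+] (m [+] l))" "f \<odot>\<^bsub>M\<^esub> b \<in> N (n [+] (m [+] l))"
        by (simp_all add: add_ac)
      then show ?thesis
        using multi_power_carr[OF f] W_carr[OF m(1)] W_carr[OF l(1)] submoduleE(5)[OF sub] by (simp add: smult_r_distr)
    qed
    then show "a \<oplus>\<^bsub>M\<^esub> b \<in> sat N n"
      unfolding sat_def using submoduleE(5)[OF W_submod m(1) l(1)] by blast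
  next
    fix r a assume r: "r \<in> carrier R" and "a \<in> sat N n"
    then obtain m where m: "a \<in> W n" "\<forall>f\<in>\<F> m. f \<odot>\<^bsub>M\<^esub> a \<in> N (n [+] m)" unfolding sat_def by blast
    have "f \<odot>\<^bsub>M\<^esub> (r \<odot>\<^bsub>M\<^esub> a) \<in> N (n [+] m)" if "f \<in> \<F> m" for f
      using m that multi_power_carr[OF that] W_carr[OF m(1)] submoduleE(4)[OF sub] r by (simp add: smult_comm[of f r])
    then show "r \<odot>\<^bsub>M\<^esub> a \<in> sat N n" unfolding sat_def using m(1) submoduleE(4)[OF W_submod r] by blast
  qed
next
  show "sat N n \<subseteq> W n" for n unfolding sat_def by blast
next
  fix i a n u assume i: "i \<le> d" and a: "a \<in> F i" and "u \<in> sat N n"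
  then obtain m where m: "u \<in> W n" "\<forall>f\<in>\<F> m. f \<odot>\<^bsub>M\<^esub> u \<in> N (n [+] m)" unfolding sat_def by blast
  have ac: "a \<in> carrier R" by (rule F_carr[OF i a])
  have "f \<odot>\<^bsub>M\<^esub> (a \<odot>\<^bsub>M\<^esub> u) \<in> N (inc i n [+] m)" if f: "f \<in> \<F> m" for f
  proof -
    have "f \<odot>\<^bsub>M\<^esub> (a \<odot>\<^bsub>M\<^esub> u) = a \<odot>\<^bsub>M\<^esub> (f \<odot>\<^bsub>M\<^esub> u)" by (rule smult_comm[OF multi_power_carr[OF f] ac W_carr[OF m(1)]])
    moreover have "inc i n [+] m = inc i (n [+] m)" by auto
    ultimately show ?thesis using gfamsD(3)[OF N, of i a "f \<odot>\<^bsub>M\<^esub> u" "n [+] m"] i a m(2) f by simp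
  qed
  then show "a \<odot>\<^bsub>M\<^esub> u \<in> sat N (inc i n)" unfolding sat_def using F_W[OF i a m(1)] by blast
next
  fix n n' :: "nat \<Rightarrow> nat" assume e: "\<And>i. i \<le> d \<Longrightarrow> n i = n' i"
  have "N (n [+] m) = N (n' [+] m)" for m by (intro gfamsD(4)[OF N]) (simp add: e)
  moreover have "W n = W n'" using e by (rule W_cong)
  ultimately show "sat N n = sat N n'" unfolding sat_def by simp
qed

text \<open>The degree that carries \<open>f u\<close> into \<open>N\<close> depends on
  \<open>f\<close>. The ideals \<open>D l\<close> of those \<open>f\<close> for which the degree
  \<open>l\<close> suffices are directed, so a maximal one is all of \<open>\<F> m\<close>, and
  \<open>l + m\<close> then works for \<open>u\<close> itself.\<close>

lemma sat_lift:
  assumes N: "N \<in> gfams" and u: "u \<in> W n"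
    and h: "\<And>f. f \<in> \<F> m \<Longrightarrow> f \<odot>\<^bsub>M\<^esub> u \<in> sat N (n [+] m)"
  shows "u \<in> sat N n"
proof -
  define D where "D l = {f \<in> \<F> m. \<forall>g\<in>\<F> l. g \<odot>\<^bsub>M\<^esub> (f \<odot>\<^bsub>M\<^esub> u) \<in> N (\<lambda>i. n i + m i + l i)}" for l
  note uc = W_carr[OF u]
  have Dmono: "D l \<subseteq> D (l [+] l')" for l l'
  proof
    fix f assume f: "f \<in> D l"
    have fc: "f \<odot>\<^bsub>M\<^esub> u \<in> carrier M" using f multi_power_carr uc unfolding D_def by blast
    have "g \<odot>\<^bsub>M\<^esub> (f \<odot>\<^bsub>M\<^esub> u) \<in> N (\<lambda>i. (n i + m i) + l i + l' i)" if "g \<in> \<F> (l [+] l')" for g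
      using sat_step[OF N fc, of l "n [+] m" g l'] f that unfolding D_def by blast
    then show "f \<in> D (l [+] l')" using f unfolding D_def by (simp add: add_ac)
  qed
  have Did: "ideal (D l) R" for l
  proof -
    have "submodule {v \<in> carrier M. \<forall>g\<in>\<F> l. v \<in> {v \<in> carrier M. g \<odot>\<^bsub>M\<^esub> v \<in> N (\<lambda>i. n i + m i + l i)}} R M"
      by (intro submod_all submod_colon multi_power_carr gfamsD(1)[OF N])
    from ideal_ann[OF uc this multi_power_ideal, of m] show ?thesis
      unfolding D_def by (rule back_subst[of "\<lambda>I. ideal I R"]) (use multi_power_carr uc in auto)
  qed
  obtain I where I: "I \<in> range D" "\<And>J. J \<in> range D \<Longrightarrow> I \<subseteq> J \<Longrightarrow> J = I"
    using acc_on_max[OF acc_ideals, of "range D"] Did by blast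
  then obtain l where l: "I = D l" by blast
  have "f \<in> D l" if f: "f \<in> \<F> m" for f
  proof -
    obtain l' where "\<forall>g\<in>\<F> l'. g \<odot>\<^bsub>M\<^esub> (f \<odot>\<^bsub>M\<^esub> u) \<in> N (\<lambda>i. n i + m i + l' i)"
      using h[OF f] unfolding sat_def by blast
    then have "f \<in> D l'" using f unfolding D_def by blast
    then have "f \<in> D (l' [+] l)" using Dmono by blast
    moreover have "l' [+] l = l [+] l'" by (simp add: add.commute)
    moreover have "D (l [+] l') = D l" using I(2)[of "D (l [+] l')"] Dmono[of l l'] unfolding l by blast
    ultimately show ?thesis by simp
  qed
  then have fin: "g \<odot>\<^bsub>M\<^esub> (f \<odot>\<^bsub>M\<^esub> u) \<in> N (\<lambda>i. n i + m i + l i)" if "f \<in> \<F> m" "g \<in> \<F> l" for f g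
    using that unfolding D_def by blast
  have "h \<odot>\<^bsub>M\<^esub> u \<in> N (n [+] (l [+] m))" if "h \<in> \<F> (l [+] m)" for h
  proof -
    have "h \<in> ideal_prod R (\<F> l) (\<F> m)" using that unfolding multi_power_add .
    then have "h \<odot>\<^bsub>M\<^esub> u \<in> N (\<lambda>i. n i + m i + l i)"
    proof (induction h rule: ideal_prod.induct)
      case (prod a b)
      then show ?case using fin multi_power_carr uc by (simp add: smult_assoc1)
    next
      case (sum s t)
      have "s \<in> carrier R" "t \<in> carrier R"
        using sum ideal_prod_in_carrier[OF multi_power_ideal multi_power_ideal] by auto
      then have "(s \<oplus> t) \<odot>\<^bsub>M\<^esub> u = s \<odot>\<^bsub>M\<^esub> u \<oplus>\<^bsub>M\<^esub> t \<odot>\<^bsub>M\<^esub> u" using uc by (rule smult_l_distr)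
      then show ?case using submoduleE(5)[OF gfamsD(1)[OF N]] sum by simp
    qed
    then show ?thesis by (simp add: add_ac)
  qed
  then show ?thesis unfolding sat_def using u by blast
qed

text \<open>By Artin--Rees for \<open>sat N\<close>, the components in large degrees are generated
  from the corner \<open>(c, ..., c)\<close>. The submodules \<open>E l\<close> of this corner are
  directed, so by the chain condition a single degree \<open>l\<close> carries the whole corner into
  \<open>N\<close>.\<close>

lemma sat_eventually:
  assumes N: "N \<in> gfams"
  obtains c where "\<And>n. (\<And>i. i \<le> d \<Longrightarrow> c \<le> n i) \<Longrightarrow> sat N n = N n"
proof -
  obtain c where c: "\<And>n. sat N n \<subseteq> ideal_smult R M (\<F> (\<lambda>i. n i - min (n i) c)) (sat N (\<lambda>i. min (n i) c))"
    using artin_rees[OF sat_gfams[OF N]] by blast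
  let ?c = "\<lambda>_::nat. c"
  note ss = gfamsD(1)[OF sat_gfams[OF N]] and sub = gfamsD(1)[OF N]
  define E where "E l = {u \<in> sat N ?c. \<forall>f\<in>\<F> l. f \<odot>\<^bsub>M\<^esub> u \<in> N (?c [+] l)}" for l
  have sc: "u \<in> carrier M" if "u \<in> sat N ?c" for u using submod_carr[OF ss that] .
  have "submodule (E l) R M" for l
  proof -
    have "submodule (sat N ?c \<inter> {v \<in> carrier M. \<forall>f\<in>\<F> l. v \<in> {v \<in> carrier M. f \<odot>\<^bsub>M\<^esub> v \<in> N (?c [+] l)}}) R M"
      by (intro submod_Int ss submod_all submod_colon multi_power_carr sub)
    then show ?thesis
      unfolding E_def by (rule back_subst[of "\<lambda>I. submodule I R M"]) (use sc in auto)
  qed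
  then have "range E \<subseteq> submods" unfolding submods_def by blast
  then obtain X where X: "X \<in> range E" "\<And>J. J \<in> range E \<Longrightarrow> X \<subseteq> J \<Longrightarrow> J = X"
    using acc_on_max[OF acc_submods, of "range E"] by blast
  then obtain l where l: "X = E l" by blast
  have Emono: "E l \<subseteq> E (l [+] l')" for l l'
  proof
    fix u assume u: "u \<in> E l"
    have "g \<odot>\<^bsub>M\<^esub> u \<in> N (\<lambda>i. c + l i + l' i)" if "g \<in> \<F> (l [+] l')" for g
      using sat_step[OF N sc, of u l ?c g l'] u that unfolding E_def by blast
    then show "u \<in> E (l [+] l')" using u unfolding E_def by (simp add: add_ac)
  qed
  have El: "sat N ?c \<subseteq> E l"
  proof
    fix u assume u: "u \<in> sat N ?c"
    then obtain l' where "u \<in> E l'" unfolding E_def sat_def by blast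
    then have "u \<in> E (l' [+] l)" using Emono by blast
    moreover have "l' [+] l = l [+] l'" by (simp add: add.commute)
    moreover have "E (l [+] l') = E l" using X(2)[of "E (l [+] l')"] Emono[of l l'] unfolding l by blast
    ultimately show "u \<in> E l" by simp
  qed
  \<comment> \<open>The part \<open>c\<close> reaches the corner, and the sum bounds every
    \<open>l i\<close>, so that degree \<open>l\<close> can still be split off.\<close>
  define c' where "c' = c + (\<Sum>i\<le>d. l i)"
  have "sat N n = N n" if n: "\<And>i. i \<le> d \<Longrightarrow> c' \<le> n i" for n
  proof
    show "N n \<subseteq> sat N n" by (rule subset_sat[OF N])
    have lc: "c + l i \<le> n i" if "i \<le> d" for i
      using n[OF that] member_le_sum[of i "{..d}" l] that unfolding c'_def by simp
    define p where "p = (\<lambda>i. n i - c - l i)"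
    have "sat N n \<subseteq> ideal_smult R M (\<F> (\<lambda>i. n i - min (n i) c)) (sat N (\<lambda>i. min (n i) c))" by (rule c)
    also have "sat N (\<lambda>i. min (n i) c) = sat N ?c"
      by (rule gfamsD(4)[OF sat_gfams[OF N]]) (use lc in force)
    also have "\<F> (\<lambda>i. n i - min (n i) c) = \<F> (p [+] l)"
      unfolding p_def by (rule multi_power_cong) (use lc in force)
    also have "ideal_smult R M (\<F> (p [+] l)) (sat N ?c) = ideal_smult R M (\<F> p) (ideal_smult R M (\<F> l) (sat N ?c))"
      unfolding multi_power_add by (rule ideal_smult_prod[OF multi_power_ideal multi_power_ideal ss])
    also have "\<dots> \<subseteq> ideal_smult R M (\<F> p) (N (?c [+] l))"
    proof (rule ideal_smult_mono[OF multi_power_subset _ order_refl])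
      show "N (?c [+] l) \<subseteq> carrier M" using submod_carr[OF sub] by blast
      show "ideal_smult R M (\<F> l) (sat N ?c) \<subseteq> N (?c [+] l)"
        by (rule ideal_smult_least[OF sub]) (use El in \<open>auto simp: E_def\<close>)
    qed
    also have "\<dots> \<subseteq> N ((?c [+] l) [+] p)" using gfams_ism[OF N, of p "?c [+] l"] by simp
    also have "\<dots> = N n" by (rule gfamsD(4)[OF N]) (use lc in \<open>force simp: p_def\<close>)
    finally show "sat N n \<subseteq> N n" .
  qed
  then show thesis by (rule that)
qed

text \<open>The ideals found here are the traces on \<open>F i\<close> of the relevant associated primes of the graded module \<open>W/N\<close>.
  By Noetherian induction they are those for \<open>N\<close> enlarged by the graded submodule generated by some \<open>u \<notin> sat N\<close>,
  together with the trace of the annihilator of \<open>u\<close>, where \<open>u\<close> is chosen such that this trace is maximal.\<close>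

lemma regular_elements:
  assumes N: "N \<in> gfams" and i: "i \<le> d"
  shows "\<exists>Q. finite Q \<and> (\<forall>q\<in>Q. ideal q R \<and> q \<subset> F i) \<and>
    (\<forall>x\<in>F i. (\<forall>q\<in>Q. x \<notin> q) \<longrightarrow> (\<forall>n. \<forall>u\<in>W n. x \<odot>\<^bsub>M\<^esub> u \<in> N (inc i n) \<longrightarrow> u \<in> sat N n))"
  using acc_gfams N
proof (induction N rule: acc_on_induct)
  case (step N)
  note N = step(1)
  note sub = gfamsD(1)[OF N] and ss = gfamsD(1)[OF sat_gfams[OF N]]
  show ?case
  proof (cases "\<forall>n. W n \<subseteq> sat N n")
    case True
    then show ?thesis by (intro exI[of _ "{}"]) blast
  next
    case False
    define q where "q n u = {x \<in> F i. x \<odot>\<^bsub>M\<^esub> u \<in> sat N (inc i n)}" for n u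
    have q_ideal: "ideal (q n u) R" if "u \<in> W n" for n u
      unfolding q_def by (rule ideal_ann[OF W_carr[OF that] ss F_ideal[OF i]])
    define X where "X = {q n u | n u. u \<in> W n \<and> u \<notin> sat N n}"
    have "X \<subseteq> {I. ideal I R}" "X \<noteq> {}" unfolding X_def using q_ideal False by blast+
    then obtain p where p: "p \<in> X" "\<And>J. J \<in> X \<Longrightarrow> p \<subseteq> J \<Longrightarrow> J = p"
      using acc_on_max[OF acc_ideals] by metis
    then obtain n u where u: "p = q n u" "u \<in> W n" "u \<notin> sat N n" unfolding X_def by blast
    note uc = W_carr[OF u(2)]
    have p_proper: "p \<subset> F i"
    proof -
      \<comment> \<open>If all of \<open>F i\<close> carried \<open>u\<close> into the saturation,
        \<open>sat_lift\<close> would put \<open>u\<close> there as well.\<close>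
      have "p \<noteq> F i"
      proof
        assume "p = F i"
        then have "f \<odot>\<^bsub>M\<^esub> u \<in> sat N (n [+] unitv i)" if "f \<in> \<F> (unitv i)" for f
          using that i unfolding inc_eq_madd[symmetric] u(1) q_def by (auto simp: multi_power_unit simp del: fun_upd_apply)
        then show False using sat_lift[OF N u(2)] u(3) by blast
      qed
      then show ?thesis unfolding u(1) q_def by blast
    qed
    \<comment> \<open>\<open>N\<close> enlarged by the graded submodule that \<open>u\<close>
      generates from degree \<open>n\<close>; only the degrees above \<open>n\<close> are
      affected.\<close>
    define N' where "N' m = (if \<forall>j\<le>d. n j \<le> m j then N m <+>\<^bsub>M\<^esub> (\<lambda>g. g \<odot>\<^bsub>M\<^esub> u) ` \<F> (\<lambda>j. m j - n j) else N m)" for m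
    have subu: "submodule ((\<lambda>g. g \<odot>\<^bsub>M\<^esub> u) ` \<F> m) R M" for m
      by (rule ideal_image_submod[OF multi_power_ideal uc])
    have gu: "g \<odot>\<^bsub>M\<^esub> u \<in> W m" if "\<forall>j\<le>d. n j \<le> m j" "g \<in> \<F> (\<lambda>j. m j - n j)" for g m
    proof -
      have "W (n [+] (\<lambda>j. m j - n j)) = W m" by (rule W_cong) (use that in auto)
      then show ?thesis using multi_power_W[OF that(2) u(2)] by simp
    qed
    have N': "N' \<in> gfams"
    proof (rule gfamsI)
      show "submodule (N' m) R M" for m unfolding N'_def using sub subu by (simp add: submod_sum)
      show "N' m \<subseteq> W m" for m
      proof (cases "\<forall>j\<le>d. n j \<le> m j")
        case True
        then have "(\<lambda>g. g \<odot>\<^bsub>M\<^esub> u) ` \<F> (\<lambda>j. m j - n j) \<subseteq> W m" using gu[OF True] by blast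
        then show ?thesis unfolding N'_def using True sum_least[OF W_submod gfamsD(2)[OF N]] by simp
      next
        case False
        then show ?thesis unfolding N'_def using gfamsD(2)[OF N] by auto
      qed
      show "N' m = N' m'" if e: "\<And>i. i \<le> d \<Longrightarrow> m i = m' i" for m m'
      proof -
        have "N m = N m'" using e by (rule gfamsD(4)[OF N])
        moreover have "\<F> (\<lambda>j. m j - n j) = \<F> (\<lambda>j. m' j - n j)" by (rule multi_power_cong) (simp add: e)
        moreover have "(\<forall>j\<le>d. n j \<le> m j) \<longleftrightarrow> (\<forall>j\<le>d. n j \<le> m' j)" using e by auto
        ultimately show ?thesis unfolding N'_def by presburger
      qed
      fix j a m v assume j: "j \<le> d" and a: "a \<in> F j" and v: "v \<in> N' m"
      have ac: "a \<in> carrier R" by (rule F_carr[OF j a])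
      have N_N': "N m' \<subseteq> N' m'" for m' unfolding N'_def using sum_upper1[OF sub subu] by simp
      show "a \<odot>\<^bsub>M\<^esub> v \<in> N' (inc j m)"
      proof (cases "\<forall>j\<le>d. n j \<le> m j")
        case True
        then obtain w g where wg: "w \<in> N m" "g \<in> \<F> (\<lambda>j. m j - n j)" "v = w \<oplus>\<^bsub>M\<^esub> g \<odot>\<^bsub>M\<^esub> u"
          using v unfolding N'_def by (auto simp: mem_sum)
        have "a \<odot>\<^bsub>M\<^esub> v = a \<odot>\<^bsub>M\<^esub> w \<oplus>\<^bsub>M\<^esub> (a \<otimes> g) \<odot>\<^bsub>M\<^esub> u"
          using wg ac uc submod_carr[OF sub] multi_power_carr by (simp add: smult_r_distr smult_assoc1)
        moreover have "a \<odot>\<^bsub>M\<^esub> w \<in> N (inc j m)" by (rule gfamsD(3)[OF N, of j a w m, OF j a wg(1)])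
        moreover have "a \<otimes> g \<in> \<F> (inc j (\<lambda>j. m j - n j))"
          unfolding multi_power_inc[OF j, of "\<lambda>j. m j - n j"] using a wg(2) by (rule ideal_prod.prod)
        moreover have "inc j (\<lambda>j. m j - n j) = (\<lambda>l. inc j m l - n l)"
          using True j by (auto simp: fun_eq_iff)
        moreover have "\<forall>l\<le>d. n l \<le> inc j m l" using True by (auto intro: le_SucI)
        ultimately show ?thesis unfolding N'_def by (auto intro!: sumI simp del: fun_upd_apply)
      next
        case False
        then have "v \<in> N m" using v unfolding N'_def by (auto split: if_splits)
        then show ?thesis using gfamsD(3)[OF N, of j a v m, OF j a] N_N' by blast
      qed
    qed
    have less: "N < N'"
    proof -
      have "N m \<subseteq> N' m" for m unfolding N'_def using sum_upper1[OF sub subu] by simp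
      moreover have "u \<in> N' n"
      proof -
        have "\<F> (\<lambda>j. n j - n j) = carrier R" by (rule multi_power_zero) simp
        then have "u \<in> (\<lambda>g. g \<odot>\<^bsub>M\<^esub> u) ` \<F> (\<lambda>j. n j - n j)" using uc by (intro image_eqI[of _ _ \<one>]) auto
        then show ?thesis unfolding N'_def using sum_upper2[OF sub subu] by auto
      qed
      moreover have "u \<notin> N n" using u(3) subset_sat[OF N] by blast
      ultimately show ?thesis unfolding less_le le_fun_def by metis
    qed
    obtain Q where Q: "finite Q" "\<forall>q\<in>Q. ideal q R \<and> q \<subset> F i"
      "\<forall>x\<in>F i. (\<forall>q\<in>Q. x \<notin> q) \<longrightarrow> (\<forall>n. \<forall>u\<in>W n. x \<odot>\<^bsub>M\<^esub> u \<in> N' (inc i n) \<longrightarrow> u \<in> sat N' n)"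
      using step(2)[OF N' less] by blast
    have "v \<in> sat N m" if x: "x \<in> F i" "\<forall>q\<in>insert p Q. x \<notin> q" and v: "v \<in> W m" "x \<odot>\<^bsub>M\<^esub> v \<in> N (inc i m)" for x m v
    proof -
      have xc: "x \<in> carrier R" by (rule F_carr[OF i x(1)])
      have vc: "v \<in> carrier M" by (rule W_carr[OF v(1)])
      have "N (inc i m) \<subseteq> N' (inc i m)" using less by (simp add: less_le le_fun_def)
      then have "v \<in> sat N' m" using Q(3) x v by blast
      then obtain l where l: "\<forall>f\<in>\<F> l. f \<odot>\<^bsub>M\<^esub> v \<in> N' (m [+] l)" unfolding sat_def by blast
      have "f \<odot>\<^bsub>M\<^esub> v \<in> sat N (m [+] l)" if f: "f \<in> \<F> l" for f
      proof (cases "\<forall>j\<le>d. n j \<le> (m [+] l) j")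
        case False
        then show ?thesis using l f subset_sat[OF N] unfolding N'_def by (auto split: if_splits)
      next
        case True
        define s where "s = m [+] l"
        have fc: "f \<in> carrier R" by (rule multi_power_carr[OF f])
        have "f \<odot>\<^bsub>M\<^esub> v \<in> N' s" using l f unfolding s_def by blast
        then obtain w g where wg: "w \<in> N s" "g \<in> \<F> (\<lambda>j. s j - n j)" "f \<odot>\<^bsub>M\<^esub> v = w \<oplus>\<^bsub>M\<^esub> g \<odot>\<^bsub>M\<^esub> u"
          using True unfolding N'_def s_def by (auto simp: mem_sum)
        have wc: "w \<in> carrier M" by (rule submod_carr[OF sub wg(1)])
        have gc: "g \<in> carrier R" by (rule multi_power_carr[OF wg(2)])
        have "\<forall>j\<le>d. n j \<le> s j" using True unfolding s_def .
        then have guW: "g \<odot>\<^bsub>M\<^esub> u \<in> W s" using wg(2) by (rule gu)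
        have "x \<odot>\<^bsub>M\<^esub> (f \<odot>\<^bsub>M\<^esub> v) = x \<odot>\<^bsub>M\<^esub> w \<oplus>\<^bsub>M\<^esub> x \<odot>\<^bsub>M\<^esub> (g \<odot>\<^bsub>M\<^esub> u)"
          unfolding wg(3) using xc wc gc uc by (simp add: smult_r_distr)
        then have "x \<odot>\<^bsub>M\<^esub> w \<oplus>\<^bsub>M\<^esub> x \<odot>\<^bsub>M\<^esub> (g \<odot>\<^bsub>M\<^esub> u) = f \<odot>\<^bsub>M\<^esub> (x \<odot>\<^bsub>M\<^esub> v)"
          by (simp add: smult_comm[OF xc fc vc])
        moreover have "f \<odot>\<^bsub>M\<^esub> (x \<odot>\<^bsub>M\<^esub> v) \<in> N (inc i m [+] l)"
          by (rule gfams_multi_power[OF N, of f l "x \<odot>\<^bsub>M\<^esub> v" "inc i m", OF f v(2)])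
        moreover have "inc i m [+] l = inc i s" unfolding s_def by auto
        moreover have "x \<odot>\<^bsub>M\<^esub> w \<in> N (inc i s)" by (rule gfamsD(3)[OF N, of i x w s, OF i x(1) wg(1)])
        ultimately have xgu: "x \<odot>\<^bsub>M\<^esub> (g \<odot>\<^bsub>M\<^esub> u) \<in> N (inc i s)"
          using submod_add_cancel[OF sub, of "x \<odot>\<^bsub>M\<^esub> w" "inc i s"] xc gc uc by simp
        \<comment> \<open>The trace belonging to \<open>g u\<close> contains \<open>p\<close>,
          because \<open>g u\<close> is a multiple of \<open>u\<close>. If \<open>g u\<close> were
          not saturated, maximality would make this trace equal to \<open>p\<close>; but it contains
          \<open>x\<close>, which avoids \<open>p\<close>.\<close>
        have "g \<odot>\<^bsub>M\<^esub> u \<in> sat N s"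
        proof (rule ccontr)
          assume "g \<odot>\<^bsub>M\<^esub> u \<notin> sat N s"
          then have "q s (g \<odot>\<^bsub>M\<^esub> u) \<in> X" unfolding X_def using guW by blast
          moreover have "p \<subseteq> q s (g \<odot>\<^bsub>M\<^esub> u)"
          proof
            fix y assume y: "y \<in> p"
            have yF: "y \<in> F i" "y \<odot>\<^bsub>M\<^esub> u \<in> sat N (inc i n)" using y unfolding u(1) q_def by auto
            have "y \<odot>\<^bsub>M\<^esub> (g \<odot>\<^bsub>M\<^esub> u) = g \<odot>\<^bsub>M\<^esub> (y \<odot>\<^bsub>M\<^esub> u)" by (rule smult_comm[OF F_carr[OF i yF(1)] gc uc])
            moreover have "g \<odot>\<^bsub>M\<^esub> (y \<odot>\<^bsub>M\<^esub> u) \<in> sat N (inc i n [+] (\<lambda>j. s j - n j))"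
              by (rule gfams_multi_power[OF sat_gfams[OF N], of g "\<lambda>j. s j - n j" "y \<odot>\<^bsub>M\<^esub> u" "inc i n", OF wg(2) yF(2)])
            moreover have "sat N (inc i n [+] (\<lambda>j. s j - n j)) = sat N (inc i s)"
            proof (rule gfamsD(4)[OF sat_gfams[OF N]])
              fix j assume "j \<le> d"
              then have "n j \<le> s j" using True unfolding s_def by blast
              then show "(inc i n [+] (\<lambda>j. s j - n j)) j = inc i s j" by simp
            qed
            ultimately show "y \<in> q s (g \<odot>\<^bsub>M\<^esub> u)" unfolding q_def using yF(1) by simp
          qed
          ultimately have "q s (g \<odot>\<^bsub>M\<^esub> u) = p" by (rule p(2))
          moreover have "x \<in> q s (g \<odot>\<^bsub>M\<^esub> u)" unfolding q_def using x(1) xgu subset_sat[OF N] by blast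
          ultimately show False using x(2) by blast
        qed
        then have "f \<odot>\<^bsub>M\<^esub> v \<in> sat N s"
          unfolding wg(3) using wg(1) subset_sat[OF N] submoduleE(5)[OF ss] by blast
        then show ?thesis unfolding s_def .
      qed
      then show ?thesis by (rule sat_lift[OF N v(1)])
    qed
    moreover have "ideal p R" unfolding u(1) by (rule q_ideal[OF u(2)])
    ultimately show ?thesis using Q(1,2) p_proper by (intro exI[of _ "insert p Q"]) blast
  qed
qed

end

section \<open>Large multi-indices\<close>

text \<open>As a filter, largeness of multi-indices lets finitely many conditions be combined
  without keeping track of bounds.\<close>

definition large :: "nat \<Rightarrow> (nat \<Rightarrow> nat) filter" where
  "large d = (INF N. principal {n. \<forall>i\<le>d. N \<le> n i})"

lemma eventually_large: "eventually P (large d) \<longleftrightarrow> (\<exists>N. \<forall>n. (\<forall>i\<le>d. N \<le> n i) \<longrightarrow> P n)"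
  unfolding large_def
proof (subst eventually_INF_base)
  fix a b :: nat
  have "{n :: nat \<Rightarrow> nat. \<forall>i\<le>d. max a b \<le> n i} \<subseteq> {n. \<forall>i\<le>d. a \<le> n i} \<inter> {n. \<forall>i\<le>d. b \<le> n i}" by auto
  then show "\<exists>x\<in>UNIV. principal {n :: nat \<Rightarrow> nat. \<forall>i\<le>d. x \<le> n i}
      \<le> inf (principal {n. \<forall>i\<le>d. a \<le> n i}) (principal {n. \<forall>i\<le>d. b \<le> n i})"
    by (intro bexI[of _ "max a b"]) auto
qed (auto simp: eventually_principal)

lemma for_all_large_iff: "for_all_large d P \<longleftrightarrow> eventually P (large d)"
  unfolding for_all_large_def eventually_large ..

lemma eventually_large_ge: "eventually (\<lambda>n. \<forall>i\<le>d. c \<le> n i) (large d)"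
  unfolding eventually_large by blast

lemma eventually_large_inc:
  assumes "eventually P (large d)" shows "eventually (\<lambda>n. P (inc i n)) (large d)"
proof -
  obtain N where N: "\<And>n. (\<forall>i\<le>d. N \<le> n i) \<Longrightarrow> P n" using assms unfolding eventually_large by blast
  have "P (inc i n)" if "\<forall>i\<le>d. N \<le> n i" for n using that by (intro N) (auto intro: le_SucI)
  then show ?thesis unfolding eventually_large by blast
qed

lemma eventually_large_dec:
  assumes "eventually P (large d)" shows "eventually (\<lambda>n. P (dec i n)) (large d)"
proof -
  obtain N where N: "\<And>n. (\<forall>i\<le>d. N \<le> n i) \<Longrightarrow> P n" using assms unfolding eventually_large by blast
  have "P (dec i n)" if "\<forall>i\<le>d. Suc N \<le> n i" for n using that by (intro N) (auto simp: dec_def Suc_le_eq dest: Suc_le_lessD intro: less_imp_le)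
  then show ?thesis unfolding eventually_large by blast
qed

lemma inc_dec: "1 \<le> n i \<Longrightarrow> inc i (dec i n) = n" "dec i (inc i n) = n"
  by (auto simp: dec_def)

section \<open>Local rings with infinite residue field\<close>

locale local_multi_ideals = multi_ideals R M d F for R (structure) and M (structure) and d F +
  fixes \<mm> :: "'a set"
  assumes local_ring: "local_ring R \<mm>" and residue_infinite: "infinite (carrier (R Quot \<mm>))"
    and F0_primary: "primary_to R \<mm> (F 0)"
begin

lemma \<mm>_max: "maximalideal \<mm> R"
  using local_ring unfolding local_ring_def by blast

lemma \<mm>_ideal: "ideal \<mm> R"
  using \<mm>_max maximalideal.axioms(1) by blast

lemma proper_ideal_subset:
  assumes I: "ideal I R" "I \<noteq> carrier R"
  shows "I \<subseteq> \<mm>"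
proof -
  define X where "X = {K. ideal K R \<and> I \<subseteq> K \<and> K \<noteq> carrier R}"
  have sub: "X \<subseteq> {I. ideal I R}" and ne: "X \<noteq> {}" using I unfolding X_def by auto
  obtain K where K0: "K \<in> X" "\<And>L. L \<in> X \<Longrightarrow> K \<subseteq> L \<Longrightarrow> L = K"
    using acc_on_max[OF acc_ideals sub ne] by metis
  have K: "ideal K R" "I \<subseteq> K" "K \<noteq> carrier R" using K0(1) unfolding X_def by auto
  have K4: "L = K" if "ideal L R" "I \<subseteq> L" "L \<noteq> carrier R" "K \<subseteq> L" for L
    using K0(2)[of L] that unfolding X_def by simp
  have "maximalideal K R"
  proof (rule maximalidealI)
    show "J = K \<or> J = carrier R" if "ideal J R" "K \<subseteq> J" for J
      using K4[of J] that K(2) by blast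
  qed (use K in auto)
  then have "K = \<mm>" using local_ring unfolding local_ring_def by blast
  then show ?thesis using K(2) by simp
qed

lemma unit_outside_\<mm>:
  assumes "r \<in> carrier R" "r \<notin> \<mm>"
  obtains s where "s \<in> carrier R" "s \<otimes> r = \<one>"
proof -
  have "r \<in> PIdl r" by (rule cgenideal_self[OF assms(1)])
  then have "PIdl r = carrier R" using proper_ideal_subset[OF cgenideal_ideal[OF assms(1)]] assms(2) by blast
  then have "\<one> \<in> PIdl r" by simp
  then show thesis using that unfolding cgenideal_def by auto
qed

lemma residue_representatives:
  obtains \<Lambda> where "infinite \<Lambda>" "\<Lambda> \<subseteq> carrier R" "\<And>a. a \<in> \<Lambda> \<Longrightarrow> a \<notin> \<mm>"
    "\<And>a b. a \<in> \<Lambda> \<Longrightarrow> b \<in> \<Lambda> \<Longrightarrow> a \<noteq> b \<Longrightarrow> a \<ominus> b \<notin> \<mm>"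
proof -
  interpret I: ideal \<mm> R by (rule \<mm>_ideal)
  have c: "carrier (R Quot \<mm>) = (\<lambda>a. \<mm> +> a) ` carrier R"
    unfolding FactRing_def A_RCOSETS_def' by auto
  define r where "r X = (SOME a. a \<in> carrier R \<and> \<mm> +> a = X)" for X
  have r: "r X \<in> carrier R" "\<mm> +> r X = X" if "X \<in> carrier (R Quot \<mm>)" for X
    using someI_ex[of "\<lambda>a. a \<in> carrier R \<and> \<mm> +> a = X"] that unfolding c r_def by auto
  let ?S = "carrier (R Quot \<mm>) - {\<mm>}"
  have inj: "inj_on r ?S" by (rule inj_on_inverseI[of _ "\<lambda>a. \<mm> +> a"]) (use r in auto)
  show thesis
  proof (rule that[of "r ` ?S"])
    show "infinite (r ` ?S)" using residue_infinite inj by (simp add: finite_image_iff)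
    show "r ` ?S \<subseteq> carrier R" using r by auto
    show "a \<notin> \<mm>" if a: "a \<in> r ` ?S" for a
    proof
      assume "a \<in> \<mm>"
      then have "\<mm> +> a = \<mm>" by (rule I.a_rcos_const)
      then show False using a r by auto
    qed
    show "a \<ominus> b \<notin> \<mm>" if a: "a \<in> r ` ?S" and b: "b \<in> r ` ?S" and ne: "a \<noteq> b" for a b
    proof
      assume ab: "a \<ominus> b \<in> \<mm>"
      obtain X Y where XY: "X \<in> ?S" "a = r X" "Y \<in> ?S" "b = r Y" using a b by blast
      then have cc: "a \<in> carrier R" "b \<in> carrier R" using r by auto
      have "\<mm> +> a = \<mm> +> b" using R.quotient_eq_iff_same_a_r_cos[OF \<mm>_ideal cc] ab by blast
      then have "X = Y" using XY r by auto
      then show False using XY ne by simp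
    qed
  qed
qed

text \<open>The infinite residue field takes the place of primality. With \<open>x\<close> outside
  all members of \<open>Q\<close> and \<open>y\<close> outside \<open>p\<close>, the candidates are
  \<open>x + a y\<close> for representatives \<open>a\<close> of distinct nonzero residue classes.
  Two failures for the same \<open>q\<close> give \<open>(a - b) y\<close> in \<open>q\<close> with
  \<open>a - b\<close> a unit, hence \<open>y\<close> and then \<open>x\<close> in \<open>q\<close>;
  so each \<open>q\<close> excludes at most one \<open>a\<close>.\<close>

lemma ideal_avoidance:
  assumes I: "ideal I R" and fin: "finite Q" and Q: "\<And>q. q \<in> Q \<Longrightarrow> ideal q R" "\<And>q. q \<in> Q \<Longrightarrow> q \<subset> I"
  shows "\<exists>x\<in>I. \<forall>q\<in>Q. x \<notin> q"
  using fin Q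
proof (induction Q)
  case empty
  then show ?case using additive_subgroup.zero_closed[OF ideal.axioms(1)[OF I]] by blast
next
  case (insert p Q)
  then obtain x where x: "x \<in> I" "\<forall>q\<in>Q. x \<notin> q" by auto
  obtain y where y: "y \<in> I" "y \<notin> p" using insert.prems(2) by blast
  show ?case
  proof (cases "x \<in> p")
    case False
    then show ?thesis using x by blast
  next
    case True
    have xy: "x \<in> carrier R" "y \<in> carrier R" using x y ideal_carr[OF I] by auto
    obtain \<Lambda> where \<Lambda>: "infinite \<Lambda>" "\<Lambda> \<subseteq> carrier R" "\<And>a. a \<in> \<Lambda> \<Longrightarrow> a \<notin> \<mm>"
      "\<And>a b. a \<in> \<Lambda> \<Longrightarrow> b \<in> \<Lambda> \<Longrightarrow> a \<noteq> b \<Longrightarrow> a \<ominus> b \<notin> \<mm>"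
      using residue_representatives by blast
    have cancel: "v \<in> q" if q: "ideal q R" and a: "a \<in> carrier R" "a \<notin> \<mm>" and v: "v \<in> carrier R" "a \<otimes> v \<in> q" for q a v
    proof -
      obtain s where s: "s \<in> carrier R" "s \<otimes> a = \<one>" using unit_outside_\<mm>[OF a] by blast
      have "s \<otimes> (a \<otimes> v) = v" using s a v by (simp flip: m_assoc)
      then show ?thesis using ideal.I_l_closed[OF q v(2) s(1)] by simp
    qed
    have bad: "finite {a \<in> \<Lambda>. x \<oplus> a \<otimes> y \<in> q}" (is "finite ?B") if q: "q \<in> Q" for q
    proof -
      have qi: "ideal q R" using insert.prems(1) q by blast
      interpret q: ideal q R by (rule qi)
      have unique: "a = b" if a: "a \<in> \<Lambda>" "x \<oplus> a \<otimes> y \<in> q" and b: "b \<in> \<Lambda>" "x \<oplus> b \<otimes> y \<in> q" for a b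
      proof (rule ccontr)
        assume "a \<noteq> b"
        then have ab: "a \<ominus> b \<notin> \<mm>" using \<Lambda>(4) a b by blast
        have c: "a \<in> carrier R" "b \<in> carrier R" using a b \<Lambda>(2) by auto
        have "(x \<oplus> a \<otimes> y) \<ominus> (x \<oplus> b \<otimes> y) = (a \<ominus> b) \<otimes> y" using c xy by algebra
        then have "(a \<ominus> b) \<otimes> y \<in> q"
          using q.a_closed[OF a(2) q.a_inv_closed[OF b(2)]] by (simp only: R.minus_eq)
        moreover have "a \<ominus> b \<in> carrier R" using c by simp
        ultimately have "y \<in> q" using cancel[OF qi _ ab xy(2)] by blast
        then have "a \<otimes> y \<in> q" using c q.I_l_closed by blast
        then have "(x \<oplus> a \<otimes> y) \<oplus> \<ominus> (a \<otimes> y) \<in> q" using a(2) q.a_closed q.a_inv_closed by blast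
        moreover have "(x \<oplus> a \<otimes> y) \<oplus> \<ominus> (a \<otimes> y) = x" using c xy by algebra
        ultimately show False using x(2) q by simp
      qed
      show ?thesis
      proof (cases "?B = {}")
        case False
        then obtain b where "b \<in> ?B" by blast
        then have "?B \<subseteq> {b}" using unique by blast
        then show ?thesis by (rule finite_subset) simp
      next
        case True
        then show ?thesis by (simp only: finite.emptyI)
      qed
    qed
    have "infinite (\<Lambda> - (\<Union>q\<in>Q. {a \<in> \<Lambda>. x \<oplus> a \<otimes> y \<in> q}))"
      using \<Lambda>(1) bad insert.hyps(1) by (intro Diff_infinite_finite) auto
    from infinite_imp_nonempty[OF this] obtain a where "a \<in> \<Lambda> - (\<Union>q\<in>Q. {a \<in> \<Lambda>. x \<oplus> a \<otimes> y \<in> q})" by blast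
    then have a: "a \<in> \<Lambda>" "\<forall>q\<in>Q. x \<oplus> a \<otimes> y \<notin> q" by auto
    have ac: "a \<in> carrier R" using a \<Lambda>(2) by blast
    \<comment> \<open>Here \<open>x\<close> lies in \<open>p\<close> and \<open>a\<close> is a unit,
      so membership of the sum in \<open>p\<close> would force \<open>y\<close> into
      \<open>p\<close>.\<close>
    have "x \<oplus> a \<otimes> y \<notin> p"
    proof
      assume m: "x \<oplus> a \<otimes> y \<in> p"
      have pi: "ideal p R" using insert.prems(1) by blast
      interpret p: ideal p R by (rule pi)
      have "(x \<oplus> a \<otimes> y) \<oplus> \<ominus> x \<in> p" using m True p.a_closed p.a_inv_closed by blast
      moreover have "(x \<oplus> a \<otimes> y) \<oplus> \<ominus> x = a \<otimes> y" using ac xy by algebra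
      ultimately have "y \<in> p" using cancel[OF pi ac \<Lambda>(3)[OF a(1)] xy(2)] by simp
      then show False using y by blast
    qed
    moreover have "x \<oplus> a \<otimes> y \<in> I"
      using x y ac ideal.I_l_closed[OF I] additive_subgroup.a_closed[OF ideal.axioms(1)[OF I]] by blast
    ultimately show ?thesis using a(2) by blast
  qed
qed

text \<open>If \<open>P\<close> were a proper submodule of \<open>Q\<close>, the chain condition
  would give \<open>K\<close> maximal among the proper submodules of \<open>Q\<close> containing
  \<open>P\<close>. For \<open>a\<close> in \<open>\<mm>\<close> and \<open>v\<close> in
  \<open>Q\<close> with \<open>a v\<close> outside \<open>K\<close>, maximality puts
  \<open>v\<close> into \<open>K + R a v\<close>; as \<open>1 - g a\<close> is a unit,
  \<open>v\<close> is in \<open>K\<close>, a contradiction. So \<open>K\<close> contains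
  \<open>P\<close> and \<open>\<mm> Q\<close>, hence \<open>Q\<close>.\<close>

lemma nakayama:
  assumes P: "submodule P R M" and Q: "submodule Q R M" and PQ: "P \<subseteq> Q"
    and le: "Q \<subseteq> P <+>\<^bsub>M\<^esub> ideal_smult R M \<mm> Q"
  shows "Q = P"
proof (rule ccontr)
  assume ne: "Q \<noteq> P"
  have mc: "\<mm> \<subseteq> carrier R" using ideal_carr[OF \<mm>_ideal] by blast
  let ?X = "{K. submodule K R M \<and> P \<subseteq> K \<and> K \<subset> Q}"
  have "?X \<subseteq> submods" "?X \<noteq> {}" using P PQ ne unfolding submods_def by auto
  then obtain K where "K \<in> ?X" "\<And>L. L \<in> ?X \<Longrightarrow> K \<subseteq> L \<Longrightarrow> L = K"
    using acc_on_max[OF acc_submods, of ?X] by blast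
  then have K: "submodule K R M" "P \<subseteq> K" "K \<subset> Q"
    "\<And>L. submodule L R M \<Longrightarrow> P \<subseteq> L \<Longrightarrow> L \<subset> Q \<Longrightarrow> K \<subseteq> L \<Longrightarrow> L = K"
    by auto
  obtain u where u: "u \<in> Q" "u \<notin> K" using K(3) by blast
  have uc: "u \<in> carrier M" by (rule submod_carr[OF Q u(1)])
  have key: "a \<odot>\<^bsub>M\<^esub> v \<in> K" if a: "a \<in> \<mm>" and v: "v \<in> Q" for a v
  proof (rule ccontr)
    assume n: "a \<odot>\<^bsub>M\<^esub> v \<notin> K"
    have ac: "a \<in> carrier R" using a mc by blast
    have vc: "v \<in> carrier M" by (rule submod_carr[OF Q v])
    let ?C = "(\<lambda>g. g \<odot>\<^bsub>M\<^esub> (a \<odot>\<^bsub>M\<^esub> v)) ` carrier R"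
    have avc: "a \<odot>\<^bsub>M\<^esub> v \<in> carrier M" using ac vc by simp
    have C: "submodule ?C R M" by (rule ideal_image_submod[OF oneideal avc])
    have "a \<odot>\<^bsub>M\<^esub> v \<in> ?C" using avc by (intro image_eqI[of _ _ \<one>]) auto
    then have notin: "\<not> K <+>\<^bsub>M\<^esub> ?C \<subseteq> K" using n sum_upper2[OF K(1) C] by blast
    have "?C \<subseteq> Q" using submoduleE(4)[OF Q] v ac by auto
    then have "K <+>\<^bsub>M\<^esub> ?C \<subseteq> Q" using K(3) sum_least[OF Q] by blast
    then have "K <+>\<^bsub>M\<^esub> ?C = Q"
      using K(4)[OF submod_sum[OF K(1) C]] sum_upper1[OF K(1) C] K(2) notin by blast
    then have "v \<in> K <+>\<^bsub>M\<^esub> ?C" using v by simp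
    then obtain w g where wg: "w \<in> K" "g \<in> carrier R" "v = w \<oplus>\<^bsub>M\<^esub> g \<odot>\<^bsub>M\<^esub> (a \<odot>\<^bsub>M\<^esub> v)"
      by (auto simp: mem_sum)
    have wc: "w \<in> carrier M" by (rule submod_carr[OF K(1) wg(1)])
    have "\<one> \<ominus> g \<otimes> a \<notin> \<mm>"
    proof
      assume m: "\<one> \<ominus> g \<otimes> a \<in> \<mm>"
      interpret \<mm>: ideal \<mm> R by (rule \<mm>_ideal)
      have "g \<otimes> a \<in> \<mm>" using a wg(2) \<mm>.I_l_closed by blast
      then have "(\<one> \<ominus> g \<otimes> a) \<oplus> g \<otimes> a \<in> \<mm>" using m \<mm>.a_closed by blast
      moreover have "(\<one> \<ominus> g \<otimes> a) \<oplus> g \<otimes> a = \<one>" using wg(2) ac by algebra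
      ultimately have "\<mm> = carrier R" using \<mm>.one_imp_carrier by simp
      then show False using maximalideal.I_notcarr[OF \<mm>_max] by simp
    qed
    then obtain s where s: "s \<in> carrier R" "s \<otimes> (\<one> \<ominus> g \<otimes> a) = \<one>"
      using unit_outside_\<mm>[of "\<one> \<ominus> g \<otimes> a"] wg(2) ac by auto
    define t where "t = g \<odot>\<^bsub>M\<^esub> (a \<odot>\<^bsub>M\<^esub> v)"
    have tc: "t \<in> carrier M" unfolding t_def using wg(2) avc by simp
    have "(\<one> \<ominus> g \<otimes> a) \<odot>\<^bsub>M\<^esub> v = v \<ominus>\<^bsub>M\<^esub> t"
      unfolding t_def using wg(2) ac vc by (simp add: R.minus_eq M.minus_eq smult_l_distr smult_l_minus smult_assoc1)
    also have "\<dots> = w" using wg(3) wc tc unfolding t_def[symmetric]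
      by (metis M.add.inv_solve_right M.minus_eq vc)
    finally have "v = s \<odot>\<^bsub>M\<^esub> w" using s wg(2) ac vc by (metis R.minus_closed R.m_closed R.one_closed smult_assoc1 smult_one)
    then have "v \<in> K" using submoduleE(4)[OF K(1) s(1) wg(1)] by simp
    then show False using n submoduleE(4)[OF K(1) ac] by blast
  qed
  have "ideal_smult R M \<mm> Q \<subseteq> K" by (rule ideal_smult_least[OF K(1) key])
  then have "Q \<subseteq> K" using le sum_least[OF K(1) K(2)] by blast
  then show False using K(3) by blast
qed

section \<open>Weak-(FC)-elements relative to a submodule\<close>

text \<open>Filter-regularity for \<open>W\<close> and for its graded pieces, read modulo
  \<open>N\<close>. The pieces are taken in every direction \<open>j\<close>, because
  \<open>good_climb\<close> has to raise the multi-index in all coordinates.\<close>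

definition good :: "'c set \<Rightarrow> nat \<Rightarrow> 'a \<Rightarrow> bool" where
  "good N i x \<longleftrightarrow> i \<le> d \<and> x \<in> F i \<and> eventually (\<lambda>n. \<forall>u\<in>W n. x \<odot>\<^bsub>M\<^esub> u \<in> N \<longrightarrow> u \<in> N) (large d) \<and>
    (\<forall>j\<le>d. eventually (\<lambda>n. \<forall>u\<in>W n. x \<odot>\<^bsub>M\<^esub> u \<in> W (inc j (inc i n)) <+>\<^bsub>M\<^esub> N \<longrightarrow> u \<in> W (inc j n) <+>\<^bsub>M\<^esub> N) (large d))"

text \<open>Each family forbids only finitely many proper subideals of \<open>F i\<close>, so one
  \<open>x\<close> serves all of them, and in large degrees the saturations coincide with the
  families.\<close>

lemma common_regular_element:
  assumes i: "i \<le> d" and fin: "finite G" and G: "G \<subseteq> gfams"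
  shows "\<exists>x\<in>F i. \<forall>N\<in>G. eventually (\<lambda>n. \<forall>u\<in>W n. x \<odot>\<^bsub>M\<^esub> u \<in> N (inc i n) \<longrightarrow> u \<in> N n) (large d)"
proof -
  have "\<forall>N\<in>G. \<exists>Q. finite Q \<and> (\<forall>q\<in>Q. ideal q R \<and> q \<subset> F i) \<and>
    (\<forall>x\<in>F i. (\<forall>q\<in>Q. x \<notin> q) \<longrightarrow> (\<forall>n. \<forall>u\<in>W n. x \<odot>\<^bsub>M\<^esub> u \<in> N (inc i n) \<longrightarrow> u \<in> sat N n))"
    using regular_elements[OF _ i] G by blast
  then obtain Q where Q: "\<And>N. N \<in> G \<Longrightarrow> finite (Q N)" "\<And>N q. N \<in> G \<Longrightarrow> q \<in> Q N \<Longrightarrow> ideal q R \<and> q \<subset> F i"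
    "\<And>N x n u. N \<in> G \<Longrightarrow> x \<in> F i \<Longrightarrow> (\<forall>q\<in>Q N. x \<notin> q) \<Longrightarrow> u \<in> W n \<Longrightarrow> x \<odot>\<^bsub>M\<^esub> u \<in> N (inc i n) \<Longrightarrow> u \<in> sat N n"
    by metis
  obtain x where x: "x \<in> F i" "\<forall>q\<in>(\<Union>N\<in>G. Q N). x \<notin> q"
    using ideal_avoidance[OF F_ideal[OF i], of "\<Union>N\<in>G. Q N"] fin Q(1,2) by blast
  have "eventually (\<lambda>n. \<forall>u\<in>W n. x \<odot>\<^bsub>M\<^esub> u \<in> N (inc i n) \<longrightarrow> u \<in> N n) (large d)" if N: "N \<in> G" for N
  proof -
    obtain c where c: "\<And>n. (\<And>i. i \<le> d \<Longrightarrow> c \<le> n i) \<Longrightarrow> sat N n = N n"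
      using sat_eventually[of N] G N by blast
    show ?thesis
      using eventually_large_ge[of d c]
    proof eventually_elim
      case (elim n)
      then have "sat N n = N n" using c by blast
      then show ?case using Q(3)[OF N x(1)] x(2) N by blast
    qed
  qed
  then show ?thesis using x(1) by blast
qed

lemma Int_gfams:
  assumes N: "submodule N R M"
  shows "(\<lambda>n. W n \<inter> N) \<in> gfams"
proof (rule gfamsI)
  show "a \<odot>\<^bsub>M\<^esub> u \<in> W (inc i n) \<inter> N" if "i \<le> d" "a \<in> F i" "u \<in> W n \<inter> N" for i a u n
    using that F_W F_carr submoduleE(4)[OF N] by blast
  show "W n \<inter> N = W m \<inter> N" if "\<And>i. i \<le> d \<Longrightarrow> n i = m i" for n m using W_cong[OF that] by simp
qed (auto intro: submod_Int W_submod N)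

text \<open>Intersecting with \<open>W n\<close> turns the preimage of a graded submodule modulo
  \<open>N\<close> into a member of \<open>gfams\<close>. It is applied to
  \<open>K n = W (inc j n)\<close> and, in the exchange argument, to the sum of \<open>J W n\<close>
  and the remaining terms of a joint reduction.\<close>

lemma Int_sum_gfams:
  assumes N: "submodule N R M" and K: "\<And>n. submodule (K n) R M"
    and Kst: "\<And>i a u n. i \<le> d \<Longrightarrow> a \<in> F i \<Longrightarrow> u \<in> K n \<Longrightarrow> a \<odot>\<^bsub>M\<^esub> u \<in> K (inc i n)"
    and Kcong: "\<And>n m. (\<And>i. i \<le> d \<Longrightarrow> n i = m i) \<Longrightarrow> K n = K m"
  shows "(\<lambda>n. W n \<inter> (K n <+>\<^bsub>M\<^esub> N)) \<in> gfams"
proof (rule gfamsI)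
  show "submodule (W n \<inter> (K n <+>\<^bsub>M\<^esub> N)) R M" for n by (intro submod_Int W_submod submod_sum K N)
  show "a \<odot>\<^bsub>M\<^esub> u \<in> W (inc i n) \<inter> (K (inc i n) <+>\<^bsub>M\<^esub> N)"
    if i: "i \<le> d" and a: "a \<in> F i" and u: "u \<in> W n \<inter> (K n <+>\<^bsub>M\<^esub> N)" for i a u n
  proof -
    obtain v w where vw: "v \<in> K n" "w \<in> N" "u = v \<oplus>\<^bsub>M\<^esub> w" using u by (auto simp: mem_sum)
    have "a \<odot>\<^bsub>M\<^esub> u = a \<odot>\<^bsub>M\<^esub> v \<oplus>\<^bsub>M\<^esub> a \<odot>\<^bsub>M\<^esub> w"
      using vw submod_carr[OF K] submod_carr[OF N] F_carr[OF i a] by (simp add: smult_r_distr)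
    then have "a \<odot>\<^bsub>M\<^esub> u \<in> K (inc i n) <+>\<^bsub>M\<^esub> N"
      using sumI[OF Kst[OF i a vw(1)] submoduleE(4)[OF N F_carr[OF i a] vw(2)]] by simp
    then show ?thesis using F_W[OF i a, of u n] u by blast
  qed
  show "W n \<inter> (K n <+>\<^bsub>M\<^esub> N) = W m \<inter> (K m <+>\<^bsub>M\<^esub> N)" if "\<And>i. i \<le> d \<Longrightarrow> n i = m i" for n m
    using W_cong[OF that] Kcong[OF that] by simp
qed auto

text \<open>The additional families \<open>G\<close> serve the exchange argument, where a good
  element must also be regular on a quotient built from the joint reduction.\<close>

lemma good_exists:
  assumes N: "submodule N R M" and i: "i \<le> d" and fin: "finite G" and G: "G \<subseteq> gfams"
  obtains x where "good N i x"
    "\<And>K. K \<in> G \<Longrightarrow> eventually (\<lambda>n. \<forall>u\<in>W n. x \<odot>\<^bsub>M\<^esub> u \<in> K (inc i n) \<longrightarrow> u \<in> K n) (large d)"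
proof -
  let ?K = "\<lambda>j n. W n \<inter> (W (inc j n) <+>\<^bsub>M\<^esub> N)"
  have K: "?K j \<in> gfams" if j: "j \<le> d" for j
  proof (rule Int_sum_gfams[OF N W_submod])
    show "a \<odot>\<^bsub>M\<^esub> u \<in> W (inc j (inc i n))" if "i \<le> d" "a \<in> F i" "u \<in> W (inc j n)" for i a u n
    proof -
      have "inc i (inc j n) = inc j (inc i n)" by auto
      then show ?thesis using F_W[OF that] by simp
    qed
    show "W (inc j n) = W (inc j m)" if "\<And>i. i \<le> d \<Longrightarrow> n i = m i" for n m
      using that by (intro W_cong) auto
  qed
  have "finite (G \<union> {\<lambda>n. W n \<inter> N} \<union> ?K ` {..d})" "G \<union> {\<lambda>n. W n \<inter> N} \<union> ?K ` {..d} \<subseteq> gfams"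
    using fin G Int_gfams[OF N] K by auto
  then obtain x where x: "x \<in> F i" and ev: "\<forall>L\<in>G \<union> {\<lambda>n. W n \<inter> N} \<union> ?K ` {..d}.
      eventually (\<lambda>n. \<forall>u\<in>W n. x \<odot>\<^bsub>M\<^esub> u \<in> L (inc i n) \<longrightarrow> u \<in> L n) (large d)"
    using common_regular_element[OF i, of "G \<union> {\<lambda>n. W n \<inter> N} \<union> ?K ` {..d}"] by blast
  show thesis
  proof (rule that)
    have "eventually (\<lambda>n. \<forall>u\<in>W n. x \<odot>\<^bsub>M\<^esub> u \<in> W (inc i n) \<inter> N \<longrightarrow> u \<in> W n \<inter> N) (large d)"
      using ev by auto
    then have 1: "eventually (\<lambda>n. \<forall>u\<in>W n. x \<odot>\<^bsub>M\<^esub> u \<in> N \<longrightarrow> u \<in> N) (large d)"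
      by (rule eventually_mono) (use F_W[OF i x] in blast)
    have 2: "eventually (\<lambda>n. \<forall>u\<in>W n. x \<odot>\<^bsub>M\<^esub> u \<in> W (inc j (inc i n)) <+>\<^bsub>M\<^esub> N \<longrightarrow> u \<in> W (inc j n) <+>\<^bsub>M\<^esub> N) (large d)"
      if j: "j \<le> d" for j
    proof -
      have "eventually (\<lambda>n. \<forall>u\<in>W n. x \<odot>\<^bsub>M\<^esub> u \<in> ?K j (inc i n) \<longrightarrow> u \<in> ?K j n) (large d)"
        by (rule bspec[OF ev]) (use j in blast)
      then show ?thesis by (rule eventually_mono) (use F_W[OF i x] in blast)
    qed
    show "good N i x" unfolding good_def using i x 1 2 by blast
    show "\<And>K. K \<in> G \<Longrightarrow> eventually (\<lambda>n. \<forall>u\<in>W n. x \<odot>\<^bsub>M\<^esub> u \<in> K (inc i n) \<longrightarrow> u \<in> K n) (large d)"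
      using ev by blast
  qed
qed

end

section \<open>Relative length\<close>

context module
begin

definition has_chain :: "'c set \<Rightarrow> 'c set \<Rightarrow> nat \<Rightarrow> bool" where
  "has_chain P Q l \<longleftrightarrow> (\<exists>C :: nat \<Rightarrow> 'c set. (\<forall>i\<le>l. submodule (C i) R M \<and> P \<subseteq> C i \<and> C i \<subseteq> Q) \<and>
     (\<forall>i<l. C i \<subset> C (Suc i)))"

definition rel_length :: "'c set \<Rightarrow> 'c set \<Rightarrow> enat" where
  "rel_length P Q = Sup {enat l |l. has_chain P Q l}"

lemma has_chain_zero: "submodule P R M \<Longrightarrow> P \<subseteq> Q \<Longrightarrow> has_chain P Q 0"
  unfolding has_chain_def by (intro exI[of _ "\<lambda>_. P"]) simp

lemma rel_length_ge: "has_chain P Q l \<Longrightarrow> enat l \<le> rel_length P Q"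
  unfolding rel_length_def by (rule Sup_upper) blast

lemma rel_length_le: "(\<And>l. has_chain P Q l \<Longrightarrow> enat l \<le> b) \<Longrightarrow> rel_length P Q \<le> b"
  unfolding rel_length_def by (rule Sup_least) blast

lemma has_chain_mono: "has_chain P Q l \<Longrightarrow> Q \<subseteq> Q' \<Longrightarrow> has_chain P Q' l"
  unfolding has_chain_def by (meson order_trans)

lemma rel_length_mono: "Q \<subseteq> Q' \<Longrightarrow> rel_length P Q \<le> rel_length P Q'"
  by (intro rel_length_le rel_length_ge) (rule has_chain_mono)

lemma rel_length_attained:
  assumes "rel_length P Q = enat r" "submodule P R M" "P \<subseteq> Q"
  shows "has_chain P Q r"
proof -
  have bd: "l \<le> r" if "has_chain P Q l" for l using rel_length_ge[OF that] assms(1) by simp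
  then have fin: "finite {l. has_chain P Q l}"
    by (auto intro: finite_subset[of "{l. has_chain P Q l}" "{..r}"])
  have ne: "{l. has_chain P Q l} \<noteq> {}" using has_chain_zero[OF assms(2,3)] by blast
  define m where "m = Max {l. has_chain P Q l}"
  have m: "has_chain P Q m" using Max_in[OF fin ne] unfolding m_def by simp
  have "enat l \<le> enat m" if "has_chain P Q l" for l
    unfolding m_def using Max_ge[OF fin, of l] that by simp
  then have "rel_length P Q \<le> enat m" by (rule rel_length_le)
  then have "r \<le> m" using assms(1) by simp
  then have "m = r" using bd[OF m] by simp
  then show ?thesis using m by simp
qed

text \<open>A strictly monotone map between two intervals of submodules transports chains. The
  comparisons of lengths that stand for isomorphism theorems all come from such maps, used in one or
  both directions.\<close>

lemma rel_length_map:
  assumes fX: "\<And>X. submodule X R M \<Longrightarrow> P \<subseteq> X \<Longrightarrow> X \<subseteq> Q \<Longrightarrow> submodule (f X) R M \<and> P' \<subseteq> f X \<and> f X \<subseteq> Q'"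
    and mono: "\<And>X Y. submodule X R M \<Longrightarrow> submodule Y R M \<Longrightarrow> P \<subseteq> X \<Longrightarrow> X \<subset> Y \<Longrightarrow> Y \<subseteq> Q \<Longrightarrow> f X \<subset> f Y"
  shows "rel_length P Q \<le> rel_length P' Q'"
proof (rule rel_length_le)
  fix l assume "has_chain P Q l"
  then obtain C where C: "\<And>i. i \<le> l \<Longrightarrow> submodule (C i) R M \<and> P \<subseteq> C i \<and> C i \<subseteq> Q" "\<And>i. i < l \<Longrightarrow> C i \<subset> C (Suc i)"
    unfolding has_chain_def by blast
  have "has_chain P' Q' l"
    unfolding has_chain_def
  proof (intro exI[of _ "\<lambda>i. f (C i)"] conjI allI impI)
    show "submodule (f (C i)) R M" "P' \<subseteq> f (C i)" "f (C i) \<subseteq> Q'" if "i \<le> l" for i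
      using fX[of "C i"] C(1)[OF that] by blast+
    show "f (C i) \<subset> f (C (Suc i))" if "i < l" for i
      using mono[of "C i" "C (Suc i)"] C(1)[of i] C(1)[of "Suc i"] C(2)[OF that] that by auto
  qed
  then show "enat l \<le> rel_length P' Q'" by (rule rel_length_ge)
qed

lemma has_chain_snoc:
  assumes "has_chain P X s" "X \<subset> Y" "submodule Y R M"
  shows "has_chain P Y (Suc s)"
proof -
  obtain C where C: "\<And>i. i \<le> s \<Longrightarrow> submodule (C i) R M \<and> P \<subseteq> C i \<and> C i \<subseteq> X" "\<And>i. i < s \<Longrightarrow> C i \<subset> C (Suc i)"
    using assms(1) unfolding has_chain_def by blast
  show ?thesis
    unfolding has_chain_def
  proof (intro exI[of _ "\<lambda>i. if i \<le> s then C i else Y"] conjI allI impI)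
    fix i
    show "submodule (if i \<le> s then C i else Y) R M" "(if i \<le> s then C i else Y) \<subseteq> Y"
      using C(1)[of i] assms by auto
    show "P \<subseteq> (if i \<le> s then C i else Y)"
      using C(1)[of i] C(1)[of s] assms(2) by auto
    show "(if i \<le> s then C i else Y) \<subset> (if Suc i \<le> s then C (Suc i) else Y)" if "i < Suc s"
      using C(1)[of i] C(2)[of i] assms(2) that by auto
  qed
qed

lemma weak_chain_len:
  assumes D: "\<And>i. i \<le> l \<Longrightarrow> submodule (D i) R M" "\<And>i. i < l \<Longrightarrow> D i \<subseteq> D (Suc i)" and P: "P \<subseteq> D 0"
  shows "has_chain P (D l) (card {i. i < l \<and> D i \<noteq> D (Suc i)})"
  using D
proof (induction l)
  case 0
  then show ?case using P unfolding has_chain_def by (intro exI[of _ D]) simp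
next
  case (Suc l)
  have IH: "has_chain P (D l) (card {i. i < l \<and> D i \<noteq> D (Suc i)})" using Suc by simp
  show ?case
  proof (cases "D l = D (Suc l)")
    case True
    then have "{i. i < Suc l \<and> D i \<noteq> D (Suc i)} = {i. i < l \<and> D i \<noteq> D (Suc i)}"
      by (auto simp: less_Suc_eq)
    then show ?thesis using IH True by simp
  next
    case False
    then have "{i. i < Suc l \<and> D i \<noteq> D (Suc i)} = insert l {i. i < l \<and> D i \<noteq> D (Suc i)}"
      by (auto simp: less_Suc_eq)
    then have "card {i. i < Suc l \<and> D i \<noteq> D (Suc i)} = Suc (card {i. i < l \<and> D i \<noteq> D (Suc i)})" by simp
    moreover have "D l \<subset> D (Suc l)" using Suc.prems(2)[of l] False by blast
    ultimately show ?thesis using has_chain_snoc[OF IH] Suc.prems(1)[of "Suc l"] by simp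
  qed
qed

lemma has_chain_append:
  assumes a: "has_chain P Q a" and b: "has_chain Q K b"
  shows "has_chain P K (a + b)"
proof -
  obtain C where C: "\<And>i. i \<le> a \<Longrightarrow> submodule (C i) R M \<and> P \<subseteq> C i \<and> C i \<subseteq> Q" "\<And>i. i < a \<Longrightarrow> C i \<subset> C (Suc i)"
    using a unfolding has_chain_def by blast
  obtain D where D: "\<And>i. i \<le> b \<Longrightarrow> submodule (D i) R M \<and> Q \<subseteq> D i \<and> D i \<subseteq> K" "\<And>i. i < b \<Longrightarrow> D i \<subset> D (Suc i)"
    using b unfolding has_chain_def by blast
  have PQ: "P \<subseteq> Q" and QK: "Q \<subseteq> K" using C(1)[of 0] D(1)[of 0] by auto
  show ?thesis
    unfolding has_chain_def
  proof (intro exI[of _ "\<lambda>i. if i \<le> a then C i else D (i - a)"] conjI allI impI)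
    fix i assume "i \<le> a + b"
    then show "submodule (if i \<le> a then C i else D (i - a)) R M" "P \<subseteq> (if i \<le> a then C i else D (i - a))"
        "(if i \<le> a then C i else D (i - a)) \<subseteq> K"
      using C(1)[of i] D(1)[of "i - a"] PQ QK by (cases "i \<le> a"; force)+
  next
    fix i assume i: "i < a + b"
    consider "i < a" | "i = a" | "i > a" by linarith
    then show "(if i \<le> a then C i else D (i - a)) \<subset> (if Suc i \<le> a then C (Suc i) else D (Suc i - a))"
    proof cases
      case 2
      then have "C a \<subseteq> Q" "Q \<subseteq> D 0" "D 0 \<subset> D (Suc 0)" using C(1)[of a] D(1)[of 0] D(2)[of 0] i by auto
      then show ?thesis using 2 by auto
    next
      case 3
      then show ?thesis using D(2)[of "i - a"] i by (simp add: Suc_diff_le)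
    qed (use C(2)[of i] in auto)
  qed
qed

text \<open>A chain from \<open>P\<close> to \<open>K\<close> is replaced by its intersections with
  \<open>Q\<close> and its sums with \<open>Q\<close>. By the modular law every strict step stays
  strict in at least one of the two, so the strict steps of both together are enough.\<close>

lemma rel_length_add:
  assumes P: "submodule P R M" and Q: "submodule Q R M" and K: "submodule K R M" and le: "P \<subseteq> Q" "Q \<subseteq> K"
  shows "rel_length P K = rel_length P Q + rel_length Q K"
proof (rule antisym)
  show "rel_length P K \<le> rel_length P Q + rel_length Q K"
  proof (rule rel_length_le)
    fix l assume "has_chain P K l"
    then obtain C where C: "\<And>i. i \<le> l \<Longrightarrow> submodule (C i) R M \<and> P \<subseteq> C i \<and> C i \<subseteq> K" "\<And>i. i < l \<Longrightarrow> C i \<subset> C (Suc i)"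
      unfolding has_chain_def by blast
    define D E where "D = (\<lambda>i. C i \<inter> Q)" and "E = (\<lambda>i. C i <+>\<^bsub>M\<^esub> Q)"
    let ?A = "{i. i < l \<and> D i \<noteq> D (Suc i)}" and ?B = "{i. i < l \<and> E i \<noteq> E (Suc i)}"
    have "has_chain P (D l) (card ?A)"
    proof (rule weak_chain_len[of l D P])
      show "submodule (D i) R M" if "i \<le> l" for i unfolding D_def using C(1)[OF that] Q submod_Int by blast
      show "D i \<subseteq> D (Suc i)" if "i < l" for i unfolding D_def using C(2)[OF that] by blast
      show "P \<subseteq> D 0" unfolding D_def using C(1)[of 0] le by blast
    qed
    moreover have "D l \<subseteq> Q" unfolding D_def by blast
    ultimately have 1: "enat (card ?A) \<le> rel_length P Q"
      using has_chain_mono[of P "D l" _ Q] rel_length_ge by blast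
    have "has_chain Q (E l) (card ?B)"
    proof (rule weak_chain_len[of l E Q])
      show "submodule (E i) R M" if "i \<le> l" for i unfolding E_def using C(1)[OF that] Q submod_sum by blast
      show "E i \<subseteq> E (Suc i)" if "i < l" for i unfolding E_def using C(2)[OF that] by (intro sum_mono) auto
      show "Q \<subseteq> E 0" unfolding E_def using sum_upper2[of "C 0"] C(1)[of 0] Q by blast
    qed
    moreover have "E l \<subseteq> K" unfolding E_def using sum_least[OF K] C(1)[of l] le(2) by blast
    ultimately have 2: "enat (card ?B) \<le> rel_length Q K"
      using has_chain_mono[of Q "E l" _ K] rel_length_ge by blast
    have "{..<l} \<subseteq> ?A \<union> ?B"
    proof
      fix i assume "i \<in> {..<l}"
      then have i: "i < l" by simp
      have Ci: "submodule (C i) R M" "submodule (C (Suc i)) R M" "C i \<subset> C (Suc i)"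
        using C(1)[of i] C(1)[of "Suc i"] C(2)[OF i] i by auto
      show "i \<in> ?A \<union> ?B"
      proof (rule ccontr)
        assume "i \<notin> ?A \<union> ?B"
        then have eq: "D i = D (Suc i)" "E i = E (Suc i)" using i by auto
        have "C (Suc i) = C (Suc i) \<inter> E (Suc i)"
          using sum_upper1[OF Ci(2) Q] unfolding E_def by blast
        also have "\<dots> = C (Suc i) \<inter> (C i <+>\<^bsub>M\<^esub> Q)" using eq(2) unfolding E_def by simp
        also have "\<dots> = C i <+>\<^bsub>M\<^esub> D (Suc i)"
          unfolding D_def using submod_modular[OF Ci(1) Q Ci(2)] Ci(3) by blast
        also have "\<dots> = C i <+>\<^bsub>M\<^esub> D i" using eq(1) by simp
        also have "\<dots> \<subseteq> C i" unfolding D_def using sum_least[OF Ci(1)] by blast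
        finally show False using Ci(3) by blast
      qed
    qed
    then have "card {..<l} \<le> card (?A \<union> ?B)" by (intro card_mono) auto
    also have "\<dots> \<le> card ?A + card ?B" by (rule card_Un_le)
    finally have "enat l \<le> enat (card ?A) + enat (card ?B)" by simp
    also have "\<dots> \<le> rel_length P Q + rel_length Q K" using 1 2 by (rule add_mono)
    finally show "enat l \<le> rel_length P Q + rel_length Q K" .
  qed
  show "rel_length P Q + rel_length Q K \<le> rel_length P K"
  proof (cases "rel_length P K")
    case (enat r)
    have bd: "a + b \<le> r" if "has_chain P Q a" "has_chain Q K b" for a b
      using rel_length_ge[OF has_chain_append[OF that]] enat by simp
    have "rel_length P Q \<le> enat r"
      using bd has_chain_zero[OF Q le(2)] by (intro rel_length_le) force
    then obtain a where a: "rel_length P Q = enat a" by (cases "rel_length P Q") auto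
    have "rel_length Q K \<le> enat r"
      using bd has_chain_zero[OF P le(1)] by (intro rel_length_le) force
    then obtain b where b: "rel_length Q K = enat b" by (cases "rel_length Q K") auto
    show ?thesis
      using bd[OF rel_length_attained[OF a P le(1)] rel_length_attained[OF b Q le(2)]] a b enat by simp
  qed simp
qed

text \<open>By the modular law, adding \<open>Q\<close> and intersecting with \<open>P\<close> are
  strictly monotone maps between the two intervals.\<close>

lemma rel_length_diamond:
  assumes P: "submodule P R M" and Q: "submodule Q R M"
  shows "rel_length (P \<inter> Q) P = rel_length Q (P <+>\<^bsub>M\<^esub> Q)"
proof (rule antisym)
  show "rel_length (P \<inter> Q) P \<le> rel_length Q (P <+>\<^bsub>M\<^esub> Q)"
  proof (rule rel_length_map[where f = "\<lambda>X. X <+>\<^bsub>M\<^esub> Q"])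
    fix X assume X: "submodule X R M" "P \<inter> Q \<subseteq> X" "X \<subseteq> P"
    show "submodule (X <+>\<^bsub>M\<^esub> Q) R M \<and> Q \<subseteq> X <+>\<^bsub>M\<^esub> Q \<and> X <+>\<^bsub>M\<^esub> Q \<subseteq> P <+>\<^bsub>M\<^esub> Q"
      using X Q submod_sum sum_upper2 sum_mono[OF X(3) order_refl] by blast
  next
    fix X Y assume X: "submodule X R M" "submodule Y R M" "P \<inter> Q \<subseteq> X" "X \<subset> Y" "Y \<subseteq> P"
    have "Z = P \<inter> (Z <+>\<^bsub>M\<^esub> Q)" if "submodule Z R M" "P \<inter> Q \<subseteq> Z" "Z \<subseteq> P" for Z
      using submod_modular[OF that(1) Q P that(3)] sum_absorb(1)[OF that(1) submod_Int[OF P Q] that(2)] by simp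
    from this[of X] this[of Y] X have "X = P \<inter> (X <+>\<^bsub>M\<^esub> Q)" "Y = P \<inter> (Y <+>\<^bsub>M\<^esub> Q)" by blast+
    then have "X <+>\<^bsub>M\<^esub> Q \<noteq> Y <+>\<^bsub>M\<^esub> Q" using X(4) by (metis less_irrefl)
    then show "X <+>\<^bsub>M\<^esub> Q \<subset> Y <+>\<^bsub>M\<^esub> Q" using sum_mono[of X Y Q Q] X(4) by blast
  qed
  show "rel_length Q (P <+>\<^bsub>M\<^esub> Q) \<le> rel_length (P \<inter> Q) P"
  proof (rule rel_length_map[where f = "\<lambda>Y. P \<inter> Y"])
    fix X assume X: "submodule X R M" "Q \<subseteq> X" "X \<subseteq> P <+>\<^bsub>M\<^esub> Q"
    show "submodule (P \<inter> X) R M \<and> P \<inter> Q \<subseteq> P \<inter> X \<and> P \<inter> X \<subseteq> P"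
      using X P submod_Int by blast
  next
    fix X Y assume X: "submodule X R M" "submodule Y R M" "Q \<subseteq> X" "X \<subset> Y" "Y \<subseteq> P <+>\<^bsub>M\<^esub> Q"
    have "Z = Q <+>\<^bsub>M\<^esub> (P \<inter> Z)" if "submodule Z R M" "Q \<subseteq> Z" "Z \<subseteq> P <+>\<^bsub>M\<^esub> Q" for Z
    proof -
      have "Z = Z \<inter> (Q <+>\<^bsub>M\<^esub> P)" using that(3) sum_comm[OF P Q] by blast
      also have "\<dots> = Q <+>\<^bsub>M\<^esub> (Z \<inter> P)" by (rule submod_modular[OF Q P that(1,2)])
      finally show ?thesis by (simp add: Int_commute)
    qed
    from this[of X] this[of Y] X have "X = Q <+>\<^bsub>M\<^esub> (P \<inter> X)" "Y = Q <+>\<^bsub>M\<^esub> (P \<inter> Y)" by blast+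
    then have "P \<inter> X \<noteq> P \<inter> Y" using X(4) by (metis less_irrefl)
    then show "P \<inter> X \<subset> P \<inter> Y" using X(4) by blast
  qed
qed

text \<open>Multiplication by \<open>x\<close> induces an injective map from
  \<open>(A + N)/N\<close> to \<open>M/N\<close>; \<open>reg'\<close> extends the assumption from
  \<open>A\<close> to \<open>A + N\<close> for this. Images and preimages under \<open>x\<close>
  then give the two inequalities.\<close>

lemma rel_length_mult:
  assumes x: "x \<in> carrier R" and A: "submodule A R M" and B: "submodule B R M" and BA: "B \<subseteq> A"
    and N: "submodule N R M" and reg: "\<And>u. u \<in> A \<Longrightarrow> x \<odot>\<^bsub>M\<^esub> u \<in> N \<Longrightarrow> u \<in> N"
  shows "rel_length (B <+>\<^bsub>M\<^esub> N) (A <+>\<^bsub>M\<^esub> N) =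
    rel_length ((\<odot>\<^bsub>M\<^esub>) x ` B <+>\<^bsub>M\<^esub> N) ((\<odot>\<^bsub>M\<^esub>) x ` A <+>\<^bsub>M\<^esub> N)"
proof (rule antisym)
  note xA = submod_image[OF x A] and xB = submod_image[OF x B]
  note AN = submod_sum[OF A N] and BN = submod_sum[OF B N]
  have reg': "u \<in> N" if u: "u \<in> A <+>\<^bsub>M\<^esub> N" "x \<odot>\<^bsub>M\<^esub> u \<in> N" for u
  proof -
    obtain a v where av: "a \<in> A" "v \<in> N" "u = v \<oplus>\<^bsub>M\<^esub> a"
      using u(1) M.a_comm submod_carr[OF A] submod_carr[OF N] unfolding mem_sum by metis
    have c: "a \<in> carrier M" "v \<in> carrier M" using av submod_carr[OF A] submod_carr[OF N] by auto
    have "x \<odot>\<^bsub>M\<^esub> v \<oplus>\<^bsub>M\<^esub> x \<odot>\<^bsub>M\<^esub> a \<in> N" using u(2) av(3) c x by (simp add: smult_r_distr)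
    moreover have "x \<odot>\<^bsub>M\<^esub> a \<in> carrier M" using c x by simp
    ultimately have "x \<odot>\<^bsub>M\<^esub> a \<in> N"
      using submod_add_cancel[OF N submoduleE(4)[OF N x av(2)]] by blast
    then have "a \<in> N" using reg av(1) by blast
    then show ?thesis unfolding av(3) using av(2) submoduleE(5)[OF N] by blast
  qed
  show "rel_length (B <+>\<^bsub>M\<^esub> N) (A <+>\<^bsub>M\<^esub> N) \<le> rel_length ((\<odot>\<^bsub>M\<^esub>) x ` B <+>\<^bsub>M\<^esub> N) ((\<odot>\<^bsub>M\<^esub>) x ` A <+>\<^bsub>M\<^esub> N)"
  proof (rule rel_length_map[where f = "\<lambda>X. (\<odot>\<^bsub>M\<^esub>) x ` X <+>\<^bsub>M\<^esub> N"])
    fix X assume X: "submodule X R M" "B <+>\<^bsub>M\<^esub> N \<subseteq> X" "X \<subseteq> A <+>\<^bsub>M\<^esub> N"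
    have "B \<subseteq> X" using X(2) sum_upper1[OF B N] by blast
    then have 1: "(\<odot>\<^bsub>M\<^esub>) x ` B <+>\<^bsub>M\<^esub> N \<subseteq> (\<odot>\<^bsub>M\<^esub>) x ` X <+>\<^bsub>M\<^esub> N" by (intro sum_mono) auto
    have "x \<odot>\<^bsub>M\<^esub> u \<in> (\<odot>\<^bsub>M\<^esub>) x ` A <+>\<^bsub>M\<^esub> N" if u: "u \<in> X" for u
    proof -
      obtain a v where av: "a \<in> A" "v \<in> N" "u = a \<oplus>\<^bsub>M\<^esub> v" using subsetD[OF X(3) u] by (auto simp: mem_sum)
      then have "x \<odot>\<^bsub>M\<^esub> u = x \<odot>\<^bsub>M\<^esub> a \<oplus>\<^bsub>M\<^esub> x \<odot>\<^bsub>M\<^esub> v"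
        using x submod_carr[OF A] submod_carr[OF N] by (simp add: smult_r_distr)
      then show ?thesis using av submoduleE(4)[OF N x av(2)] by (auto intro!: sumI)
    qed
    then have "(\<odot>\<^bsub>M\<^esub>) x ` X \<subseteq> (\<odot>\<^bsub>M\<^esub>) x ` A <+>\<^bsub>M\<^esub> N" by blast
    then have 2: "(\<odot>\<^bsub>M\<^esub>) x ` X <+>\<^bsub>M\<^esub> N \<subseteq> (\<odot>\<^bsub>M\<^esub>) x ` A <+>\<^bsub>M\<^esub> N"
      using sum_least[OF submod_sum[OF xA N]] sum_upper2[OF xA N] by blast
    show "submodule ((\<odot>\<^bsub>M\<^esub>) x ` X <+>\<^bsub>M\<^esub> N) R M \<and> (\<odot>\<^bsub>M\<^esub>) x ` B <+>\<^bsub>M\<^esub> N \<subseteq> (\<odot>\<^bsub>M\<^esub>) x ` X <+>\<^bsub>M\<^esub> N \<and>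
        (\<odot>\<^bsub>M\<^esub>) x ` X <+>\<^bsub>M\<^esub> N \<subseteq> (\<odot>\<^bsub>M\<^esub>) x ` A <+>\<^bsub>M\<^esub> N"
      using submod_sum[OF submod_image[OF x X(1)] N] 1 2 by blast
  next
    fix X Y assume X: "submodule X R M" "submodule Y R M" "B <+>\<^bsub>M\<^esub> N \<subseteq> X" "X \<subset> Y" "Y \<subseteq> A <+>\<^bsub>M\<^esub> N"
    obtain y where y: "y \<in> Y" "y \<notin> X" using X(4) by blast
    have yc: "y \<in> carrier M" by (rule submod_carr[OF X(2) y(1)])
    have "x \<odot>\<^bsub>M\<^esub> y \<notin> (\<odot>\<^bsub>M\<^esub>) x ` X <+>\<^bsub>M\<^esub> N"
    proof
      assume "x \<odot>\<^bsub>M\<^esub> y \<in> (\<odot>\<^bsub>M\<^esub>) x ` X <+>\<^bsub>M\<^esub> N"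
      then obtain z v where zv: "z \<in> X" "v \<in> N" "x \<odot>\<^bsub>M\<^esub> y = x \<odot>\<^bsub>M\<^esub> z \<oplus>\<^bsub>M\<^esub> v" by (auto simp: mem_sum)
      have c: "z \<in> carrier M" "v \<in> carrier M" using zv submod_carr[OF X(1)] submod_carr[OF N] by auto
      have "x \<odot>\<^bsub>M\<^esub> (y \<ominus>\<^bsub>M\<^esub> z) = x \<odot>\<^bsub>M\<^esub> y \<ominus>\<^bsub>M\<^esub> x \<odot>\<^bsub>M\<^esub> z" by (rule smult_diff[OF x yc c(1)])
      also have "\<dots> = v"
        unfolding zv(3) M.a_comm[OF smult_closed[OF x c(1)] c(2)] using c x by (simp add: M.minus_eq M.a_assoc M.r_neg)
      finally have "x \<odot>\<^bsub>M\<^esub> (y \<ominus>\<^bsub>M\<^esub> z) \<in> N" using zv(2) by simp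
      moreover have "y \<ominus>\<^bsub>M\<^esub> z \<in> A <+>\<^bsub>M\<^esub> N" using submod_diff[OF X(2)] y(1) zv(1) X(4,5) by blast
      ultimately have "y \<ominus>\<^bsub>M\<^esub> z \<in> N" using reg' by blast
      then have "y \<ominus>\<^bsub>M\<^esub> z \<in> X" using X(3) sum_upper2[OF B N] by blast
      then have "z \<oplus>\<^bsub>M\<^esub> (y \<ominus>\<^bsub>M\<^esub> z) \<in> X" using zv(1) submoduleE(5)[OF X(1)] by blast
      moreover have "z \<oplus>\<^bsub>M\<^esub> (y \<ominus>\<^bsub>M\<^esub> z) = y"         using c yc by (simp add: M.minus_eq M.a_comm[of y] M.r_neg2)
      ultimately show False using y(2) by simp
    qed
    moreover have "x \<odot>\<^bsub>M\<^esub> y \<in> (\<odot>\<^bsub>M\<^esub>) x ` Y <+>\<^bsub>M\<^esub> N"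
      using sum_upper1[OF submod_image[OF x X(2)] N] y(1) by blast
    moreover have "(\<odot>\<^bsub>M\<^esub>) x ` X <+>\<^bsub>M\<^esub> N \<subseteq> (\<odot>\<^bsub>M\<^esub>) x ` Y <+>\<^bsub>M\<^esub> N" using X(4) by (intro sum_mono) auto
    ultimately show "(\<odot>\<^bsub>M\<^esub>) x ` X <+>\<^bsub>M\<^esub> N \<subset> (\<odot>\<^bsub>M\<^esub>) x ` Y <+>\<^bsub>M\<^esub> N" by blast
  qed
  show "rel_length ((\<odot>\<^bsub>M\<^esub>) x ` B <+>\<^bsub>M\<^esub> N) ((\<odot>\<^bsub>M\<^esub>) x ` A <+>\<^bsub>M\<^esub> N) \<le> rel_length (B <+>\<^bsub>M\<^esub> N) (A <+>\<^bsub>M\<^esub> N)"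
  proof (rule rel_length_map[where f = "\<lambda>Y. (A <+>\<^bsub>M\<^esub> N) \<inter> {u \<in> carrier M. x \<odot>\<^bsub>M\<^esub> u \<in> Y}"])
    fix Y assume Y: "submodule Y R M" "(\<odot>\<^bsub>M\<^esub>) x ` B <+>\<^bsub>M\<^esub> N \<subseteq> Y" "Y \<subseteq> (\<odot>\<^bsub>M\<^esub>) x ` A <+>\<^bsub>M\<^esub> N"
    have BY: "(\<odot>\<^bsub>M\<^esub>) x ` B \<subseteq> Y" and NY: "N \<subseteq> Y" using Y(2) sum_upper1[OF xB N] sum_upper2[OF xB N] by blast+
    have s: "submodule ((A <+>\<^bsub>M\<^esub> N) \<inter> {u \<in> carrier M. x \<odot>\<^bsub>M\<^esub> u \<in> Y}) R M"
      by (intro submod_Int AN submod_colon x Y(1))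
    have "B \<subseteq> (A <+>\<^bsub>M\<^esub> N) \<inter> {u \<in> carrier M. x \<odot>\<^bsub>M\<^esub> u \<in> Y}"
      using BA sum_upper1[OF A N] BY submod_carr[OF B] by blast
    moreover have "N \<subseteq> (A <+>\<^bsub>M\<^esub> N) \<inter> {u \<in> carrier M. x \<odot>\<^bsub>M\<^esub> u \<in> Y}"
      using sum_upper2[OF A N] NY submod_carr[OF N] submoduleE(4)[OF N x] by blast
    ultimately show "submodule ((A <+>\<^bsub>M\<^esub> N) \<inter> {u \<in> carrier M. x \<odot>\<^bsub>M\<^esub> u \<in> Y}) R M \<and>
        B <+>\<^bsub>M\<^esub> N \<subseteq> (A <+>\<^bsub>M\<^esub> N) \<inter> {u \<in> carrier M. x \<odot>\<^bsub>M\<^esub> u \<in> Y} \<and>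
        (A <+>\<^bsub>M\<^esub> N) \<inter> {u \<in> carrier M. x \<odot>\<^bsub>M\<^esub> u \<in> Y} \<subseteq> A <+>\<^bsub>M\<^esub> N"
      using s sum_least[OF s] by blast
  next
    fix X Y assume X: "submodule X R M" "submodule Y R M" "(\<odot>\<^bsub>M\<^esub>) x ` B <+>\<^bsub>M\<^esub> N \<subseteq> X" "X \<subset> Y"
      "Y \<subseteq> (\<odot>\<^bsub>M\<^esub>) x ` A <+>\<^bsub>M\<^esub> N"
    have NX: "N \<subseteq> X" using X(3) sum_upper2[OF xB N] by blast
    obtain y where y: "y \<in> Y" "y \<notin> X" using X(4) by blast
    then have "y \<in> (\<odot>\<^bsub>M\<^esub>) x ` A <+>\<^bsub>M\<^esub> N" using X(5) by blast
    then obtain a v where av: "a \<in> A" "v \<in> N" "y = x \<odot>\<^bsub>M\<^esub> a \<oplus>\<^bsub>M\<^esub> v" by (auto simp: mem_sum)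
    have ac: "a \<in> carrier M" "x \<odot>\<^bsub>M\<^esub> a \<in> carrier M" using av(1) submod_carr[OF A] x by auto
    have "x \<odot>\<^bsub>M\<^esub> a \<in> Y"
      using submod_add_cancel_iff(2)[OF X(2) _ ac(2), of v] av y(1) NX X(4) by blast
    moreover have "x \<odot>\<^bsub>M\<^esub> a \<notin> X" using y(2) av submoduleE(5)[OF X(1)] NX by blast
    moreover have "a \<in> A <+>\<^bsub>M\<^esub> N" using sum_upper1[OF A N] av(1) by blast
    ultimately show "(A <+>\<^bsub>M\<^esub> N) \<inter> {u \<in> carrier M. x \<odot>\<^bsub>M\<^esub> u \<in> X} \<subset> (A <+>\<^bsub>M\<^esub> N) \<inter> {u \<in> carrier M. x \<odot>\<^bsub>M\<^esub> u \<in> Y}"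
      using X(4) ac by blast
  qed
qed

lemma rel_length_self: "submodule P R M \<Longrightarrow> rel_length P P = 0"
proof (rule antisym)
  assume "submodule P R M"
  show "rel_length P P \<le> 0"
  proof (rule rel_length_le)
    fix l assume "has_chain P P l"
    then obtain C where C: "\<And>i. i \<le> l \<Longrightarrow> P \<subseteq> C i \<and> C i \<subseteq> P" "\<And>i. i < l \<Longrightarrow> C i \<subset> C (Suc i)"
      unfolding has_chain_def by blast
    have "l = 0"
    proof (rule ccontr)
      assume "l \<noteq> 0"
      then show False using C(1)[of 0] C(1)[of 1] C(2)[of 0] by auto
    qed
    then show "enat l \<le> 0" by (simp add: zero_enat_def)
  qed
qed simp

lemma rel_length_eq_0:
  assumes "submodule P R M" "submodule Q R M" "P \<subseteq> Q" "rel_length P Q = 0"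
  shows "P = Q"
proof (rule ccontr)
  assume "P \<noteq> Q"
  then have "P \<subset> Q" using assms(3) by blast
  then have "has_chain P Q (Suc 0)"
    using has_chain_snoc[OF has_chain_zero[OF assms(1) order_refl]] assms(2) by blast
  then have "enat (Suc 0) \<le> rel_length P Q" by (rule rel_length_ge)
  then show False using assms(4) by (simp add: zero_enat_def)
qed

end

lemma (in module) sumE_swapped:
  assumes "v \<in> N <+>\<^bsub>M\<^esub> P" "submodule N R M" "submodule P R M"
  obtains a b where "a \<in> N" "b \<in> P" "v = b \<oplus>\<^bsub>M\<^esub> a"
proof -
  obtain a b where "a \<in> N" "b \<in> P" "v = a \<oplus>\<^bsub>M\<^esub> b" using assms(1) by (auto simp: mem_sum)
  then show thesis using that M.a_comm submod_carr[OF assms(2)] submod_carr[OF assms(3)] by metis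
qed

context local_multi_ideals
begin

lemma \<mm>_pow_F0: "a \<in> \<mm> \<Longrightarrow> \<exists>n::nat. a [^] n \<in> F 0"
  using F0_primary unfolding primary_to_def ideal_radical_def by blast

lemma F0_subset_\<mm>: "F 0 \<subseteq> \<mm>"
proof
  fix a assume a: "a \<in> F 0"
  then have "a \<in> carrier R" using F_carr[of 0 a] by simp
  moreover from this have "a [^] (1::nat) \<in> F 0" using a by simp
  ultimately show "a \<in> \<mm>" using F0_primary unfolding primary_to_def ideal_radical_def by blast
qed

section \<open>Finiteness of length\<close>

text \<open>Take \<open>u\<close> in \<open>Q\<close> outside \<open>P\<close> with maximal
  annihilator modulo \<open>P\<close>. If some \<open>a\<close> in \<open>\<mm>\<close> did not
  carry it into \<open>P\<close>, then \<open>a u\<close> would have the same annihilator, and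
  inductively no power of \<open>a\<close> would carry \<open>u\<close> into \<open>P\<close>; but
  some power of \<open>a\<close> lies in \<open>F 0\<close>.\<close>

lemma socle_element:
  assumes P: "submodule P R M" and Q: "submodule Q R M" and "\<not> Q \<subseteq> P"
    and J: "\<And>a v. a \<in> F 0 \<Longrightarrow> v \<in> Q \<Longrightarrow> a \<odot>\<^bsub>M\<^esub> v \<in> P"
  obtains u where "u \<in> Q" "u \<notin> P" "\<And>a. a \<in> \<mm> \<Longrightarrow> a \<odot>\<^bsub>M\<^esub> u \<in> P"
proof -
  define ann where "ann u = {a \<in> carrier R. a \<odot>\<^bsub>M\<^esub> u \<in> P}" for u
  define X where "X = ann ` (Q - P)"
  have "ideal (ann u) R" if "u \<in> Q" for u
    unfolding ann_def by (rule ideal_ann[OF submod_carr[OF Q that] P oneideal])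
  then have sub: "X \<subseteq> {I. ideal I R}" and ne: "X \<noteq> {}" using assms(3) unfolding X_def by auto
  obtain I where I: "I \<in> X" "\<And>L. L \<in> X \<Longrightarrow> I \<subseteq> L \<Longrightarrow> L = I"
    using acc_on_max[OF acc_ideals sub ne] by metis
  obtain u where u: "u \<in> Q" "u \<notin> P" "I = ann u" using I(1) unfolding X_def by blast
  have uc: "u \<in> carrier M" by (rule submod_carr[OF Q u(1)])
  have "a \<odot>\<^bsub>M\<^esub> u \<in> P" if a: "a \<in> \<mm>" for a
  proof (rule ccontr)
    assume n: "a \<odot>\<^bsub>M\<^esub> u \<notin> P"
    have ac: "a \<in> carrier R" using a ideal_carr[OF \<mm>_ideal] by blast
    have auQ: "a \<odot>\<^bsub>M\<^esub> u \<in> Q" using submoduleE(4)[OF Q ac u(1)] .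
    then have "ann (a \<odot>\<^bsub>M\<^esub> u) \<in> X" unfolding X_def using n by blast
    moreover have "I \<subseteq> ann (a \<odot>\<^bsub>M\<^esub> u)"
    proof
      fix b assume "b \<in> I"
      then have b: "b \<in> carrier R" "b \<odot>\<^bsub>M\<^esub> u \<in> P" unfolding u(3) ann_def by auto
      then have "b \<odot>\<^bsub>M\<^esub> (a \<odot>\<^bsub>M\<^esub> u) \<in> P"
        using submoduleE(4)[OF P ac b(2)] by (simp add: smult_comm[OF b(1) ac uc])
      then show "b \<in> ann (a \<odot>\<^bsub>M\<^esub> u)" unfolding ann_def using b by simp
    qed
    ultimately have eq: "ann (a \<odot>\<^bsub>M\<^esub> u) = ann u" using I(2) u(3) by blast
    have "\<not> a [^] k \<odot>\<^bsub>M\<^esub> u \<in> P" for k :: nat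
    proof (induction k)
      case (Suc k)
      show ?case
      proof
        assume "a [^] Suc k \<odot>\<^bsub>M\<^esub> u \<in> P"
        then have "a [^] k \<odot>\<^bsub>M\<^esub> (a \<odot>\<^bsub>M\<^esub> u) \<in> P" using ac uc by (simp add: smult_assoc1)
        then have "a [^] k \<in> ann (a \<odot>\<^bsub>M\<^esub> u)" unfolding ann_def using ac by simp
        then show False using Suc eq unfolding ann_def by blast
      qed
    qed (use u uc in simp)
    moreover obtain k :: nat where "a [^] k \<in> F 0" using \<mm>_pow_F0[OF a] by blast
    ultimately show False using J u(1) by blast
  qed
  then show thesis using that u by blast
qed

text \<open>Noetherian induction on \<open>P\<close>: a socle element \<open>u\<close> gives
  \<open>K = P + R u\<close> with \<open>K/P\<close> simple, and additivity of length leaves the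
  interval from \<open>K\<close> to \<open>Q\<close>.\<close>

lemma rel_length_finite:
  assumes Q: "submodule Q R M" and P: "submodule P R M" "P \<subseteq> Q"
    and J: "\<And>a v. a \<in> F 0 \<Longrightarrow> v \<in> Q \<Longrightarrow> a \<odot>\<^bsub>M\<^esub> v \<in> P"
  shows "rel_length P Q \<noteq> \<infinity>"
proof -
  have "P \<in> submods" using P unfolding submods_def by blast
  with acc_submods have "P \<subseteq> Q \<longrightarrow> (\<forall>a\<in>F 0. \<forall>v\<in>Q. a \<odot>\<^bsub>M\<^esub> v \<in> P) \<longrightarrow> rel_length P Q \<noteq> \<infinity>"
  proof (induction P rule: acc_on_induct)
    case (step P)
    show ?case
    proof (intro impI)
      assume PQ: "P \<subseteq> Q" and J: "\<forall>a\<in>F 0. \<forall>v\<in>Q. a \<odot>\<^bsub>M\<^esub> v \<in> P"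
      have P: "submodule P R M" using step(1) unfolding submods_def by blast
      show "rel_length P Q \<noteq> \<infinity>"
      proof (cases "Q \<subseteq> P")
        case True
        then show ?thesis using PQ rel_length_self[OF P] by (simp add: subset_antisym)
      next
        case False
        then obtain u where u: "u \<in> Q" "u \<notin> P" "\<And>a. a \<in> \<mm> \<Longrightarrow> a \<odot>\<^bsub>M\<^esub> u \<in> P"
          using socle_element[OF P Q False] J by metis
        have uc: "u \<in> carrier M" by (rule submod_carr[OF Q u(1)])
        let ?C = "(\<lambda>g. g \<odot>\<^bsub>M\<^esub> u) ` carrier R"
        have C: "submodule ?C R M" by (rule ideal_image_submod[OF oneideal uc])
        define K where "K = P <+>\<^bsub>M\<^esub> ?C"
        have K: "submodule K R M" unfolding K_def by (rule submod_sum[OF P C])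
        have PK: "P \<subseteq> K" unfolding K_def by (rule sum_upper1[OF P C])
        have "u \<in> ?C" using uc by (intro image_eqI[of _ _ \<one>]) auto
        then have uK: "u \<in> K" unfolding K_def using sum_upper2[OF P C] by blast
        have "?C \<subseteq> Q" using submoduleE(4)[OF Q] u(1) by auto
        then have KQ: "K \<subseteq> Q" unfolding K_def using sum_least[OF Q PQ] by blast
        have simple: "X = K" if X: "submodule X R M" "P \<subset> X" "X \<subseteq> K" for X
        proof -
          obtain y where y: "y \<in> X" "y \<notin> P" using X(2) by blast
          then have "y \<in> P <+>\<^bsub>M\<^esub> ?C" using X(3) unfolding K_def by blast
          then obtain p g where pg: "p \<in> P" "g \<in> carrier R" "y = p \<oplus>\<^bsub>M\<^esub> g \<odot>\<^bsub>M\<^esub> u" by (auto simp: mem_sum)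
          have "g \<odot>\<^bsub>M\<^esub> u \<notin> P" using y(2) pg submoduleE(5)[OF P] by blast
          then have "g \<notin> \<mm>" using u(3) by blast
          then obtain s where s: "s \<in> carrier R" "s \<otimes> g = \<one>" using unit_outside_\<mm>[OF pg(2)] by blast
          have guc: "g \<odot>\<^bsub>M\<^esub> u \<in> carrier M" using pg uc by simp
          have "p \<in> X" using pg(1) X(2) by blast
          then have "g \<odot>\<^bsub>M\<^esub> u \<in> X" using submod_add_cancel[OF X(1) _ guc] y(1) pg(3) by blast
          then have "s \<odot>\<^bsub>M\<^esub> (g \<odot>\<^bsub>M\<^esub> u) \<in> X" using submoduleE(4)[OF X(1) s(1)] by blast
          then have "u \<in> X" using s pg(2) uc by (simp flip: smult_assoc1)
          then have "?C \<subseteq> X" using submoduleE(4)[OF X(1)] by blast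
          then have "K \<subseteq> X" unfolding K_def using sum_least[OF X(1)] X(2) by blast
          then show ?thesis using X(3) by blast
        qed
        have "rel_length P K \<le> enat 1"
        proof (rule rel_length_le)
          fix l assume "has_chain P K l"
          then obtain D where D: "\<And>i. i \<le> l \<Longrightarrow> submodule (D i) R M \<and> P \<subseteq> D i \<and> D i \<subseteq> K" "\<And>i. i < l \<Longrightarrow> D i \<subset> D (Suc i)"
            unfolding has_chain_def by blast
          have "l \<le> 1"
          proof (rule ccontr)
            assume "\<not> l \<le> 1"
            then have "D 0 \<subset> D 1" "D 1 \<subset> D 2" "P \<subseteq> D 0" "submodule (D 1) R M" "D 1 \<subseteq> K" "D 2 \<subseteq> K"
              using D(2)[of 0] D(2)[of 1] D(1)[of 0] D(1)[of 1] D(1)[of 2] by (auto simp: numeral_2_eq_2)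
            then show False using simple[of "D 1"] by blast
          qed
          then show "enat l \<le> enat 1" by simp
        qed
        then have fin1: "rel_length P K \<noteq> \<infinity>" by (cases "rel_length P K") auto
        have "P < K" using PK uK u(2) by blast
        moreover have "K \<in> submods" using K unfolding submods_def by blast
        moreover have "\<forall>a\<in>F 0. \<forall>v\<in>Q. a \<odot>\<^bsub>M\<^esub> v \<in> K" using J PK by blast
        ultimately have "rel_length K Q \<noteq> \<infinity>" using step(2) KQ by blast
        then show ?thesis using fin1 rel_length_add[OF P K Q PK KQ] by (simp add: plus_eq_infty_iff_enat)
      qed
    qed
  qed
  then show ?thesis using P J by blast
qed

section \<open>The Hilbert function\<close>

text \<open>The Hilbert function of \<open>M/N\<close>: the image of \<open>W n\<close> in
  \<open>M/N\<close> is the same product of ideals applied to \<open>M/N\<close>, and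
  \<open>inc 0\<close> is the extra factor \<open>J\<close>.\<close>

definition hilbert_fun :: "'c set \<Rightarrow> (nat \<Rightarrow> nat) \<Rightarrow> enat" where
  "hilbert_fun N n = rel_length (W (inc 0 n) <+>\<^bsub>M\<^esub> N) (W n <+>\<^bsub>M\<^esub> N)"

lemma WN_submod: "submodule N R M \<Longrightarrow> submodule (W n <+>\<^bsub>M\<^esub> N) R M"
  by (rule submod_sum[OF W_submod])

lemma W_inc_subset: "W (inc i n) \<subseteq> W n"
  by (rule W_antimono) simp

lemma WN_inc: "W (inc i n) <+>\<^bsub>M\<^esub> N \<subseteq> W n <+>\<^bsub>M\<^esub> N"
  by (rule sum_mono[OF W_inc_subset order_refl])

lemma smult_sum_mem:
  assumes a: "a \<in> carrier R" and N: "submodule N R M" and K: "submodule K R M" and v: "v \<in> K <+>\<^bsub>M\<^esub> N"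
    and st: "\<And>w. w \<in> K \<Longrightarrow> a \<odot>\<^bsub>M\<^esub> w \<in> L"
  shows "a \<odot>\<^bsub>M\<^esub> v \<in> L <+>\<^bsub>M\<^esub> N"
proof -
  obtain w z where wz: "w \<in> K" "z \<in> N" "v = w \<oplus>\<^bsub>M\<^esub> z" using v by (auto simp: mem_sum)
  then have "a \<odot>\<^bsub>M\<^esub> v = a \<odot>\<^bsub>M\<^esub> w \<oplus>\<^bsub>M\<^esub> a \<odot>\<^bsub>M\<^esub> z"
    using a submod_carr[OF K] submod_carr[OF N] by (simp add: smult_r_distr)
  then show ?thesis using sumI[OF st[OF wz(1)] submoduleE(4)[OF N a wz(2)]] by simp
qed

lemma F_WN:
  assumes "i \<le> d" "a \<in> F i" "submodule N R M" "v \<in> W n <+>\<^bsub>M\<^esub> N"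
  shows "a \<odot>\<^bsub>M\<^esub> v \<in> W (inc i n) <+>\<^bsub>M\<^esub> N"
  by (rule smult_sum_mem[OF F_carr[OF assms(1,2)] assms(3) W_submod assms(4) F_W[OF assms(1,2)]])

lemma hilbert_fun_finite: "submodule N R M \<Longrightarrow> hilbert_fun N n \<noteq> \<infinity>"
  unfolding hilbert_fun_def using F_WN[of 0] by (intro rel_length_finite WN_submod WN_inc) auto

text \<open>If the length vanishes, \<open>W n + N\<close> equals \<open>J W n + N\<close>. As
  \<open>J\<close> lies in \<open>\<mm>\<close>, Nakayama's lemma gives
  \<open>W n + N = N\<close>.\<close>

lemma hilbert_fun_zero_iff:
  assumes N: "submodule N R M"
  shows "hilbert_fun N n = 0 \<longleftrightarrow> W n \<subseteq> N"
proof
  assume "hilbert_fun N n = 0"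
  then have eq: "W (inc 0 n) <+>\<^bsub>M\<^esub> N = W n <+>\<^bsub>M\<^esub> N"
    unfolding hilbert_fun_def using rel_length_eq_0[OF WN_submod[OF N] WN_submod[OF N] WN_inc] by blast
  have mc: "\<mm> \<subseteq> carrier R" using ideal_carr[OF \<mm>_ideal] by blast
  have WNc: "W n <+>\<^bsub>M\<^esub> N \<subseteq> carrier M" using submod_carr[OF WN_submod[OF N]] by blast
  have "W (inc 0 n) \<subseteq> ideal_smult R M \<mm> (W n <+>\<^bsub>M\<^esub> N)"
    unfolding W_inc[OF le0]
    by (rule ideal_smult_mono[OF mc WNc F0_subset_\<mm> sum_upper1[OF W_submod N]])
  then have "W n <+>\<^bsub>M\<^esub> N \<subseteq> N <+>\<^bsub>M\<^esub> ideal_smult R M \<mm> (W n <+>\<^bsub>M\<^esub> N)"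
    using eq sum_mono[of "W (inc 0 n)" "ideal_smult R M \<mm> (W n <+>\<^bsub>M\<^esub> N)" N N]
      sum_comm[OF N ideal_smult_submod[OF mc WNc]] by blast
  then have "W n <+>\<^bsub>M\<^esub> N = N"
    by (rule nakayama[OF N WN_submod[OF N] sum_upper2[OF W_submod N]])
  then show "W n \<subseteq> N" using sum_upper1[OF W_submod N] by blast
next
  assume "W n \<subseteq> N"
  moreover from this have "W (inc 0 n) \<subseteq> N" using W_inc_subset by (rule order_trans[rotated])
  ultimately have "W n <+>\<^bsub>M\<^esub> N = N" "W (inc 0 n) <+>\<^bsub>M\<^esub> N = N"
    by (simp_all only: sum_absorb(2)[OF N W_submod])
  then show "hilbert_fun N n = 0" unfolding hilbert_fun_def using rel_length_self[OF N] by simp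
qed

section \<open>Passing to the quotient by a good element\<close>

lemma goodD:
  assumes "good N i x"
  shows "i \<le> d" "x \<in> F i" "x \<in> carrier R"
    and "eventually (\<lambda>n. \<forall>u\<in>W n. x \<odot>\<^bsub>M\<^esub> u \<in> N \<longrightarrow> u \<in> N) (large d)"
    and "eventually (\<lambda>n. \<forall>j\<le>d. \<forall>u\<in>W n. x \<odot>\<^bsub>M\<^esub> u \<in> W (inc j (inc i n)) <+>\<^bsub>M\<^esub> N \<longrightarrow> u \<in> W (inc j n) <+>\<^bsub>M\<^esub> N) (large d)"
proof -
  show 1: "i \<le> d" "x \<in> F i" using assms unfolding good_def by blast+
  show "x \<in> carrier R" by (rule F_carr[OF 1])
  show "eventually (\<lambda>n. \<forall>u\<in>W n. x \<odot>\<^bsub>M\<^esub> u \<in> N \<longrightarrow> u \<in> N) (large d)" using assms unfolding good_def by blast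
  have "eventually (\<lambda>n. \<forall>j\<in>{..d}. \<forall>u\<in>W n. x \<odot>\<^bsub>M\<^esub> u \<in> W (inc j (inc i n)) <+>\<^bsub>M\<^esub> N \<longrightarrow> u \<in> W (inc j n) <+>\<^bsub>M\<^esub> N) (large d)"
    using assms unfolding good_def by (intro eventually_ball_finite) auto
  then show "eventually (\<lambda>n. \<forall>j\<le>d. \<forall>u\<in>W n. x \<odot>\<^bsub>M\<^esub> u \<in> W (inc j (inc i n)) <+>\<^bsub>M\<^esub> N \<longrightarrow> u \<in> W (inc j n) <+>\<^bsub>M\<^esub> N) (large d)"
    by (rule eventually_mono) auto
qed

abbreviation addx :: "'a \<Rightarrow> 'c set \<Rightarrow> 'c set" where
  "addx x N \<equiv> (\<odot>\<^bsub>M\<^esub>) x ` carrier M <+>\<^bsub>M\<^esub> N"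

lemma addx_submod: "x \<in> carrier R \<Longrightarrow> submodule N R M \<Longrightarrow> submodule (addx x N) R M"
  by (intro submod_sum submod_image carrier_is_submodule)

text \<open>Write \<open>u\<close> as an element of \<open>N\<close> plus some \<open>w\<close> in
  \<open>W (m + p)\<close>. Then \<open>x w\<close> is still in \<open>W n + N\<close>, and
  regularity on the piece in direction \<open>j\<close> raises \<open>w\<close> by one step. The
  bound by \<open>dec i n\<close> ensures that \<open>n\<close> dominates the degree
  \<open>m + p + e_i + e_j\<close> used there.\<close>

lemma good_climb:
  assumes N: "submodule N R M" and good: "good N i x"
    and c: "\<And>n j u. \<forall>i\<le>d. c \<le> n i \<Longrightarrow> j \<le> d \<Longrightarrow> u \<in> W n \<Longrightarrow> x \<odot>\<^bsub>M\<^esub> u \<in> W (inc j (inc i n)) <+>\<^bsub>M\<^esub> N \<Longrightarrow> u \<in> W (inc j n) <+>\<^bsub>M\<^esub> N"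
    and m: "\<forall>i\<le>d. c \<le> m i" and u: "u \<in> W m" and xu: "x \<odot>\<^bsub>M\<^esub> u \<in> W n <+>\<^bsub>M\<^esub> N"
  shows "(\<And>j. j \<le> d \<Longrightarrow> m j + p j \<le> dec i n j) \<Longrightarrow> 1 \<le> n i \<Longrightarrow> u \<in> W (m [+] p) <+>\<^bsub>M\<^esub> N"
proof (induction p rule: multi_index_induct[of d])
  case (zero p)
  have "W (m [+] p) = W m" using zero by (intro W_cong) simp
  then show ?case using u sum_upper1[OF W_submod N] by blast
next
  case (inc p j)
  note x = goodD(3)[OF good]
  have le: "m l + p l \<le> dec i n l" if "l \<le> d" for l
    using inc.prems(1)[OF that] by (cases "l = j") auto
  then have "u \<in> W (m [+] p) <+>\<^bsub>M\<^esub> N" using inc.IH inc.prems(2) by blast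
  then obtain w v where wv: "w \<in> W (m [+] p)" "v \<in> N" "u = v \<oplus>\<^bsub>M\<^esub> w"
    using M.a_comm W_carr submod_carr[OF N] unfolding mem_sum by metis
  have wvc: "w \<in> carrier M" "v \<in> carrier M" using wv W_carr submod_carr[OF N] by auto
  have le': "inc j (inc i (m [+] p)) l \<le> n l" if "l \<le> d" for l
    using inc.prems(1)[OF that] inc.prems(2) by (auto simp: dec_def split: if_splits)
  have "W n \<subseteq> W (inc j (inc i (m [+] p)))" by (rule W_antimono[OF le'])
  then have sub: "W n <+>\<^bsub>M\<^esub> N \<subseteq> W (inc j (inc i (m [+] p))) <+>\<^bsub>M\<^esub> N" by (rule sum_mono[OF _ order_refl])
  have xv: "x \<odot>\<^bsub>M\<^esub> v \<in> W n <+>\<^bsub>M\<^esub> N" using submoduleE(4)[OF N x wv(2)] sum_upper2[OF W_submod N] by blast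
  have "x \<odot>\<^bsub>M\<^esub> v \<oplus>\<^bsub>M\<^esub> x \<odot>\<^bsub>M\<^esub> w \<in> W n <+>\<^bsub>M\<^esub> N" using xu wv(3) wvc x by (simp add: smult_r_distr)
  then have "x \<odot>\<^bsub>M\<^esub> w \<in> W n <+>\<^bsub>M\<^esub> N"
    using submod_add_cancel[OF WN_submod[OF N] xv] wvc x by blast
  then have "x \<odot>\<^bsub>M\<^esub> w \<in> W (inc j (inc i (m [+] p))) <+>\<^bsub>M\<^esub> N" using sub by blast
  then have "w \<in> W (inc j (m [+] p)) <+>\<^bsub>M\<^esub> N"
    using c[of "m [+] p" j w] m inc.hyps wv(1) by (simp add: trans_le_add1)
  moreover have "v \<in> W (inc j (m [+] p)) <+>\<^bsub>M\<^esub> N" using wv(2) sum_upper2[OF W_submod N] by blast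
  ultimately have "u \<in> W (inc j (m [+] p)) <+>\<^bsub>M\<^esub> N"
    unfolding wv(3) using submoduleE(5)[OF WN_submod[OF N]] by blast
  moreover have "inc j (m [+] p) = m [+] inc j p" by auto
  ultimately show ?case by simp
qed

text \<open>Artin--Rees gives \<open>xM \<inter> W n \<subseteq> x W (n - c)\<close>; regularity on the graded pieces then removes the defect \<open>c\<close>
  one unit vector at a time.\<close>

lemma good_FC1:
  assumes N: "submodule N R M" and good: "good N i x"
  shows "eventually (\<lambda>n. addx x N \<inter> (W n <+>\<^bsub>M\<^esub> N) = (\<odot>\<^bsub>M\<^esub>) x ` W (dec i n) <+>\<^bsub>M\<^esub> N) (large d)"
proof -
  note x = goodD(3)[OF good] and i = goodD(1)[OF good] and xF = goodD(2)[OF good]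
  have xN: "submodule (addx x N) R M" by (rule addx_submod[OF x N])
  have xM: "submodule ((\<odot>\<^bsub>M\<^esub>) x ` carrier M) R M" by (rule submod_image[OF x carrier_is_submodule])
  obtain c where c: "\<And>n. W n \<inter> addx x N \<subseteq> ideal_smult R M (\<F> (\<lambda>i. n i - min (n i) c)) (W (\<lambda>i. min (n i) c) \<inter> addx x N)"
    using artin_rees[OF Int_gfams[OF xN]] by blast
  obtain e where e: "\<And>n j u. \<forall>i\<le>d. e \<le> n i \<Longrightarrow> j \<le> d \<Longrightarrow> u \<in> W n \<Longrightarrow> x \<odot>\<^bsub>M\<^esub> u \<in> W (inc j (inc i n)) <+>\<^bsub>M\<^esub> N \<Longrightarrow> u \<in> W (inc j n) <+>\<^bsub>M\<^esub> N"
    using goodD(5)[OF good] unfolding eventually_large by blast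
  have main: "addx x N \<inter> (W n <+>\<^bsub>M\<^esub> N) = (\<odot>\<^bsub>M\<^esub>) x ` W (dec i n) <+>\<^bsub>M\<^esub> N" if n: "\<forall>j\<le>d. c + e + 1 \<le> n j" for n
  proof
    have n1: "1 \<le> n i" using n i by (metis le_add2 order_trans)
    have sxd: "submodule ((\<odot>\<^bsub>M\<^esub>) x ` W (dec i n)) R M" by (rule submod_image[OF x W_submod])
    have "(\<odot>\<^bsub>M\<^esub>) x ` W (dec i n) \<subseteq> W n"
      using F_W[OF i xF, of _ "dec i n"] unfolding inc_dec(1)[of n i, OF n1] by blast
    moreover have "(\<odot>\<^bsub>M\<^esub>) x ` W (dec i n) \<subseteq> (\<odot>\<^bsub>M\<^esub>) x ` carrier M" using W_carr by blast
    ultimately show "(\<odot>\<^bsub>M\<^esub>) x ` W (dec i n) <+>\<^bsub>M\<^esub> N \<subseteq> addx x N \<inter> (W n <+>\<^bsub>M\<^esub> N)"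
      by (intro Int_greatest sum_mono order_refl)
    show "addx x N \<inter> (W n <+>\<^bsub>M\<^esub> N) \<subseteq> (\<odot>\<^bsub>M\<^esub>) x ` W (dec i n) <+>\<^bsub>M\<^esub> N"
    proof
      fix v assume v: "v \<in> addx x N \<inter> (W n <+>\<^bsub>M\<^esub> N)"
      then have "v \<in> W n <+>\<^bsub>M\<^esub> N" by blast
      then obtain w z where wz: "w \<in> W n" "z \<in> N" "v = z \<oplus>\<^bsub>M\<^esub> w"
        by (rule sumE_swapped[OF _ W_submod N])
      have "z \<in> addx x N" using wz(2) sum_upper2[OF xM N] by blast
      then have "w \<in> addx x N" using submod_add_cancel[OF xN _ W_carr[OF wz(1)]] v wz(3) by blast
      \<comment> \<open>Artin--Rees accounts for \<open>c\<close>. One more unit is given away so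
        that \<open>q\<close> stays below \<open>dec i n\<close> also in direction \<open>i\<close>,
        where the climb has to end.\<close>
      define q where "q = (\<lambda>j. n j - c - 1)"
      have mn: "min (n j) c = c" if "j \<le> d" for j using n that by (metis add.assoc le_add1 min.absorb2 order_trans)
      have step: "W n \<inter> addx x N \<subseteq> (\<odot>\<^bsub>M\<^esub>) x ` W q <+>\<^bsub>M\<^esub> N"
      proof -
        have sq: "submodule ((\<odot>\<^bsub>M\<^esub>) x ` W q <+>\<^bsub>M\<^esub> N) R M" by (intro submod_sum submod_image x W_submod N)
        have "ideal_smult R M (\<F> (\<lambda>i. n i - min (n i) c)) (W (\<lambda>i. min (n i) c) \<inter> addx x N) \<subseteq> (\<odot>\<^bsub>M\<^esub>) x ` W q <+>\<^bsub>M\<^esub> N"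
        proof (rule ideal_smult_least[OF sq])
          fix f y assume f: "f \<in> \<F> (\<lambda>i. n i - min (n i) c)" and y: "y \<in> W (\<lambda>i. min (n i) c) \<inter> addx x N"
          have fc: "f \<in> carrier R" by (rule multi_power_carr[OF f])
          show "f \<odot>\<^bsub>M\<^esub> y \<in> (\<odot>\<^bsub>M\<^esub>) x ` W q <+>\<^bsub>M\<^esub> N"
          proof (rule smult_sum_mem[OF fc N xM])
            show "y \<in> addx x N" using y by blast
            fix w assume "w \<in> (\<odot>\<^bsub>M\<^esub>) x ` carrier M"
            then obtain b where b: "b \<in> carrier M" "w = x \<odot>\<^bsub>M\<^esub> b" by blast
            have "f \<odot>\<^bsub>M\<^esub> b \<in> W (\<lambda>i. n i - min (n i) c)" unfolding W_eq by (rule ideal_smult_I[OF f b(1)])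
            also have "W (\<lambda>i. n i - min (n i) c) \<subseteq> W q"
              by (rule W_antimono) (simp add: q_def mn)
            finally show "f \<odot>\<^bsub>M\<^esub> w \<in> (\<odot>\<^bsub>M\<^esub>) x ` W q" unfolding b(2) smult_comm[OF fc x b(1)] by blast
          qed
        qed
        then show ?thesis using c[of n] by blast
      qed
      then have "w \<in> (\<odot>\<^bsub>M\<^esub>) x ` W q <+>\<^bsub>M\<^esub> N" using wz(1) \<open>w \<in> addx x N\<close> by blast
      then obtain t y where ty: "t \<in> (\<odot>\<^bsub>M\<^esub>) x ` W q" "y \<in> N" "w = y \<oplus>\<^bsub>M\<^esub> t"
        by (rule sumE_swapped[OF _ submod_image[OF x W_submod] N])
      then obtain u where uy: "u \<in> W q" "y \<in> N" "w = y \<oplus>\<^bsub>M\<^esub> x \<odot>\<^bsub>M\<^esub> u" by blast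
      have uc: "u \<in> carrier M" by (rule W_carr[OF uy(1)])
      have "w \<in> W n <+>\<^bsub>M\<^esub> N" "y \<in> W n <+>\<^bsub>M\<^esub> N" using wz(1) uy(2) sum_upper1[OF W_submod N] sum_upper2[OF W_submod N] by blast+
      then have xu: "x \<odot>\<^bsub>M\<^esub> u \<in> W n <+>\<^bsub>M\<^esub> N"
        using submod_add_cancel[OF WN_submod[OF N]] uy(3) x uc by (metis smult_closed)
      have q: "\<forall>j\<le>d. e \<le> q j" using n unfolding q_def by (auto simp: le_diff_conv)
      have "u \<in> W (q [+] (\<lambda>j. dec i n j - q j)) <+>\<^bsub>M\<^esub> N"
        by (rule good_climb[OF N good e q uy(1) xu _ n1]) (use n in \<open>auto simp: q_def dec_def\<close>)
      also have "W (q [+] (\<lambda>j. dec i n j - q j)) = W (dec i n)"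
        by (rule W_cong) (auto simp: q_def dec_def)
      finally have "u \<in> W (dec i n) <+>\<^bsub>M\<^esub> N" .
      then have "x \<odot>\<^bsub>M\<^esub> u \<in> (\<odot>\<^bsub>M\<^esub>) x ` W (dec i n) <+>\<^bsub>M\<^esub> N"
        by (rule smult_sum_mem[OF x N W_submod]) blast
      moreover have "y \<in> (\<odot>\<^bsub>M\<^esub>) x ` W (dec i n) <+>\<^bsub>M\<^esub> N" "z \<in> (\<odot>\<^bsub>M\<^esub>) x ` W (dec i n) <+>\<^bsub>M\<^esub> N"
        using uy(2) wz(2) sum_upper2[OF sxd N] by blast+
      ultimately show "v \<in> (\<odot>\<^bsub>M\<^esub>) x ` W (dec i n) <+>\<^bsub>M\<^esub> N"
        unfolding wz(3) uy(3) using submoduleE(5)[OF submod_sum[OF sxd N]] by blast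
    qed
  qed
  then show ?thesis unfolding eventually_large by blast
qed

text \<open>For large \<open>n\<close> the interval from \<open>b\<close> to \<open>a\<close> is cut
  at the sum of \<open>b\<close> and the intersection of \<open>a\<close> with \<open>z\<close>. The
  upper part has the length belonging to \<open>M/(xM + N)\<close>. By \<open>good_FC1\<close> in
  degrees \<open>n\<close> and \<open>inc 0 n\<close> the lower part is the image under
  \<open>x\<close> of the interval in degree \<open>dec i n\<close>, and \<open>x\<close> preserves
  its length because it is regular there.\<close>

lemma hilbert_fun_addx:
  assumes N: "submodule N R M" and good: "good N i x"
  shows "eventually (\<lambda>n. hilbert_fun N n = hilbert_fun (addx x N) n + hilbert_fun N (dec i n)) (large d)"
proof -
  note x = goodD(3)[OF good] and i = goodD(1)[OF good] and xF = goodD(2)[OF good]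
  note FC1 = good_FC1[OF N good]
  show ?thesis
    using FC1 eventually_large_inc[OF FC1, of 0] eventually_large_ge[of d 1] eventually_large_dec[OF goodD(4)[OF good], of i]
  proof eventually_elim
    case (elim n)
    define z a b where "z = addx x N" and "a = W n <+>\<^bsub>M\<^esub> N" and "b = W (inc 0 n) <+>\<^bsub>M\<^esub> N"
    have z: "submodule z R M" unfolding z_def by (rule addx_submod[OF x N])
    have a: "submodule a R M" and b: "submodule b R M" unfolding a_def b_def by (rule WN_submod[OF N])+
    have ba: "b \<subseteq> a" unfolding a_def b_def by (rule WN_inc)
    have Nz: "N \<subseteq> z" unfolding z_def by (rule sum_upper2[OF submod_image[OF x carrier_is_submodule] N])
    have az: "submodule (a \<inter> z) R M" by (rule submod_Int[OF a z])
    have baz: "submodule (b <+>\<^bsub>M\<^esub> (a \<inter> z)) R M" by (rule submod_sum[OF b az])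
    have bz: "submodule (b <+>\<^bsub>M\<^esub> z) R M" by (rule submod_sum[OF b z])
    have Wz: "W m <+>\<^bsub>M\<^esub> z = (W m <+>\<^bsub>M\<^esub> N) <+>\<^bsub>M\<^esub> z" for m
      using sum_assoc[OF W_submod N z] sum_absorb(2)[OF z N Nz] by simp
    have "rel_length b a = rel_length b (b <+>\<^bsub>M\<^esub> (a \<inter> z)) + rel_length (b <+>\<^bsub>M\<^esub> (a \<inter> z)) a"
      using rel_length_add[OF b baz a sum_upper1[OF b az] sum_least[OF a ba]] by blast
    moreover have "rel_length (b <+>\<^bsub>M\<^esub> (a \<inter> z)) a = hilbert_fun z n"
    proof -
      have "rel_length (b <+>\<^bsub>M\<^esub> (a \<inter> z)) a = rel_length (a \<inter> (b <+>\<^bsub>M\<^esub> z)) a" by (simp only: submod_modular[OF b z a ba])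
      also have "\<dots> = rel_length (b <+>\<^bsub>M\<^esub> z) (a <+>\<^bsub>M\<^esub> (b <+>\<^bsub>M\<^esub> z))" by (rule rel_length_diamond[OF a bz])
      also have "a <+>\<^bsub>M\<^esub> (b <+>\<^bsub>M\<^esub> z) = a <+>\<^bsub>M\<^esub> z"
        using sum_assoc[OF a b z] sum_absorb(1)[OF a b ba] by simp
      finally show ?thesis unfolding hilbert_fun_def a_def b_def Wz .
    qed
    moreover have "rel_length b (b <+>\<^bsub>M\<^esub> (a \<inter> z)) = hilbert_fun N (dec i n)"
    proof -
      have n1: "1 \<le> n i" using elim(3) i by blast
      have swap: "dec i (inc 0 n) = inc 0 (dec i n)"
        using n1 by (cases "i = 0") (auto simp: dec_def fun_eq_iff)
      have za: "a \<inter> z = (\<odot>\<^bsub>M\<^esub>) x ` W (dec i n) <+>\<^bsub>M\<^esub> N"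
        using elim(1) unfolding a_def z_def by (simp add: Int_commute)
      have zb: "b \<inter> z = (\<odot>\<^bsub>M\<^esub>) x ` W (inc 0 (dec i n)) <+>\<^bsub>M\<^esub> N"
        using elim(2) unfolding b_def z_def swap by (simp add: Int_commute)
      have "rel_length b (b <+>\<^bsub>M\<^esub> (a \<inter> z)) = rel_length b ((a \<inter> z) <+>\<^bsub>M\<^esub> b)" by (simp only: sum_comm[OF b az])
      also have "\<dots> = rel_length ((a \<inter> z) \<inter> b) (a \<inter> z)" by (rule rel_length_diamond[OF az b, symmetric])
      also have "(a \<inter> z) \<inter> b = b \<inter> z" using ba by blast
      also have "rel_length (b \<inter> z) (a \<inter> z) = hilbert_fun N (dec i n)"
        unfolding za zb hilbert_fun_def
        by (rule rel_length_mult[OF x W_submod W_submod W_inc_subset N, symmetric]) (use elim(4) in blast)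
      finally show ?thesis .
    qed
    ultimately show ?case unfolding hilbert_fun_def[of N n] a_def[symmetric] b_def[symmetric] z_def by (simp add: add.commute)
  qed
qed

end

section \<open>Numerical polynomials\<close>

definition monomial :: "nat \<Rightarrow> (nat \<Rightarrow> nat) \<Rightarrow> (nat \<Rightarrow> int) \<Rightarrow> rat" where
  "monomial d e n = (\<Prod>i\<le>d. rat_of_int (n i) ^ e i)"

lemma polynomial_fun_iff:
  "polynomial_fun d f \<longleftrightarrow> (\<exists>E c. finite E \<and> f = (\<lambda>n. \<Sum>e\<in>E. c e * monomial d e n))"
  unfolding polynomial_fun_def monomial_def ..

lemma polynomial_fun_monomial: "polynomial_fun d (\<lambda>n. c * monomial d e n)"
  unfolding polynomial_fun_iff by (intro exI[of _ "{e}"] exI[of _ "\<lambda>_. c"]) simp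

lemma polynomial_fun_zero: "polynomial_fun d (\<lambda>_. 0)"
  unfolding polynomial_fun_iff by (intro exI[of _ "{}"]) simp

lemma polynomial_fun_add:
  assumes "polynomial_fun d f" "polynomial_fun d g"
  shows "polynomial_fun d (\<lambda>n. f n + g n)"
proof -
  obtain E a where E: "finite E" "f = (\<lambda>n. \<Sum>e\<in>E. a e * monomial d e n)"
    using assms(1) unfolding polynomial_fun_iff by blast
  obtain G b where G: "finite G" "g = (\<lambda>n. \<Sum>e\<in>G. b e * monomial d e n)"
    using assms(2) unfolding polynomial_fun_iff by blast
  define c where "c e = (if e \<in> E then a e else 0) + (if e \<in> G then b e else 0)" for e
  have "(\<Sum>e\<in>E \<union> G. c e * monomial d e n) = f n + g n" for n
  proof -
    have "(\<Sum>e\<in>E \<union> G. c e * monomial d e n) =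
      (\<Sum>e\<in>E \<union> G. if e \<in> E then a e * monomial d e n else 0) + (\<Sum>e\<in>E \<union> G. if e \<in> G then b e * monomial d e n else 0)"
      unfolding c_def sum.distrib[symmetric] by (intro sum.cong) (auto simp: distrib_right)
    also have "(\<Sum>e\<in>E \<union> G. if e \<in> E then a e * monomial d e n else 0) = f n"
      unfolding E(2) using E(1) G(1) by (subst sum.inter_restrict[symmetric]) (auto intro: sum.cong)
    also have "(\<Sum>e\<in>E \<union> G. if e \<in> G then b e * monomial d e n else 0) = g n"
      unfolding G(2) using E(1) G(1) by (subst sum.inter_restrict[symmetric]) (auto intro: sum.cong)
    finally show ?thesis .
  qed
  then show ?thesis unfolding polynomial_fun_iff using E(1) G(1)
    by (intro exI[of _ "E \<union> G"] exI[of _ c]) auto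
qed

lemma polynomial_fun_induct [consumes 1, case_names zero monomial add]:
  assumes "polynomial_fun d f" "P (\<lambda>_. 0)" "\<And>c e. P (\<lambda>n. c * monomial d e n)"
    and add: "\<And>f g. P f \<Longrightarrow> P g \<Longrightarrow> P (\<lambda>n. f n + g n)"
  shows "P f"
proof -
  obtain E c where E: "finite E" "f = (\<lambda>n. \<Sum>e\<in>E. c e * monomial d e n)"
    using assms(1) unfolding polynomial_fun_iff by blast
  have "P (\<lambda>n. \<Sum>e\<in>E. c e * monomial d e n)"
    using E(1)
  proof (induction E)
    case empty
    then show ?case using assms(2) by simp
  next
    case (insert e E)
    then show ?case using add[OF assms(3)[of "c e" e] insert.IH] by simp
  qed
  then show ?thesis using E(2) by simp
qed

lemma polynomial_fun_const: "polynomial_fun d (\<lambda>_. c)"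
  using polynomial_fun_monomial[of d c "\<lambda>_. 0"] by (simp add: monomial_def)

lemma polynomial_fun_mult:
  assumes "polynomial_fun d f" "polynomial_fun d g"
  shows "polynomial_fun d (\<lambda>n. f n * g n)"
  using assms(1)
proof (induction f rule: polynomial_fun_induct)
  case zero
  then show ?case by (simp add: polynomial_fun_zero)
next
  case (monomial c e)
  show ?case
    using assms(2)
  proof (induction g rule: polynomial_fun_induct)
    case zero
    then show ?case by (simp add: polynomial_fun_zero)
  next
    case (monomial c' e')
    have "c * monomial d e n * (c' * monomial d e' n) = (c * c') * monomial d (\<lambda>i. e i + e' i) n" for n
      by (simp add: monomial_def power_add prod.distrib)
    then show ?case using polynomial_fun_monomial[of d "c * c'" "\<lambda>i. e i + e' i"] by (simp only:)
  next
    case (add f g)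
    then show ?case using polynomial_fun_add by (simp add: distrib_left)
  qed
next
  case (add f g)
  then show ?case using polynomial_fun_add by (simp add: distrib_right)
qed

lemma polynomial_fun_cmult: "polynomial_fun d f \<Longrightarrow> polynomial_fun d (\<lambda>n. c * f n)"
  by (rule polynomial_fun_mult[OF polynomial_fun_const])

lemma polynomial_fun_diff:
  assumes "polynomial_fun d f" "polynomial_fun d g"
  shows "polynomial_fun d (\<lambda>n. f n - g n)"
  using polynomial_fun_add[OF assms(1) polynomial_fun_cmult[OF assms(2), of "- 1"]] by simp

lemma polynomial_fun_power: "polynomial_fun d f \<Longrightarrow> polynomial_fun d (\<lambda>n. f n ^ k)"
  by (induction k) (simp_all add: polynomial_fun_const polynomial_fun_mult)

lemma polynomial_fun_prod:
  "finite A \<Longrightarrow> (\<And>a. a \<in> A \<Longrightarrow> polynomial_fun d (f a)) \<Longrightarrow> polynomial_fun d (\<lambda>n. \<Prod>a\<in>A. f a n)"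
  by (induction A rule: finite_induct) (simp_all add: polynomial_fun_const polynomial_fun_mult)

lemma polynomial_fun_sum:
  "finite A \<Longrightarrow> (\<And>a. a \<in> A \<Longrightarrow> polynomial_fun d (f a)) \<Longrightarrow> polynomial_fun d (\<lambda>n. \<Sum>a\<in>A. f a n)"
  by (induction A rule: finite_induct) (simp_all add: polynomial_fun_zero polynomial_fun_add)

lemma polynomial_fun_var:
  assumes "j \<le> d" shows "polynomial_fun d (\<lambda>n. rat_of_int (n j))"
proof -
  have "1 * monomial d (\<lambda>i. if i = j then 1 else 0) n = rat_of_int (n j)" for n
  proof -
    have "monomial d (\<lambda>i. if i = j then 1 else 0) n = (\<Prod>i\<le>d. if i = j then rat_of_int (n j) else 1)"
      unfolding monomial_def by (intro prod.cong) auto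
    then show ?thesis using assms by simp
  qed
  then show ?thesis using polynomial_fun_monomial[of d 1 "\<lambda>i. if i = j then 1 else 0"] by simp
qed

lemma polynomial_fun_subst:
  assumes f: "polynomial_fun d f" and \<sigma>: "\<And>i. i \<le> d \<Longrightarrow> polynomial_fun d (\<lambda>n. rat_of_int (\<sigma> n i))"
  shows "polynomial_fun d (\<lambda>n. f (\<sigma> n))"
  using f
proof (induction f rule: polynomial_fun_induct)
  case (monomial c e)
  show ?case unfolding monomial_def using \<sigma> by (intro polynomial_fun_cmult polynomial_fun_prod polynomial_fun_power) auto
qed (simp_all add: polynomial_fun_zero polynomial_fun_add)

lemma polynomial_fun_cong:
  assumes "polynomial_fun d f" "\<And>i. i \<le> d \<Longrightarrow> n i = m i"
  shows "f n = f m"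
  using assms(1)
proof (induction f rule: polynomial_fun_induct)
  case (monomial c e)
  have "monomial d e n = monomial d e m" unfolding monomial_def using assms(2) by (intro prod.cong) auto
  then show ?case by simp
qed auto

lemma polynomial_fun_difference:
  assumes f: "polynomial_fun d f" and j: "j \<le> d"
  shows "polynomial_fun d (difference j f)"
proof -
  have "polynomial_fun d (\<lambda>n. f (n(j := n j - 1)))"
  proof (rule polynomial_fun_subst[OF f])
    show "polynomial_fun d (\<lambda>n. rat_of_int ((n(j := n j - 1)) i))" if "i \<le> d" for i
      using polynomial_fun_diff[OF polynomial_fun_var[OF j] polynomial_fun_const[of d 1]] polynomial_fun_var[OF that] by (cases "i = j") simp_all
  qed
  then have "polynomial_fun d (\<lambda>n. f n - f (n(j := n j - 1)))" by (rule polynomial_fun_diff[OF f])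
  moreover have "difference j f = (\<lambda>n. f n - f (n(j := n j - 1)))"
    by (simp add: difference_def fun_eq_iff)
  ultimately show ?thesis by simp
qed

text \<open>The difference of \<open>t ^ Suc k\<close> is \<open>Suc k\<close> times
  \<open>t ^ k\<close> minus terms of lower degree, and these have antidifferences by induction. The
  \<open>c l\<close> are the coefficients of \<open>(t - 1) ^ Suc k\<close>.\<close>

lemma power_antidifference: "\<exists>p :: rat poly. \<forall>t. poly p t - poly p (t - 1) = t ^ k"
proof (induction k rule: less_induct)
  case (less k)
  then obtain p :: "nat \<Rightarrow> rat poly" where p: "\<And>l t. l < k \<Longrightarrow> poly (p l) t - poly (p l) (t - 1) = t ^ l"
    by metis
  define c where "c l = of_nat (Suc k choose l) * (- 1 :: rat) ^ (Suc k - l)" for l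
  have expand: "t ^ Suc k - (t - 1) ^ Suc k = of_nat (Suc k) * t ^ k - (\<Sum>l<k. c l * t ^ l)" for t :: rat
  proof -
    have "(t - 1) ^ Suc k = (\<Sum>l\<le>Suc k. c l * t ^ l)"
      unfolding c_def using binomial_ring[of t "- 1" "Suc k"] by (simp add: mult_ac del: power_Suc sum.atMost_Suc binomial_Suc_Suc)
    also have "{..Suc k} = insert (Suc k) (insert k {..<k})" by auto
    also have "(\<Sum>l\<in>insert (Suc k) (insert k {..<k}). c l * t ^ l) = c (Suc k) * t ^ Suc k + (c k * t ^ k + (\<Sum>l<k. c l * t ^ l))"
      by simp
    also have "c (Suc k) = 1" unfolding c_def by simp
    also have "c k = - of_nat (Suc k)" unfolding c_def by simp
    finally have "(t - 1) ^ Suc k = 1 * t ^ Suc k + (- of_nat (Suc k) * t ^ k + (\<Sum>l<k. c l * t ^ l))" .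
    then show ?thesis by (simp only: mult_1 minus_mult_left[symmetric] diff_conv_add_uminus minus_add_distrib minus_minus)
  qed
  define q where "q = smult (1 / of_nat (Suc k)) (monom 1 (Suc k) + (\<Sum>l<k. smult (c l) (p l)))"
  have "poly q t - poly q (t - 1) = t ^ k" for t
  proof -
    have "poly q t - poly q (t - 1) =
        (1 / of_nat (Suc k)) * ((t ^ Suc k - (t - 1) ^ Suc k) + (\<Sum>l<k. c l * (poly (p l) t - poly (p l) (t - 1))))"
      unfolding q_def by (simp add: poly_monom poly_sum sum_subtractf right_diff_distrib add_divide_distrib diff_divide_distrib del: power_Suc of_nat_Suc)
    also have "(\<Sum>l<k. c l * (poly (p l) t - poly (p l) (t - 1))) = (\<Sum>l<k. c l * t ^ l)"
      by (intro sum.cong refl) (simp add: p)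
    also have "(1 / of_nat (Suc k)) * ((t ^ Suc k - (t - 1) ^ Suc k) + (\<Sum>l<k. c l * t ^ l)) = t ^ k"
      unfolding expand by (simp del: of_nat_Suc)
    finally show ?thesis .
  qed
  then show ?case by blast
qed

lemma polynomial_fun_poly:
  assumes "j \<le> d"
  shows "polynomial_fun d (\<lambda>n. poly p (rat_of_int (n j)))"
  unfolding poly_altdef using assms by (intro polynomial_fun_sum polynomial_fun_cmult polynomial_fun_power polynomial_fun_var) auto

text \<open>Antidifferences are additive, and for a monomial only the power of the variable
  \<open>j\<close> has to be treated; the other factors do not change under
  \<open>difference j\<close>.\<close>

lemma polynomial_fun_antidifference:
  assumes "polynomial_fun d f" and j: "j \<le> d"
  shows "\<exists>T. polynomial_fun d T \<and> (\<forall>n. difference j T n = f n)"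
  using assms(1)
proof (induction f rule: polynomial_fun_induct)
  case zero
  show ?case by (intro exI[of _ "\<lambda>_. 0"]) (simp add: polynomial_fun_zero difference_def)
next
  case (monomial c e)
  obtain p :: "rat poly" where p: "\<And>t. poly p t - poly p (t - 1) = t ^ e j"
    using power_antidifference by blast
  define r where "r n = (\<Prod>i\<in>{..d} - {j}. rat_of_int (n i) ^ e i)" for n :: "nat \<Rightarrow> int"
  have r: "polynomial_fun d r" unfolding r_def by (intro polynomial_fun_prod polynomial_fun_power polynomial_fun_var) auto
  have rj: "r (n(j := t)) = r n" for n t unfolding r_def by (intro prod.cong) auto
  have m: "monomial d e n = rat_of_int (n j) ^ e j * r n" for n
    unfolding monomial_def r_def using j by (simp add: prod.remove)
  let ?T = "\<lambda>n. c * (poly p (rat_of_int (n j)) * r n)"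
  have "polynomial_fun d ?T" by (intro polynomial_fun_cmult polynomial_fun_mult polynomial_fun_poly j r)
  moreover have "difference j ?T n = c * monomial d e n" for n
  proof -
    have "difference j ?T n = c * ((poly p (rat_of_int (n j)) - poly p (rat_of_int (n j) - 1)) * r n)"
      unfolding difference_def rj by (simp add: algebra_simps)
    then show ?thesis unfolding p m .
  qed
  ultimately show ?case by blast
next
  case (add f g)
  then obtain S T where "polynomial_fun d S" "\<forall>n. difference j S n = f n" "polynomial_fun d T" "\<forall>n. difference j T n = g n"
    by blast
  moreover have "difference j (\<lambda>n. S n + T n) n = difference j S n + difference j T n" for n
    by (simp add: difference_def)
  ultimately show ?case
    by (intro exI[of _ "\<lambda>n. S n + T n"] conjI polynomial_fun_add) simp_all
qed

section \<open>Polynomials determined by their values at large multi-indices or by their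
  differences\<close>

lemma polynomial_fun_univariate:
  assumes "polynomial_fun d f"
  shows "\<exists>p :: rat poly. \<forall>t. f (n(j := t)) = poly p (rat_of_int t)"
  using assms
proof (induction f rule: polynomial_fun_induct)
  case zero
  show ?case by (intro exI[of _ 0]) simp
next
  case (monomial c e)
  let ?p = "\<Prod>i\<le>d. (if i = j then [:0, 1:] else [:rat_of_int (n i):]) ^ e i"
  have "c * monomial d e (n(j := t)) = poly (smult c ?p) (rat_of_int t)" for t
    unfolding monomial_def by (auto simp: poly_prod intro!: prod.cong)
  then show ?case by blast
next
  case (add f g)
  then obtain p q :: "rat poly" where "\<forall>t. f (n(j := t)) = poly p (rat_of_int t)" "\<forall>t. g (n(j := t)) = poly q (rat_of_int t)"
    by blast
  then show ?case by (intro exI[of _ "p + q"]) (simp only: poly_add simp_thms)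
qed

text \<open>The coordinates are freed one at a time from the condition of being large. Each time the
  function is a polynomial in one variable with infinitely many zeros.\<close>

lemma polynomial_fun_eq_zero:
  assumes f: "polynomial_fun d f" and ev: "eventually (\<lambda>n. f (\<lambda>i. int (n i)) = 0) (large d)"
  shows "f = (\<lambda>_. 0)"
proof -
  obtain N where N: "\<And>n. \<forall>i\<le>d. N \<le> n i \<Longrightarrow> f (\<lambda>i. int (n i)) = 0"
    using ev unfolding eventually_large by blast
  \<comment> \<open>The coordinates below \<open>p\<close> are already arbitrary integers, those
    from \<open>p\<close> on are still large.\<close>
  have "\<forall>n. (\<forall>i. p \<le> i \<and> i \<le> d \<longrightarrow> int N \<le> n i) \<longrightarrow> f n = 0" for p
  proof (induction p)
    case 0
    show ?case
    proof (intro allI impI)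
      fix n :: "nat \<Rightarrow> int" assume n: "\<forall>i. 0 \<le> i \<and> i \<le> d \<longrightarrow> int N \<le> n i"
      then have "\<forall>i\<le>d. N \<le> nat (n i)" by auto
      then have "f (\<lambda>i. int (nat (n i))) = 0" by (rule N)
      moreover have "f n = f (\<lambda>i. int (nat (n i)))"
        by (rule polynomial_fun_cong[OF f]) (use n in force)
      ultimately show "f n = 0" by simp
    qed
  next
    case (Suc p)
    show ?case
    proof (intro allI impI)
      fix n :: "nat \<Rightarrow> int" assume n: "\<forall>i. Suc p \<le> i \<and> i \<le> d \<longrightarrow> int N \<le> n i"
      obtain q :: "rat poly" where q: "\<And>t. f (n(p := t)) = poly q (rat_of_int t)"
        using polynomial_fun_univariate[OF f] by blast
      have "poly q (rat_of_int t) = 0" if "t \<ge> int N" for t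
        unfolding q[symmetric] using Suc n that by (auto simp: not_less_eq_eq le_less_Suc_eq)
      then have "rat_of_int ` {int N..} \<subseteq> {x. poly q x = 0}" by auto
      moreover have "infinite (rat_of_int ` {int N..})"
        by (simp add: finite_image_iff inj_on_def infinite_Ici)
      ultimately have "infinite {x. poly q x = 0}" by (rule infinite_super)
      then have "q = 0" using poly_roots_finite by blast
      then have "f (n(p := n p)) = 0" unfolding q by simp
      then show "f n = 0" by simp
    qed
  qed
  from this[of "Suc d"] show ?thesis by (auto simp: fun_eq_iff)
qed

lemma polynomial_fun_unique:
  assumes f: "polynomial_fun d f" and g: "polynomial_fun d g"
    and ev: "eventually (\<lambda>n. f (\<lambda>i. int (n i)) = g (\<lambda>i. int (n i))) (large d)"
  shows "f = g"
proof -
  have "(\<lambda>n. f n - g n) = (\<lambda>_. 0)"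
    by (rule polynomial_fun_eq_zero[OF polynomial_fun_diff[OF f g]]) (use ev in \<open>auto elim: eventually_mono\<close>)
  then show ?thesis by (auto simp: fun_eq_iff)
qed

text \<open>The multi-index \<open>n\<close> is reached from \<open>(N, ..., N)\<close> by changing
  one coordinate at a time, and along each leg \<open>H\<close> changes by the increment of an
  antidifference of \<open>G j\<close>. No compatibility between the \<open>G j\<close> has to be
  checked, as they are differences of the same \<open>H\<close>.\<close>

lemma polynomial_fun_from_differences:
  fixes H :: "(nat \<Rightarrow> nat) \<Rightarrow> rat"
  assumes cong: "\<And>n m. (\<And>i. i \<le> d \<Longrightarrow> n i = m i) \<Longrightarrow> H n = H m"
    and D: "\<And>j. j \<le> d \<Longrightarrow> \<exists>G. polynomial_fun d G \<and>
      eventually (\<lambda>n. G (\<lambda>i. int (n i)) = H n - H (dec j n)) (large d)"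
  shows "\<exists>f. polynomial_fun d f \<and> eventually (\<lambda>n. f (\<lambda>i. int (n i)) = H n) (large d)"
proof -
  obtain G where G: "\<And>j. j \<le> d \<Longrightarrow> polynomial_fun d (G j)"
    "\<And>j. j \<le> d \<Longrightarrow> eventually (\<lambda>n. G j (\<lambda>i. int (n i)) = H n - H (dec j n)) (large d)"
    using D by metis
  have "eventually (\<lambda>n. \<forall>j\<in>{..d}. G j (\<lambda>i. int (n i)) = H n - H (dec j n)) (large d)"
    using G(2) by (intro eventually_ball_finite) auto
  then obtain N where N: "\<And>n j. \<forall>i\<le>d. N \<le> n i \<Longrightarrow> j \<le> d \<Longrightarrow> G j (\<lambda>i. int (n i)) = H n - H (dec j n)"
    unfolding eventually_large by blast
  have "\<exists>T. polynomial_fun d T \<and> (\<forall>n. difference j T n = G j n)" if "j \<le> d" for j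
    using polynomial_fun_antidifference[OF G(1)[OF that] that] .
  then obtain A where A: "\<And>j. j \<le> d \<Longrightarrow> polynomial_fun d (A j)"
    "\<And>j n. j \<le> d \<Longrightarrow> A j n - A j (n(j := n j - 1)) = G j n"
    unfolding difference_def by metis
  \<comment> \<open>The total of \<open>G j\<close> along the leg in direction \<open>j\<close> from
    height \<open>N\<close> to height \<open>n j\<close>.\<close>
  define T where "T j n = A j n - A j (n(j := int N))" for j n
  have T: "H n - H (n(j := N)) = T j (\<lambda>i. int (n i))" if j: "j \<le> d" and n: "\<forall>i\<le>d. N \<le> n i" for n j
  proof -
    have "H (n(j := N + t)) - H (n(j := N)) = T j (\<lambda>i. int ((n(j := N + t)) i))" for t
    proof (induction t)
      case 0
      have "(\<lambda>i. int ((n(j := N)) i))(j := int N) = (\<lambda>i. int ((n(j := N)) i))" by auto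
      then show ?case unfolding T_def by simp
    next
      case (Suc t)
      let ?m = "n(j := N + Suc t)"
      have g1: "G j (\<lambda>i. int (?m i)) = H ?m - H (dec j ?m)" by (rule N) (use n j in auto)
      have g2: "dec j ?m = n(j := N + t)" by (auto simp: dec_def)
      have g3: "A j (\<lambda>i. int (?m i)) - A j ((\<lambda>i. int (?m i))(j := int (?m j) - 1)) = G j (\<lambda>i. int (?m i))"
        by (rule A(2)[OF j, of "\<lambda>i. int (?m i)"])
      have g4: "(\<lambda>i. int (?m i))(j := int (?m j) - 1) = (\<lambda>i. int ((n(j := N + t)) i))" by auto
      have g5: "(\<lambda>i. int (?m i))(j := int N) = (\<lambda>i. int ((n(j := N + t)) i))(j := int N)" by auto
      have "A j (\<lambda>i. int (?m i)) - A j (\<lambda>i. int ((n(j := N + t)) i)) = H ?m - H (n(j := N + t))"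
        using g1 g3 unfolding g2 g4 by (rule trans[rotated])
      then show ?case using Suc unfolding T_def g5 by linarith
    qed
    from this[of "n j - N"] show ?thesis using n j by simp
  qed
  \<comment> \<open>The first \<open>p\<close> coordinates are lowered to \<open>N\<close>; at
    \<open>p = Suc d\<close> only the constant \<open>H (N, ..., N)\<close> remains.\<close>
  let ?\<rho> = "\<lambda>p n i. if i < p then N else n i"
  have tele: "p \<le> Suc d \<Longrightarrow> \<forall>i\<le>d. N \<le> n i \<Longrightarrow> H n = (\<Sum>j<p. T j (\<lambda>i. int (?\<rho> j n i))) + H (?\<rho> p n)" for n p
  proof (induction p)
    case (Suc p)
    have "H (?\<rho> p n) - H ((?\<rho> p n)(p := N)) = T p (\<lambda>i. int (?\<rho> p n i))"
      by (rule T) (use Suc.prems in auto)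
    moreover have "(?\<rho> p n)(p := N) = ?\<rho> (Suc p) n" by (auto simp: fun_eq_iff less_Suc_eq)
    ultimately show ?case using Suc by simp
  qed simp
  define f where "f n = (\<Sum>j<Suc d. T j (\<lambda>i. if i < j then int N else n i)) + H (\<lambda>_. N)" for n
  have "polynomial_fun d f"
    unfolding f_def
  proof (intro polynomial_fun_add polynomial_fun_sum polynomial_fun_const)
    fix j assume "j \<in> {..<Suc d}"
    then have j: "j \<le> d" by simp
    have s: "polynomial_fun d (\<lambda>n. rat_of_int (if b then int N else n i))" if "i \<le> d" for b i
      using polynomial_fun_const polynomial_fun_var[OF that] by (cases b) simp_all
    have "polynomial_fun d (\<lambda>n. A j (n(j := int N)))"
      by (rule polynomial_fun_subst[OF A(1)[OF j]]) (simp add: fun_upd_def s)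
    then have "polynomial_fun d (T j)" unfolding T_def by (intro polynomial_fun_diff A(1)[OF j])
    then show "polynomial_fun d (\<lambda>n. T j (\<lambda>i. if i < j then int N else n i))"
      by (rule polynomial_fun_subst) (rule s)
  qed simp
  moreover have "f (\<lambda>i. int (n i)) = H n" if n: "\<forall>i\<le>d. N \<le> n i" for n
  proof -
    have "H (?\<rho> (Suc d) n) = H (\<lambda>_. N)" by (rule cong) simp
    moreover have "(\<lambda>i. int (?\<rho> j n i)) = (\<lambda>i. if i < j then int N else int (n i))" for j by auto
    ultimately show ?thesis using tele[OF order_refl n] unfolding f_def by simp
  qed
  ultimately show ?thesis unfolding eventually_large by blast
qed

lemma polynomial_fun_constant:
  assumes f: "polynomial_fun d f" and D: "\<And>j. j \<le> d \<Longrightarrow> difference j f = (\<lambda>_. 0)"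
  shows "f n = f (\<lambda>_. 0)"
proof -
  have step: "f (n(j := t)) = f (n(j := t - 1))" if "j \<le> d" for j n t
    using fun_cong[OF D[OF that], of "n(j := t)"] by (simp add: difference_def)
  have inv: "f (n(j := t)) = f (n(j := 0))" if "j \<le> d" for j n t
  proof (induction t rule: int_induct[of _ 0])
    case (step1 i)
    then show ?case using step[OF that, of n "i + 1"] by (metis add_diff_cancel_right')
  next
    case (step2 i)
    then show ?case using step[OF that, of n i] by metis
  qed simp
  have zero: "f n = f (n(j := 0))" if "j \<le> d" for j n
    using inv[OF that, of n "n j"] by simp
  have "p \<le> Suc d \<Longrightarrow> f n = f (\<lambda>i. if i < p then 0 else n i)" for p
  proof (induction p)
    case (Suc p)
    have "(\<lambda>i. if i < p then 0 else n i)(p := 0) = (\<lambda>i. if i < Suc p then 0 else n i)"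
      by (auto simp: fun_eq_iff less_Suc_eq)
    then show ?case using Suc zero[of p "\<lambda>i. if i < p then 0 else n i"] by simp
  qed simp
  from this[of "Suc d"] have "f n = f (\<lambda>i. if i < Suc d then 0 else n i)" by simp
  also have "\<dots> = f (\<lambda>_. 0)" by (rule polynomial_fun_cong[OF f]) simp
  finally show ?thesis .
qed

context local_multi_ideals
begin

section \<open>Hilbert polynomials of quotients\<close>

definition hilbert_nat :: "'c set \<Rightarrow> (nat \<Rightarrow> nat) \<Rightarrow> nat" where
  "hilbert_nat N n = the_enat (hilbert_fun N n)"

lemma hilbert_nat: "submodule N R M \<Longrightarrow> hilbert_fun N n = enat (hilbert_nat N n)"
  unfolding hilbert_nat_def using hilbert_fun_finite[of N n] by (cases "hilbert_fun N n") auto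

definition is_hilbert_poly :: "((nat \<Rightarrow> int) \<Rightarrow> rat) \<Rightarrow> 'c set \<Rightarrow> bool" where
  "is_hilbert_poly f N \<longleftrightarrow> polynomial_fun d f \<and>
     eventually (\<lambda>n. f (\<lambda>i. int (n i)) = rat_of_nat (hilbert_nat N n)) (large d)"

lemma hilbert_fun_cong: "(\<And>i. i \<le> d \<Longrightarrow> n i = m i) \<Longrightarrow> hilbert_fun N n = hilbert_fun N m"
  using W_cong[of n m] W_cong[of "inc 0 n" "inc 0 m"] unfolding hilbert_fun_def by simp

lemma int_dec: "1 \<le> n i \<Longrightarrow> (\<lambda>j. int (dec i n j)) = (\<lambda>j. int (n j))(i := int (n i) - 1)"
  by (auto simp: dec_def fun_eq_iff)

lemma hilbert_nat_addx:
  assumes N: "submodule N R M" and good: "good N i x"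
  shows "eventually (\<lambda>n. hilbert_nat N n = hilbert_nat (addx x N) n + hilbert_nat N (dec i n)) (large d)"
  using hilbert_fun_addx[OF N good]
  by (rule eventually_mono) (simp add: hilbert_nat[OF N] hilbert_nat[OF addx_submod[OF goodD(3)[OF good] N]])

lemma is_hilbert_poly_addx:
  assumes N: "submodule N R M" and good: "good N i x" and f: "is_hilbert_poly f N"
  shows "is_hilbert_poly (difference i f) (addx x N)"
  unfolding is_hilbert_poly_def
proof
  have f': "polynomial_fun d f" "eventually (\<lambda>n. f (\<lambda>i. int (n i)) = rat_of_nat (hilbert_nat N n)) (large d)"
    using f unfolding is_hilbert_poly_def by blast+
  note i = goodD(1)[OF good]
  show "polynomial_fun d (difference i f)" by (rule polynomial_fun_difference[OF f'(1) i])
  show "eventually (\<lambda>n. difference i f (\<lambda>i. int (n i)) = rat_of_nat (hilbert_nat (addx x N) n)) (large d)"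
    using hilbert_nat_addx[OF N good] f'(2) eventually_large_dec[OF f'(2), of i] eventually_large_ge[of d 1]
  proof eventually_elim
    case (elim n)
    have "1 \<le> n i" using elim(4) i by blast
    then have "difference i f (\<lambda>i. int (n i)) = f (\<lambda>j. int (n j)) - f (\<lambda>j. int (dec i n j))"
      unfolding difference_def int_dec[of n i, OF \<open>1 \<le> n i\<close>] by simp
    then show ?case using elim(1-3) by simp
  qed
qed

lemma is_hilbert_poly_unique: "is_hilbert_poly f N \<Longrightarrow> is_hilbert_poly g N \<Longrightarrow> f = g"
proof -
  assume a: "is_hilbert_poly f N" "is_hilbert_poly g N"
  have "eventually (\<lambda>n. f (\<lambda>i. int (n i)) = g (\<lambda>i. int (n i))) (large d)"
    using conjunct2[OF a(1)[unfolded is_hilbert_poly_def]] conjunct2[OF a(2)[unfolded is_hilbert_poly_def]] by eventually_elim simp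
  then show "f = g" using a unfolding is_hilbert_poly_def by (intro polynomial_fun_unique) auto
qed

lemma is_hilbert_poly_zero_iff:
  assumes N: "submodule N R M"
  shows "is_hilbert_poly (\<lambda>_. 0) N \<longleftrightarrow> eventually (\<lambda>n. W n \<subseteq> N) (large d)"
proof -
  have "(0 = rat_of_nat (hilbert_nat N n)) \<longleftrightarrow> W n \<subseteq> N" for n
    using hilbert_fun_zero_iff[OF N, of n] hilbert_nat[OF N, of n] by (auto simp: zero_enat_def)
  then show ?thesis unfolding is_hilbert_poly_def by (simp add: polynomial_fun_zero)
qed

lemma good_element_exists:
  assumes "submodule N R M" "i \<le> d"
  shows "\<exists>x. good N i x"
proof -
  obtain x where "good N i x" by (rule good_exists[OF assms finite.emptyI empty_subsetI])
  then show ?thesis ..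
qed

text \<open>Noetherian induction: if a good \<open>x \<in> F j\<close> satisfies \<open>xM \<subseteq> N\<close> then the Hilbert function of \<open>M/N\<close>
  vanishes; otherwise all the differences are Hilbert functions of smaller quotients.\<close>

lemma is_hilbert_poly_exists:
  assumes "submodule N R M"
  shows "\<exists>f. is_hilbert_poly f N"
proof -
  have "N \<in> submods" using assms unfolding submods_def by blast
  with acc_submods show ?thesis
  proof (induction N rule: acc_on_induct)
    case (step N)
    have N: "submodule N R M" using step(1) unfolding submods_def by blast
    have "\<exists>x. good N j x" if "j \<le> d" for j
      by (rule good_element_exists[OF N that])
    then obtain x where x: "\<And>j. j \<le> d \<Longrightarrow> good N j (x j)" by metis
    show ?case
    proof (cases "\<exists>j\<le>d. addx (x j) N = N")
      case True
      then obtain j where j: "j \<le> d" "addx (x j) N = N" by blast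
      have sub: "(\<odot>\<^bsub>M\<^esub>) (x j) ` carrier M \<subseteq> N"
        using sum_upper1[OF submod_image[OF goodD(3)[OF x[OF j(1)]] carrier_is_submodule] N] j(2) by simp
      have "eventually (\<lambda>n. W n \<subseteq> N) (large d)"
        using goodD(4)[OF x[OF j(1)]]
      proof (rule eventually_mono)
        fix n assume "\<forall>u\<in>W n. x j \<odot>\<^bsub>M\<^esub> u \<in> N \<longrightarrow> u \<in> N"
        then show "W n \<subseteq> N" using W_carr sub by blast
      qed
      then show ?thesis using is_hilbert_poly_zero_iff[OF N] by blast
    next
      case False
      have diffs: "\<exists>G. polynomial_fun d G \<and>
          eventually (\<lambda>n. G (\<lambda>i. int (n i)) = rat_of_nat (hilbert_nat N n) - rat_of_nat (hilbert_nat N (dec j n))) (large d)"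
        if j: "j \<le> d" for j
      proof -
        note xc = goodD(3)[OF x[OF j]]
        have "N \<subseteq> addx (x j) N" by (rule sum_upper2[OF submod_image[OF xc carrier_is_submodule] N])
        then have "N < addx (x j) N" using False j by blast
        moreover have "addx (x j) N \<in> submods" unfolding submods_def using addx_submod[OF xc N] by blast
        ultimately obtain G where G: "is_hilbert_poly G (addx (x j) N)" using step(2) by blast
        have "eventually (\<lambda>n. G (\<lambda>i. int (n i)) = rat_of_nat (hilbert_nat N n) - rat_of_nat (hilbert_nat N (dec j n))) (large d)"
          using conjunct2[OF G[unfolded is_hilbert_poly_def]] hilbert_nat_addx[OF N x[OF j]] by eventually_elim simp
        then show ?thesis using G unfolding is_hilbert_poly_def by blast
      qed
      have "\<exists>f. polynomial_fun d f \<and> eventually (\<lambda>n. f (\<lambda>i. int (n i)) = rat_of_nat (hilbert_nat N n)) (large d)"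
      proof (rule polynomial_fun_from_differences[OF _ diffs])
        show "rat_of_nat (hilbert_nat N n) = rat_of_nat (hilbert_nat N m)" if "\<And>i. i \<le> d \<Longrightarrow> n i = m i" for n m
          unfolding hilbert_nat_def by (simp only: hilbert_fun_cong[OF that])
      qed
      then show ?thesis unfolding is_hilbert_poly_def .
    qed
  qed
qed

section \<open>Sequences of good elements\<close>

text \<open>The index accompanies the element because an element may lie in several of the ideals,
  while the direction of the difference depends on the chosen one.\<close>

fun goodseq :: "(nat \<times> 'a) list \<Rightarrow> 'c set \<Rightarrow> bool" where
  "goodseq [] N = True"
| "goodseq ((i, x) # zs) N = (good N i x \<and> goodseq zs (addx x N))"

fun addseq :: "(nat \<times> 'a) list \<Rightarrow> 'c set \<Rightarrow> 'c set" where
  "addseq [] N = N"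
| "addseq ((i, x) # zs) N = addseq zs (addx x N)"

text \<open>The right-hand side of a joint reduction in degree \<open>n\<close>, summed over the
  single elements and not over the ideals they generate; \<open>red_part_eq_gen\<close> compares the
  two.\<close>

fun red_part :: "(nat \<times> 'a) list \<Rightarrow> (nat \<Rightarrow> nat) \<Rightarrow> 'c set" where
  "red_part [] n = {\<zero>\<^bsub>M\<^esub>}"
| "red_part ((i, x) # zs) n = (\<odot>\<^bsub>M\<^esub>) x ` W (dec i n) <+>\<^bsub>M\<^esub> red_part zs n"

abbreviation seq_in :: "(nat \<times> 'a) list \<Rightarrow> bool" where
  "seq_in zs \<equiv> \<forall>(i, x)\<in>set zs. i \<le> d \<and> x \<in> F i"

lemma goodseq_in: "goodseq zs N \<Longrightarrow> seq_in zs"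
  by (induction zs N rule: goodseq.induct) (auto simp: good_def)

lemma goodseq_exists:
  assumes "set is \<subseteq> {..d}" "submodule N R M"
  shows "\<exists>zs. map fst zs = is \<and> goodseq zs N"
  using assms
proof (induction "is" arbitrary: N)
  case (Cons i "is")
  obtain x where x: "good N i x" using good_element_exists[OF Cons.prems(2), of i] Cons.prems(1) by auto
  obtain zs where "map fst zs = is" "goodseq zs (addx x N)"
    using Cons.IH[of "addx x N"] Cons.prems addx_submod[OF goodD(3)[OF x]] by auto
  then show ?case using x by (intro exI[of _ "(i, x) # zs"]) simp
qed simp

lemma addseq_submod: "seq_in zs \<Longrightarrow> submodule N R M \<Longrightarrow> submodule (addseq zs N) R M"
  by (induction zs N rule: addseq.induct) (auto intro!: addx_submod F_carr)

lemma is_hilbert_poly_goodseq: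
  "goodseq zs N \<Longrightarrow> submodule N R M \<Longrightarrow> is_hilbert_poly f N \<Longrightarrow> is_hilbert_poly (fold difference (map fst zs) f) (addseq zs N)"
  by (induction zs N arbitrary: f rule: goodseq.induct)
     (auto intro!: is_hilbert_poly_addx addx_submod goodD(3))

lemma red_part_submod: "seq_in zs \<Longrightarrow> submodule (red_part zs n) R M"
  by (induction zs) (auto intro!: zero_submod submod_sum submod_image W_submod F_carr)

lemma red_part_subset:
  "seq_in zs \<Longrightarrow> \<forall>i\<le>d. 1 \<le> n i \<Longrightarrow> red_part zs n \<subseteq> W n"
proof (induction zs)
  case Nil
  then show ?case using submod_zero[OF W_submod] by simp
next
  case (Cons z zs)
  obtain i x where z: "z = (i, x)" by force
  have ix: "i \<le> d" "x \<in> F i" using Cons.prems(1) z by auto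
  then have "1 \<le> n i" using Cons.prems(2) by blast
  have "(\<odot>\<^bsub>M\<^esub>) x ` W (dec i n) \<subseteq> W n"
    using F_W[OF ix, of _ "dec i n"] unfolding inc_dec(1)[of n i, OF \<open>1 \<le> n i\<close>] by blast
  then show ?case unfolding z using Cons sum_least[OF W_submod] by simp
qed

text \<open>Goodness of each term lets one descend from \<open>(x\<^sub>1, \<dots>, x\<^sub>t)M\<close> to \<open>\<Sum> x\<^sub>j W(n - e\<^bsub>i\<^sub>j\<^esub>)\<close> one term at a time.\<close>

lemma goodseq_red_part:
  "goodseq zs N \<Longrightarrow> submodule N R M \<Longrightarrow>
    eventually (\<lambda>n. W n \<inter> addseq zs N \<subseteq> red_part zs n <+>\<^bsub>M\<^esub> N) (large d)"
proof (induction zs N rule: goodseq.induct)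
  case (1 N)
  have "N \<subseteq> {\<zero>\<^bsub>M\<^esub>} <+>\<^bsub>M\<^esub> N" by (rule sum_upper2[OF zero_submod 1(2)])
  then show ?case by (intro always_eventually) auto
next
  case (2 i x zs N)
  then have good: "good N i x" and gs: "goodseq zs (addx x N)" and N: "submodule N R M" by auto
  note x = goodD(3)[OF good]
  note si = goodseq_in[OF gs]
  have xN: "submodule (addx x N) R M" by (rule addx_submod[OF x N])
  show ?case
    using 2(1)[OF gs xN] good_FC1[OF N good] eventually_large_ge[of d 1]
  proof eventually_elim
    case (elim n)
    have rs: "submodule (red_part zs n) R M" by (rule red_part_submod[OF si])
    have xs: "submodule ((\<odot>\<^bsub>M\<^esub>) x ` W (dec i n)) R M" by (rule submod_image[OF x W_submod])
    show ?case
    proof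
      fix v assume "v \<in> W n \<inter> addseq ((i, x) # zs) N"
      then have v: "v \<in> W n" "v \<in> red_part zs n <+>\<^bsub>M\<^esub> addx x N" using elim(1) by auto
      obtain r y where ry: "r \<in> red_part zs n" "y \<in> addx x N" "v = r \<oplus>\<^bsub>M\<^esub> y" using v(2) by (auto simp only: mem_sum)
      \<comment> \<open>Only because \<open>r\<close> already lies in \<open>W n\<close> does the
        remainder \<open>y\<close> lie there too, and this is what (FC1) for \<open>x\<close>
        requires.\<close>
      have "r \<in> W n" using red_part_subset[OF si elim(3)] ry(1) by blast
      then have "y \<in> W n"
        using submod_add_cancel[OF W_submod _ submod_carr[OF xN ry(2)]] v(1) ry(3) by blast
      then have "y \<in> W n <+>\<^bsub>M\<^esub> N" using sum_upper1[OF W_submod N] by blast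
      then have y: "y \<in> (\<odot>\<^bsub>M\<^esub>) x ` W (dec i n) <+>\<^bsub>M\<^esub> N" using elim(2) ry(2) by blast
      have K: "submodule (((\<odot>\<^bsub>M\<^esub>) x ` W (dec i n) <+>\<^bsub>M\<^esub> red_part zs n) <+>\<^bsub>M\<^esub> N) R M"
        by (intro submod_sum xs rs N)
      have "(\<odot>\<^bsub>M\<^esub>) x ` W (dec i n) <+>\<^bsub>M\<^esub> N \<subseteq> ((\<odot>\<^bsub>M\<^esub>) x ` W (dec i n) <+>\<^bsub>M\<^esub> red_part zs n) <+>\<^bsub>M\<^esub> N"
        by (intro sum_mono sum_upper1 xs rs order_refl)
      moreover have "red_part zs n \<subseteq> ((\<odot>\<^bsub>M\<^esub>) x ` W (dec i n) <+>\<^bsub>M\<^esub> red_part zs n) <+>\<^bsub>M\<^esub> N"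
        by (rule order_trans[OF sum_upper2[OF xs rs] sum_upper1[OF submod_sum[OF xs rs] N]])
      ultimately show "v \<in> red_part ((i, x) # zs) n <+>\<^bsub>M\<^esub> N"
        unfolding ry(3) red_part.simps using ry(1) y submoduleE(5)[OF K] by blast
    qed
  qed
qed

lemma red_part_inc_stable:
  assumes j: "j \<le> d" "a \<in> F j"
  shows "seq_in zs \<Longrightarrow> u \<in> red_part zs n \<Longrightarrow> a \<odot>\<^bsub>M\<^esub> u \<in> red_part zs (inc j n)"
proof (induction zs arbitrary: u)
  case Nil
  then show ?case using F_carr[OF j] by simp
next
  case (Cons z zs)
  obtain i x where z: "z = (i, x)" by force
  have ix: "i \<le> d" "x \<in> F i" using Cons.prems(1) z by auto
  have xc: "x \<in> carrier R" and ac: "a \<in> carrier R" using F_carr ix j by blast+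
  obtain w v where wv: "w \<in> W (dec i n)" "v \<in> red_part zs n" "u = x \<odot>\<^bsub>M\<^esub> w \<oplus>\<^bsub>M\<^esub> v"
    using Cons.prems(2) unfolding z by (auto simp: mem_sum)
  have wc: "w \<in> carrier M" "v \<in> carrier M" using wv W_carr submod_carr[OF red_part_submod[of zs]] Cons.prems(1) by auto
  have "a \<odot>\<^bsub>M\<^esub> u = x \<odot>\<^bsub>M\<^esub> (a \<odot>\<^bsub>M\<^esub> w) \<oplus>\<^bsub>M\<^esub> a \<odot>\<^bsub>M\<^esub> v"
    using wv(3) wc ac xc by (simp add: smult_r_distr smult_comm[OF ac xc])
  moreover have "a \<odot>\<^bsub>M\<^esub> v \<in> red_part zs (inc j n)" by (rule Cons.IH[OF _ wv(2)]) (use Cons.prems(1) in simp)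
  moreover have "a \<odot>\<^bsub>M\<^esub> w \<in> W (dec i (inc j n))"
  proof -
    have "W (inc j (dec i n)) \<subseteq> W (dec i (inc j n))" by (rule W_antimono) (auto simp: dec_def)
    then show ?thesis using F_W[OF j wv(1)] by blast
  qed
  ultimately show ?case unfolding z red_part.simps by (auto intro!: sumI)
qed

lemma red_part_cong: "seq_in zs \<Longrightarrow> (\<And>i. i \<le> d \<Longrightarrow> n i = m i) \<Longrightarrow> red_part zs n = red_part zs m"
proof (induction zs)
  case (Cons z zs)
  obtain i x where z: "z = (i, x)" by force
  have "W (dec i n) = W (dec i m)" using Cons.prems(1) by (intro W_cong) (auto simp: z dec_def Cons.prems(2))
  then show ?case using Cons unfolding z by simp
qed simp

section \<open>Joint reductions force vanishing differences\<close>

text \<open>One inclusion is enough, since \<open>red_part_subset\<close> gives the other in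
  positive degrees. The submodule \<open>N\<close> is carried along because the exchange argument
  enlarges it.\<close>

definition joint_red :: "(nat \<times> 'a) list \<Rightarrow> 'c set \<Rightarrow> bool" where
  "joint_red zs N \<longleftrightarrow> eventually (\<lambda>n. W n \<subseteq> red_part zs n <+>\<^bsub>M\<^esub> N) (large d)"

text \<open>Multiplication by \<open>y\<close> is onto and multiplication by \<open>x\<close> is injective between the same two modules of
  finite length \<open>A/B\<close> and \<open>A'/B'\<close>, so \<open>x\<close> is onto as well.\<close>

lemma surjective_exchange:
  assumes A: "submodule A R M" and B: "submodule B R M" "B \<subseteq> A"
    and A': "submodule A' R M" and B': "submodule B' R M" "B' \<subseteq> A'"
    and x: "x \<in> carrier R" and y: "y \<in> carrier R"
    and xA: "\<And>u. u \<in> A \<Longrightarrow> x \<odot>\<^bsub>M\<^esub> u \<in> A'" and inj: "\<And>u. u \<in> A \<Longrightarrow> x \<odot>\<^bsub>M\<^esub> u \<in> B' \<Longrightarrow> u \<in> B"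
    and yB: "\<And>u. u \<in> B \<Longrightarrow> y \<odot>\<^bsub>M\<^esub> u \<in> B'" and surj: "A' \<subseteq> (\<odot>\<^bsub>M\<^esub>) y ` A <+>\<^bsub>M\<^esub> B'"
    and fin: "rel_length B A \<noteq> \<infinity>"
  shows "A' = (\<odot>\<^bsub>M\<^esub>) x ` A <+>\<^bsub>M\<^esub> B'"
proof -
  note xA_s = submod_image[OF x A]
  let ?K = "(\<odot>\<^bsub>M\<^esub>) x ` A <+>\<^bsub>M\<^esub> B'"
  have K: "submodule ?K R M" by (rule submod_sum[OF xA_s B'(1)])
  have B'K: "B' \<subseteq> ?K" by (rule sum_upper2[OF xA_s B'(1)])
  have "(\<odot>\<^bsub>M\<^esub>) x ` A \<subseteq> A'" using xA by blast
  then have KA': "?K \<subseteq> A'" using sum_least[OF A' _ B'(2)] by blast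
  \<comment> \<open>Preimages under \<open>y\<close> separate the submodules between
    \<open>B'\<close> and \<open>A'\<close>, because \<open>y\<close> is onto modulo
    \<open>B'\<close>.\<close>
  have le1: "rel_length B' A' \<le> rel_length B A"
  proof (rule rel_length_map[where f = "\<lambda>X. A \<inter> {u \<in> carrier M. y \<odot>\<^bsub>M\<^esub> u \<in> X}"])
    fix X assume X: "submodule X R M" "B' \<subseteq> X" "X \<subseteq> A'"
    show "submodule (A \<inter> {u \<in> carrier M. y \<odot>\<^bsub>M\<^esub> u \<in> X}) R M \<and> B \<subseteq> A \<inter> {u \<in> carrier M. y \<odot>\<^bsub>M\<^esub> u \<in> X} \<and>
        A \<inter> {u \<in> carrier M. y \<odot>\<^bsub>M\<^esub> u \<in> X} \<subseteq> A"
      using submod_Int[OF A submod_colon[OF y X(1)]] yB X(2) B(2) submod_carr[OF B(1)] by blast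
  next
    fix X Y assume X: "submodule X R M" "submodule Y R M" "B' \<subseteq> X" "X \<subset> Y" "Y \<subseteq> A'"
    obtain v where v: "v \<in> Y" "v \<notin> X" using X(4) by blast
    then have "v \<in> (\<odot>\<^bsub>M\<^esub>) y ` A <+>\<^bsub>M\<^esub> B'" using X(5) surj by blast
    then obtain u b where ub: "u \<in> A" "b \<in> B'" "v = y \<odot>\<^bsub>M\<^esub> u \<oplus>\<^bsub>M\<^esub> b" by (auto simp: mem_sum)
    have uc: "u \<in> carrier M" "y \<odot>\<^bsub>M\<^esub> u \<in> carrier M" using ub(1) submod_carr[OF A] y by auto
    have "y \<odot>\<^bsub>M\<^esub> u \<in> Y"
      using submod_add_cancel_iff(2)[OF X(2) _ uc(2), of b] ub v(1) X(3,4) by blast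
    moreover have "y \<odot>\<^bsub>M\<^esub> u \<notin> X" using v(2) ub submoduleE(5)[OF X(1)] X(3) by blast
    ultimately show "A \<inter> {u \<in> carrier M. y \<odot>\<^bsub>M\<^esub> u \<in> X} \<subset> A \<inter> {u \<in> carrier M. y \<odot>\<^bsub>M\<^esub> u \<in> Y}"
      using X(4) ub(1) uc by blast
  qed
  \<comment> \<open>Images under \<open>x\<close> separate the submodules between \<open>B\<close>
    and \<open>A\<close>, because \<open>x\<close> is injective modulo \<open>B\<close> and
    \<open>B'\<close>. Together with \<open>le1\<close> and finiteness no length remains between
    \<open>?K\<close> and \<open>A'\<close>.\<close>
  have le2: "rel_length B A \<le> rel_length B' ?K"
  proof (rule rel_length_map[where f = "\<lambda>X. (\<odot>\<^bsub>M\<^esub>) x ` X <+>\<^bsub>M\<^esub> B'"])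
    fix X assume X: "submodule X R M" "B \<subseteq> X" "X \<subseteq> A"
    show "submodule ((\<odot>\<^bsub>M\<^esub>) x ` X <+>\<^bsub>M\<^esub> B') R M \<and> B' \<subseteq> (\<odot>\<^bsub>M\<^esub>) x ` X <+>\<^bsub>M\<^esub> B' \<and>
        (\<odot>\<^bsub>M\<^esub>) x ` X <+>\<^bsub>M\<^esub> B' \<subseteq> ?K"
      using submod_sum[OF submod_image[OF x X(1)] B'(1)] sum_upper2[OF submod_image[OF x X(1)] B'(1)]
        sum_mono[OF image_mono[OF X(3)] order_refl] by blast
  next
    fix X Y assume X: "submodule X R M" "submodule Y R M" "B \<subseteq> X" "X \<subset> Y" "Y \<subseteq> A"
    obtain v where v: "v \<in> Y" "v \<notin> X" using X(4) by blast
    have vc: "v \<in> carrier M" by (rule submod_carr[OF X(2) v(1)])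
    have "x \<odot>\<^bsub>M\<^esub> v \<notin> (\<odot>\<^bsub>M\<^esub>) x ` X <+>\<^bsub>M\<^esub> B'"
    proof
      assume "x \<odot>\<^bsub>M\<^esub> v \<in> (\<odot>\<^bsub>M\<^esub>) x ` X <+>\<^bsub>M\<^esub> B'"
      then obtain w b where wb: "w \<in> X" "b \<in> B'" "x \<odot>\<^bsub>M\<^esub> v = x \<odot>\<^bsub>M\<^esub> w \<oplus>\<^bsub>M\<^esub> b" by (auto simp: mem_sum)
      have c: "w \<in> carrier M" "b \<in> carrier M" using wb submod_carr[OF X(1)] submod_carr[OF B'(1)] by auto
      have "x \<odot>\<^bsub>M\<^esub> (v \<ominus>\<^bsub>M\<^esub> w) = x \<odot>\<^bsub>M\<^esub> v \<ominus>\<^bsub>M\<^esub> x \<odot>\<^bsub>M\<^esub> w" by (rule smult_diff[OF x vc c(1)])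
      also have "\<dots> = b"
        unfolding wb(3) M.a_comm[OF smult_closed[OF x c(1)] c(2)] using c x by (simp add: M.minus_eq M.a_assoc M.r_neg)
      finally have "x \<odot>\<^bsub>M\<^esub> (v \<ominus>\<^bsub>M\<^esub> w) \<in> B'" using wb(2) by simp
      moreover have "v \<ominus>\<^bsub>M\<^esub> w \<in> A" using submod_diff[OF X(2)] v(1) wb(1) X(4,5) by blast
      ultimately have "v \<ominus>\<^bsub>M\<^esub> w \<in> X" using inj X(3) by blast
      then have "w \<oplus>\<^bsub>M\<^esub> (v \<ominus>\<^bsub>M\<^esub> w) \<in> X" using wb(1) submoduleE(5)[OF X(1)] by blast
      moreover have "w \<oplus>\<^bsub>M\<^esub> (v \<ominus>\<^bsub>M\<^esub> w) = v" using c vc by (simp add: M.minus_eq M.a_comm[of v] M.r_neg2)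
      ultimately show False using v(2) by simp
    qed
    moreover have "x \<odot>\<^bsub>M\<^esub> v \<in> (\<odot>\<^bsub>M\<^esub>) x ` Y <+>\<^bsub>M\<^esub> B'"
      using sum_upper1[OF submod_image[OF x X(2)] B'(1)] v(1) by blast
    moreover have "(\<odot>\<^bsub>M\<^esub>) x ` X <+>\<^bsub>M\<^esub> B' \<subseteq> (\<odot>\<^bsub>M\<^esub>) x ` Y <+>\<^bsub>M\<^esub> B'" using X(4) by (intro sum_mono) auto
    ultimately show "(\<odot>\<^bsub>M\<^esub>) x ` X <+>\<^bsub>M\<^esub> B' \<subset> (\<odot>\<^bsub>M\<^esub>) x ` Y <+>\<^bsub>M\<^esub> B'" by blast
  qed
  have add: "rel_length B' A' = rel_length B' ?K + rel_length ?K A'" by (rule rel_length_add[OF B'(1) K A' B'K KA'])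
  have "rel_length ?K A' = 0"
  proof -
    obtain a where a: "rel_length B A = enat a" using fin by (cases "rel_length B A") auto
    obtain a' where a': "rel_length B' A' = enat a'" using le1 a by (cases "rel_length B' A'") auto
    obtain b where b: "rel_length B' ?K = enat b" using add a' by (cases "rel_length B' ?K") auto
    obtain c where c: "rel_length ?K A' = enat c" using add a' by (cases "rel_length ?K A'") auto
    show ?thesis using add le1 le2 unfolding a a' b c by (simp add: zero_enat_def)
  qed
  then show ?thesis using rel_length_eq_0[OF K A' KA'] by simp
qed

text \<open>Once the first element \<open>y\<close> is exchanged for a good \<open>x\<close>, the
  remaining elements form a joint reduction modulo \<open>xM + N\<close>, whose Hilbert polynomial
  is \<open>difference i f\<close>. When no elements are left, \<open>W n\<close> lies in
  \<open>N\<close> and the Hilbert polynomial is zero.\<close>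

lemma joint_red_difference_zero:
  "seq_in zs \<Longrightarrow> submodule N R M \<Longrightarrow> joint_red zs N \<Longrightarrow> is_hilbert_poly f N \<Longrightarrow> fold difference (map fst zs) f = (\<lambda>_. 0)"
proof (induction zs arbitrary: N f)
  case Nil
  have "red_part [] n <+>\<^bsub>M\<^esub> N = N" for n
    using sum_absorb(2)[OF Nil.prems(2) zero_submod] submod_zero[OF Nil.prems(2)] by simp
  then have "is_hilbert_poly (\<lambda>_. 0) N" using Nil.prems(3) is_hilbert_poly_zero_iff[OF Nil.prems(2)] unfolding joint_red_def by simp
  then have "f = (\<lambda>_. 0)" by (rule is_hilbert_poly_unique[OF Nil.prems(4)])
  then show ?case by simp
next
  case (Cons z zs)
  obtain i y where z: "z = (i, y)" by force
  have i: "i \<le> d" and yF: "y \<in> F i" and si: "seq_in zs" using Cons.prems(1) z by auto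
  have yc: "y \<in> carrier R" by (rule F_carr[OF i yF])
  note N = Cons.prems(2)
  have rs: "submodule (red_part zs n) R M" for n by (rule red_part_submod[OF si])
  \<comment> \<open>The summand \<open>W (inc 0 n)\<close>, that is \<open>J W n\<close>, makes
    \<open>W n / K n\<close> a module of finite length. The good element \<open>x\<close> is chosen
    regular for \<open>K\<close> as well.\<close>
  define L where "L n = W (inc 0 n) <+>\<^bsub>M\<^esub> red_part zs n" for n
  have L: "submodule (L n) R M" for n unfolding L_def by (rule submod_sum[OF W_submod rs])
  define K where "K = (\<lambda>n. W n \<inter> (L n <+>\<^bsub>M\<^esub> N))"
  have Lst: "a \<odot>\<^bsub>M\<^esub> u \<in> L (inc j n)" if j: "j \<le> d" and a: "a \<in> F j" and u: "u \<in> L n" for j a u n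
  proof -
    obtain w v where wv: "w \<in> W (inc 0 n)" "v \<in> red_part zs n" "u = w \<oplus>\<^bsub>M\<^esub> v" using u unfolding L_def by (auto simp: mem_sum)
    have "a \<odot>\<^bsub>M\<^esub> u = a \<odot>\<^bsub>M\<^esub> w \<oplus>\<^bsub>M\<^esub> a \<odot>\<^bsub>M\<^esub> v"
      using wv W_carr submod_carr[OF rs] F_carr[OF j a] by (simp add: smult_r_distr)
    moreover have "inc j (inc 0 n) = inc 0 (inc j n)" by auto
    then have "a \<odot>\<^bsub>M\<^esub> w \<in> W (inc 0 (inc j n))" using F_W[OF j a wv(1)] by simp
    moreover have "a \<odot>\<^bsub>M\<^esub> v \<in> red_part zs (inc j n)" by (rule red_part_inc_stable[OF j a si wv(2)])
    ultimately show ?thesis unfolding L_def by (auto intro!: sumI)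
  qed
  have Kg: "K \<in> gfams"
    unfolding K_def
  proof (rule Int_sum_gfams[of N L, OF N L Lst])
    show "L n = L m" if e: "\<And>i. i \<le> d \<Longrightarrow> n i = m i" for n m
    proof -
      have "W (inc 0 n) = W (inc 0 m)" by (rule W_cong) (simp add: e)
      then show ?thesis unfolding L_def using red_part_cong[OF si e] by simp
    qed
  qed
  obtain x where x: "good N i x"
    and xK: "\<And>L. L \<in> {K} \<Longrightarrow> eventually (\<lambda>n. \<forall>u\<in>W n. x \<odot>\<^bsub>M\<^esub> u \<in> L (inc i n) \<longrightarrow> u \<in> L n) (large d)"
    using good_exists[OF N i, of "{K}"] Kg by auto
  note xc = goodD(3)[OF x] and xF = goodD(2)[OF x]
  have xN: "submodule (addx x N) R M" by (rule addx_submod[OF xc N])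
  have xM: "submodule ((\<odot>\<^bsub>M\<^esub>) x ` carrier M) R M" by (rule submod_image[OF xc carrier_is_submodule])
  have ev: "eventually (\<lambda>n. W (inc i n) \<subseteq> red_part zs (inc i n) <+>\<^bsub>M\<^esub> addx x N) (large d)"
    using xK[OF singletonI] eventually_large_inc[OF Cons.prems(3)[unfolded joint_red_def], of i] eventually_large_ge[of d 1]
  proof eventually_elim
    case (elim n)
    let ?n = "inc i n"
    note Ks = gfamsD(1)[OF Kg] and KW = gfamsD(2)[OF Kg]
    have "dec i ?n = n" by (rule inc_dec(2))
    then have WN: "W ?n \<subseteq> ((\<odot>\<^bsub>M\<^esub>) y ` W n <+>\<^bsub>M\<^esub> red_part zs ?n) <+>\<^bsub>M\<^esub> N" using elim(2) unfolding z by simp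
    have yW: "submodule ((\<odot>\<^bsub>M\<^esub>) y ` W n) R M" by (rule submod_image[OF yc W_submod])
    have eq: "W ?n = (\<odot>\<^bsub>M\<^esub>) x ` W n <+>\<^bsub>M\<^esub> K ?n"
    proof (rule surjective_exchange[OF W_submod Ks KW W_submod Ks KW xc yc])
      show "x \<odot>\<^bsub>M\<^esub> u \<in> W ?n" if "u \<in> W n" for u by (rule F_W[OF i xF that])
      show "u \<in> K n" if "u \<in> W n" "x \<odot>\<^bsub>M\<^esub> u \<in> K ?n" for u using elim(1) that by blast
      show "y \<odot>\<^bsub>M\<^esub> u \<in> K ?n" if "u \<in> K n" for u using gfamsD(3)[OF Kg, of i y u n, OF i yF that] .
      show "W ?n \<subseteq> (\<odot>\<^bsub>M\<^esub>) y ` W n <+>\<^bsub>M\<^esub> K ?n"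
      proof
        fix v assume v: "v \<in> W ?n"
        then have "v \<in> (\<odot>\<^bsub>M\<^esub>) y ` W n <+>\<^bsub>M\<^esub> (red_part zs ?n <+>\<^bsub>M\<^esub> N)" using WN sum_assoc[OF yW rs N] by blast
        then obtain u t where ut: "u \<in> W n" "t \<in> red_part zs ?n <+>\<^bsub>M\<^esub> N" "v = y \<odot>\<^bsub>M\<^esub> u \<oplus>\<^bsub>M\<^esub> t" by (auto simp only: mem_sum image_iff)
        have tc: "t \<in> carrier M" by (rule submod_carr[OF submod_sum[OF rs N] ut(2)])
        have "t \<in> W ?n" using submod_add_cancel[OF W_submod F_W[OF i yF ut(1)] tc] v ut(3) by simp
        moreover have "red_part zs ?n <+>\<^bsub>M\<^esub> N \<subseteq> L ?n <+>\<^bsub>M\<^esub> N"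
          unfolding L_def by (rule sum_mono[OF sum_upper2[OF W_submod rs] order_refl])
        ultimately have "t \<in> K ?n" unfolding K_def using ut(2) by blast
        then show "v \<in> (\<odot>\<^bsub>M\<^esub>) y ` W n <+>\<^bsub>M\<^esub> K ?n" unfolding ut(3) using ut(1) by (auto intro!: sumI)
      qed
      show "rel_length (K n) (W n) \<noteq> \<infinity>"
      proof (rule rel_length_finite[OF W_submod Ks KW])
        fix a v assume a: "a \<in> F 0" and v: "v \<in> W n"
        have "a \<odot>\<^bsub>M\<^esub> v \<in> W (inc 0 n)" by (rule F_W[OF _ a v]) simp
        moreover have "W (inc 0 n) \<subseteq> L n <+>\<^bsub>M\<^esub> N"
          unfolding L_def using sum_upper1[OF W_submod rs] sum_upper1[OF submod_sum[OF W_submod rs] N] by (rule order_trans)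
        ultimately show "a \<odot>\<^bsub>M\<^esub> v \<in> K n" unfolding K_def using W_inc_subset[of n 0] by blast
      qed
    qed
    \<comment> \<open>\<open>P\<close> is the submodule that should contain \<open>W ?n\<close>, and
      \<open>Q\<close> is their sum. The summand \<open>J W ?n\<close> of \<open>L\<close> lies in
      \<open>\<mm> Q\<close>, so \<open>Q\<close> is contained in \<open>P + \<mm> Q\<close> and
      Nakayama's lemma applies.\<close>
    define P where "P = red_part zs ?n <+>\<^bsub>M\<^esub> addx x N"
    have P: "submodule P R M" unfolding P_def by (rule submod_sum[OF rs xN])
    have NP: "N \<subseteq> P" unfolding P_def using sum_upper2[OF xM N] sum_upper2[OF rs xN] by blast
    have xP: "(\<odot>\<^bsub>M\<^esub>) x ` W n \<subseteq> P"
      unfolding P_def using W_carr sum_upper1[OF xM N] sum_upper2[OF rs xN] by blast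
    have rP: "red_part zs ?n \<subseteq> P" unfolding P_def by (rule sum_upper1[OF rs xN])
    define Q where "Q = W ?n <+>\<^bsub>M\<^esub> P"
    have Q: "submodule Q R M" unfolding Q_def by (rule submod_sum[OF W_submod P])
    have PQ: "P \<subseteq> Q" unfolding Q_def by (rule sum_upper2[OF W_submod P])
    have mc: "\<mm> \<subseteq> carrier R" using ideal_carr[OF \<mm>_ideal] by blast
    have Qc: "Q \<subseteq> carrier M" using submod_carr[OF Q] by blast
    have mQ: "submodule (ideal_smult R M \<mm> Q) R M" by (rule ideal_smult_submod[OF mc Qc])
    have PmQ: "submodule (P <+>\<^bsub>M\<^esub> ideal_smult R M \<mm> Q) R M" by (rule submod_sum[OF P mQ])
    have "W (inc 0 ?n) \<subseteq> ideal_smult R M \<mm> Q"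
      unfolding W_inc[OF le0] unfolding Q_def
      by (rule ideal_smult_mono[OF mc Qc[unfolded Q_def] F0_subset_\<mm> sum_upper1[OF W_submod P]])
    then have W0: "W (inc 0 ?n) \<subseteq> P <+>\<^bsub>M\<^esub> ideal_smult R M \<mm> Q" using sum_upper2[OF P mQ] by blast
    have PP: "P \<subseteq> P <+>\<^bsub>M\<^esub> ideal_smult R M \<mm> Q" by (rule sum_upper1[OF P mQ])
    have "L ?n \<subseteq> P <+>\<^bsub>M\<^esub> ideal_smult R M \<mm> Q" unfolding L_def
      by (rule sum_least[OF PmQ W0 order_trans[OF rP PP]])
    then have "L ?n <+>\<^bsub>M\<^esub> N \<subseteq> P <+>\<^bsub>M\<^esub> ideal_smult R M \<mm> Q"
      by (rule sum_least[OF PmQ _ order_trans[OF NP PP]])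
    then have "K ?n \<subseteq> P <+>\<^bsub>M\<^esub> ideal_smult R M \<mm> Q" unfolding K_def by blast
    then have "W ?n \<subseteq> P <+>\<^bsub>M\<^esub> ideal_smult R M \<mm> Q"
      unfolding eq by (rule sum_least[OF PmQ order_trans[OF xP PP]])
    then have "Q \<subseteq> P <+>\<^bsub>M\<^esub> ideal_smult R M \<mm> Q" unfolding Q_def[symmetric] by (subst Q_def) (rule sum_least[OF PmQ _ PP])
    then have "Q = P" by (rule nakayama[OF P Q PQ])
    then show ?case unfolding P_def Q_def using sum_upper1[OF W_submod P[unfolded P_def]] by blast
  qed
  have "joint_red zs (addx x N)"
    unfolding joint_red_def
    using eventually_large_dec[OF ev, of i] eventually_large_ge[of d 1]
  proof eventually_elim
    case (elim n)
    have "1 \<le> n i" using elim(2) i by blast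
    then have "inc i (dec i n) = n" by (rule inc_dec(1))
    then show ?case using elim(1) by simp
  qed
  then have "fold difference (map fst zs) (difference i f) = (\<lambda>_. 0)"
    using Cons.IH[OF si xN] is_hilbert_poly_addx[OF N x Cons.prems(4)] by blast
  then show ?case unfolding z by simp
qed

section \<open>Independence of the first variable\<close>

text \<open>Dividing by the factor \<open>J\<close> one power at a time adds the same value
  \<open>h\<close> in each of \<open>a\<close> steps.\<close>

lemma rel_length_power:
  assumes N: "submodule N R M" and c: "\<And>a. hilbert_nat N (n(0 := n 0 + a)) = h"
  shows "rel_length (W (n(0 := n 0 + a)) <+>\<^bsub>M\<^esub> N) (W n <+>\<^bsub>M\<^esub> N) = enat (a * h)"
proof (induction a)
  case 0
  then show ?case using rel_length_self[OF WN_submod[OF N]] by (simp add: zero_enat_def)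
next
  case (Suc a)
  let ?m = "n(0 := n 0 + a)"
  have e: "n(0 := n 0 + Suc a) = inc 0 ?m" by auto
  have "W ?m \<subseteq> W n" by (rule W_antimono) simp
  then have "W ?m <+>\<^bsub>M\<^esub> N \<subseteq> W n <+>\<^bsub>M\<^esub> N" by (rule sum_mono) simp
  then have "rel_length (W (inc 0 ?m) <+>\<^bsub>M\<^esub> N) (W n <+>\<^bsub>M\<^esub> N) = hilbert_fun N ?m + rel_length (W ?m <+>\<^bsub>M\<^esub> N) (W n <+>\<^bsub>M\<^esub> N)"
    unfolding hilbert_fun_def by (rule rel_length_add[OF WN_submod[OF N] WN_submod[OF N] WN_submod[OF N] WN_inc])
  also have "\<dots> = enat (Suc a * h)" unfolding Suc.IH hilbert_nat[OF N] c by simp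
  finally show ?case unfolding e .
qed

text \<open>Both \<open>W n\<close> and its submodule \<open>W (n + e\<^sub>j)\<close> have length growing linearly modulo \<open>J\<^sup>a\<close>;
  by Artin--Rees the slope for the submodule is at most the slope for \<open>W n\<close>.\<close>

lemma hilbert_nat_inc_le:
  assumes N: "submodule N R M" and j: "j \<le> d"
    and c1: "\<And>a. hilbert_nat N (n(0 := n 0 + a)) = h" and c2: "\<And>a. hilbert_nat N ((inc j n)(0 := inc j n 0 + a)) = h'"
  shows "h' \<le> h"
proof -
  let ?p = "inc j n"
  define Y where "Y = W ?p <+>\<^bsub>M\<^esub> N"
  have Y: "submodule Y R M" unfolding Y_def by (rule WN_submod[OF N])
  obtain c where c: "\<And>m. W m \<inter> Y \<subseteq> ideal_smult R M (\<F> (\<lambda>i. m i - min (m i) c)) (W (\<lambda>i. min (m i) c) \<inter> Y)"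
    using artin_rees[OF Int_gfams[OF Y]] by blast
  \<comment> \<open>With the Artin--Rees constant \<open>c\<close>, the submodule \<open>Y\<close>
    modulo \<open>b\<close> powers of \<open>J\<close> is controlled by \<open>W n\<close> modulo
    \<open>b + c\<close> powers.\<close>
  have bound: "b * h' \<le> (b + c) * h" for b
  proof -
    let ?m = "n(0 := n 0 + (b + c))"
    define X where "X = W ?m <+>\<^bsub>M\<^esub> N"
    have X: "submodule X R M" unfolding X_def by (rule WN_submod[OF N])
    define Z where "Z = W (?p(0 := ?p 0 + b)) <+>\<^bsub>M\<^esub> N"
    have Z: "submodule Z R M" unfolding Z_def by (rule WN_submod[OF N])
    have NZ: "N \<subseteq> Z" unfolding Z_def by (rule sum_upper2[OF W_submod N])
    have "W (?p(0 := ?p 0 + b)) \<subseteq> W ?p" by (rule W_antimono) simp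
    then have ZY: "Z \<subseteq> Y" unfolding Z_def Y_def by (rule sum_mono) simp
    have W_Z: "W ?m \<inter> Y \<subseteq> Z"
    proof -
      \<comment> \<open>In coordinate \<open>0\<close> this exponent is \<open>n 0 + b\<close>,
        since \<open>?m 0\<close> is at least \<open>c\<close>; so it supplies the \<open>b\<close>
        factors \<open>J\<close> that \<open>Z\<close> asks for.\<close>
      let ?q = "\<lambda>i. ?m i - min (?m i) c"
      have "ideal_smult R M (\<F> ?q) (W (\<lambda>i. min (?m i) c) \<inter> Y) \<subseteq> Z"
      proof (rule ideal_smult_least[OF Z])
        fix f v assume f: "f \<in> \<F> ?q" and "v \<in> W (\<lambda>i. min (?m i) c) \<inter> Y"
        then have v: "v \<in> Y" by blast
        have "f \<odot>\<^bsub>M\<^esub> v \<in> W (?p [+] ?q) <+>\<^bsub>M\<^esub> N"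
          by (rule smult_sum_mem[OF multi_power_carr[OF f] N W_submod v[unfolded Y_def]]) (rule multi_power_W[OF f])
        moreover have "W (?p [+] ?q) \<subseteq> W (?p(0 := ?p 0 + b))" by (rule W_antimono) auto
        then have "W (?p [+] ?q) <+>\<^bsub>M\<^esub> N \<subseteq> Z" unfolding Z_def by (rule sum_mono) simp
        ultimately show "f \<odot>\<^bsub>M\<^esub> v \<in> Z" by blast
      qed
      then show ?thesis using c[of ?m] by blast
    qed
    have XY: "X \<inter> Y \<subseteq> Z"
    proof
      fix v assume v: "v \<in> X \<inter> Y"
      then have "v \<in> W ?m <+>\<^bsub>M\<^esub> N" unfolding X_def by blast
      then obtain w y where wy: "w \<in> W ?m" "y \<in> N" "v = y \<oplus>\<^bsub>M\<^esub> w" by (rule sumE_swapped[OF _ W_submod N])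
      have "y \<in> Y" using wy(2) NZ ZY by blast
      then have "w \<in> Y" using submod_add_cancel[OF Y _ W_carr[OF wy(1)]] v wy(3) by blast
      then have "w \<in> Z" using W_Z wy(1) by blast
      then show "v \<in> Z" unfolding wy(3) using wy(2) NZ submoduleE(5)[OF Z] by blast
    qed
    have "enat (b * h') = rel_length Z Y" unfolding Z_def Y_def by (rule rel_length_power[OF N c2, symmetric])
    also have "\<dots> \<le> rel_length (X \<inter> Y) Z + rel_length Z Y" by simp
    also have "\<dots> = rel_length (X \<inter> Y) Y" by (rule rel_length_add[OF submod_Int[OF X Y] Z Y XY ZY, symmetric])
    also have "\<dots> = rel_length X (Y <+>\<^bsub>M\<^esub> X)" using rel_length_diamond[OF Y X] by (simp add: Int_commute)
    also have "\<dots> \<le> rel_length X (W n <+>\<^bsub>M\<^esub> N)"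
    proof (rule rel_length_mono)
      have "W ?m \<subseteq> W n" by (rule W_antimono) simp
      then have "X \<subseteq> W n <+>\<^bsub>M\<^esub> N" unfolding X_def by (rule sum_mono) simp
      moreover have "Y \<subseteq> W n <+>\<^bsub>M\<^esub> N" unfolding Y_def by (rule WN_inc)
      ultimately show "Y <+>\<^bsub>M\<^esub> X \<subseteq> W n <+>\<^bsub>M\<^esub> N" by (intro sum_least[OF WN_submod[OF N]])
    qed
    also have "\<dots> = enat ((b + c) * h)" unfolding X_def by (rule rel_length_power[OF N c1])
    finally show ?thesis by simp
  qed
  show "h' \<le> h"
  proof (rule ccontr)
    assume "\<not> h' \<le> h"
    \<comment> \<open>The value \<open>b = c * h + 1\<close> is large enough: with \<open>h'\<close>
      at least \<open>h + 1\<close> the bound reduces to \<open>c * h + 1 <= c * h\<close>.\<close>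
    then have "(c * h + 1) * (h + 1) \<le> (c * h + 1) * h'" by (intro mult_le_mono2) simp
    also have "\<dots> \<le> (c * h + 1 + c) * h" by (rule bound)
    finally show False by (simp add: algebra_simps)
  qed
qed

lemma is_hilbert_poly_constant:
  assumes N: "submodule N R M" and f: "is_hilbert_poly f N" and D: "difference 0 f = (\<lambda>_. 0)"
  shows "f n = f (\<lambda>_. 0)"
proof (rule polynomial_fun_constant)
  show pf: "polynomial_fun d f" using f unfolding is_hilbert_poly_def by blast
  obtain e where e: "\<And>n. \<forall>i\<le>d. e \<le> n i \<Longrightarrow> f (\<lambda>i. int (n i)) = rat_of_nat (hilbert_nat N n)"
    using f unfolding is_hilbert_poly_def eventually_large by blast
  have f0: "f (m(0 := m 0 + int a)) = f m" for m a
  proof (induction a)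
    case (Suc a)
    have "difference 0 f (m(0 := m 0 + int (Suc a))) = 0" using D by simp
    moreover have "(m(0 := m 0 + int (Suc a)))(0 := (m(0 := m 0 + int (Suc a))) 0 - 1) = m(0 := m 0 + int a)" by auto
    ultimately show ?case using Suc unfolding difference_def by (simp only: diff_eq_eq add_0)
  qed simp
  have shift: "hilbert_nat N (n(0 := n 0 + a)) = hilbert_nat N n" if n: "\<forall>i\<le>d. e \<le> n i" for n a
  proof -
    have "\<forall>i\<le>d. e \<le> (n(0 := n 0 + a)) i" using n by auto
    moreover have "(\<lambda>i. int ((n(0 := n 0 + a)) i)) = (\<lambda>i. int (n i))(0 := int (n 0) + int a)" by auto
    ultimately show ?thesis using e[of "n(0 := n 0 + a)"] e[OF n] f0[of "\<lambda>i. int (n i)" a] by simp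
  qed
  fix j assume j: "j \<le> d"
  obtain x where x: "good N j x" using good_element_exists[OF N j] by blast
  have "eventually (\<lambda>n. difference j f (\<lambda>i. int (n i)) = 0) (large d)"
    using hilbert_nat_addx[OF N x] eventually_large_ge[of d "e + 1"]
  proof eventually_elim
    case (elim n)
    let ?m = "dec j n"
    have m: "\<forall>i\<le>d. e \<le> ?m i" using elim(2) by (auto simp: dec_def)
    have n: "\<forall>i\<le>d. e \<le> n i" using elim(2) by auto
    have "1 \<le> n j" using elim(2) j by auto
    then have nm: "inc j ?m = n" by (rule inc_dec(1))
    have "hilbert_nat N n \<le> hilbert_nat N ?m"
    proof (rule hilbert_nat_inc_le[OF N j])
      show "hilbert_nat N (?m(0 := ?m 0 + a)) = hilbert_nat N ?m" for a by (rule shift[OF m])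
      show "hilbert_nat N ((inc j ?m)(0 := inc j ?m 0 + a)) = hilbert_nat N n" for a unfolding nm by (rule shift[OF n])
    qed
    \<comment> \<open>The opposite inequality comes from \<open>elim(1)\<close>: the difference in
      direction \<open>j\<close> is a value of the Hilbert function of \<open>M/(xM + N)\<close>,
      hence not negative.\<close>
    then have "hilbert_nat N n = hilbert_nat N ?m" using elim(1) by simp
    then have "f (\<lambda>i. int (n i)) = f (\<lambda>i. int (?m i))" using e[OF n] e[OF m] by simp
    then show ?case unfolding difference_def int_dec[of n j, OF \<open>1 \<le> n j\<close>] by simp
  qed
  then show "difference j f = (\<lambda>_. 0)" by (rule polynomial_fun_eq_zero[OF polynomial_fun_difference[OF pf j]])
qed

end

section \<open>Quotient modules\<close>

context module
begin

lemma submoduleI_smult: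
  assumes "H \<subseteq> carrier M" "\<zero>\<^bsub>M\<^esub> \<in> H" "\<And>a b. a \<in> H \<Longrightarrow> b \<in> H \<Longrightarrow> a \<oplus>\<^bsub>M\<^esub> b \<in> H"
    and smult: "\<And>a x. a \<in> carrier R \<Longrightarrow> x \<in> H \<Longrightarrow> a \<odot>\<^bsub>M\<^esub> x \<in> H"
  shows "submodule H R M"
proof (rule submoduleI)
  fix a assume a: "a \<in> H"
  then have "(\<ominus> \<one>) \<odot>\<^bsub>M\<^esub> a = \<ominus>\<^bsub>M\<^esub> a" using assms(1) by (subst smult_l_minus) auto
  then show "\<ominus>\<^bsub>M\<^esub> a \<in> H" using smult[of "\<ominus> \<one>" a] a by simp
qed (use assms in auto)

lemma submodule_carrier_update:
  assumes H: "submodule H R M"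
  shows "submodule K R (M\<lparr>carrier := H\<rparr>) \<longleftrightarrow> submodule K R M \<and> K \<subseteq> H"
proof -
  interpret H: module R "M\<lparr>carrier := H\<rparr>" by (rule submodule.submodule_is_module[OF H module_axioms])
  show ?thesis
  proof
    assume K: "submodule K R (M\<lparr>carrier := H\<rparr>)"
    have KH: "K \<subseteq> H" using H.submod_carr[OF K] by auto
    moreover have "submodule K R M"
      using H.submod_zero[OF K] H.submoduleE(4,5)[OF K] KH submod_carr[OF H] by (intro submoduleI_smult) auto
    ultimately show "submodule K R M \<and> K \<subseteq> H" by blast
  next
    assume K: "submodule K R M \<and> K \<subseteq> H"
    then show "submodule K R (M\<lparr>carrier := H\<rparr>)"
      using submod_zero submoduleE(4,5) by (intro H.submoduleI_smult) auto
  qed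
qed

end

locale module_quotient = module R M for R (structure) and M (structure) +
  fixes N :: "'c set"
  assumes N: "submodule N R M"
begin

abbreviation "Q \<equiv> quot_module M N"
abbreviation \<pi> :: "'c \<Rightarrow> 'c set" where "\<pi> v \<equiv> N +>\<^bsub>M\<^esub> v"

lemma \<pi>_def: "\<pi> v = {n \<oplus>\<^bsub>M\<^esub> v | n. n \<in> N}"
  unfolding a_r_coset_def' by auto

lemma \<pi>_self: "v \<in> carrier M \<Longrightarrow> v \<in> \<pi> v"
  unfolding \<pi>_def using submod_zero[OF N] by (auto intro!: exI[of _ "\<zero>\<^bsub>M\<^esub>"])

lemma \<pi>_eq_iff:
  assumes v: "v \<in> carrier M" and w: "w \<in> carrier M"
  shows "\<pi> v = \<pi> w \<longleftrightarrow> (\<exists>n\<in>N. v = n \<oplus>\<^bsub>M\<^esub> w)"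
proof
  assume "\<pi> v = \<pi> w"
  then show "\<exists>n\<in>N. v = n \<oplus>\<^bsub>M\<^esub> w" using \<pi>_self[OF v] unfolding \<pi>_def by auto
next
  assume "\<exists>n\<in>N. v = n \<oplus>\<^bsub>M\<^esub> w"
  then obtain n where n: "n \<in> N" "v = n \<oplus>\<^bsub>M\<^esub> w" by blast
  have nc: "n \<in> carrier M" by (rule submod_carr[OF N n(1)])
  show "\<pi> v = \<pi> w"
  proof
    show "\<pi> v \<subseteq> \<pi> w"
    proof
      fix y assume "y \<in> \<pi> v"
      then obtain m where m: "m \<in> N" "y = m \<oplus>\<^bsub>M\<^esub> v" unfolding \<pi>_def by blast
      then have "y = (m \<oplus>\<^bsub>M\<^esub> n) \<oplus>\<^bsub>M\<^esub> w" using n nc w submod_carr[OF N m(1)] by (simp add: M.a_assoc)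
      then show "y \<in> \<pi> w" unfolding \<pi>_def using submoduleE(5)[OF N m(1) n(1)] by blast
    qed
    show "\<pi> w \<subseteq> \<pi> v"
    proof
      fix y assume "y \<in> \<pi> w"
      then obtain m where m: "m \<in> N" "y = m \<oplus>\<^bsub>M\<^esub> w" unfolding \<pi>_def by blast
      then have "y = (m \<oplus>\<^bsub>M\<^esub> \<ominus>\<^bsub>M\<^esub> n) \<oplus>\<^bsub>M\<^esub> v" using n nc w submod_carr[OF N m(1)] by (simp add: M.a_assoc M.r_neg1)
      then show "y \<in> \<pi> v" unfolding \<pi>_def using submoduleE(5)[OF N m(1) submoduleE(3)[OF N n(1)]] by blast
    qed
  qed
qed

lemma \<pi>_eq_N: "v \<in> carrier M \<Longrightarrow> \<pi> v = N \<longleftrightarrow> v \<in> N"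
proof -
  assume v: "v \<in> carrier M"
  have "\<pi> \<zero>\<^bsub>M\<^esub> = N" unfolding \<pi>_def using submod_carr[OF N] by auto (metis M.r_zero)
  then have "\<pi> v = N \<longleftrightarrow> \<pi> v = \<pi> \<zero>\<^bsub>M\<^esub>" by simp
  also have "\<dots> \<longleftrightarrow> v \<in> N" unfolding \<pi>_eq_iff[OF v M.zero_closed] using submod_carr[OF N] by auto
  finally show ?thesis .
qed

lemma Q_carrier: "carrier Q = \<pi> ` carrier M"
  unfolding quot_module_def A_RCOSETS_def' by auto

lemma Q_zero: "\<zero>\<^bsub>Q\<^esub> = N" "\<zero>\<^bsub>Q\<^esub> = \<pi> \<zero>\<^bsub>M\<^esub>"
proof -
  show "\<zero>\<^bsub>Q\<^esub> = N" by (simp add: quot_module_def)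
  then show "\<zero>\<^bsub>Q\<^esub> = \<pi> \<zero>\<^bsub>M\<^esub>" using \<pi>_eq_N[of "\<zero>\<^bsub>M\<^esub>"] submod_zero[OF N] by simp
qed

lemma Q_add:
  assumes v: "v \<in> carrier M" and w: "w \<in> carrier M"
  shows "\<pi> v \<oplus>\<^bsub>Q\<^esub> \<pi> w = \<pi> (v \<oplus>\<^bsub>M\<^esub> w)"
proof -
  have "\<pi> v <+>\<^bsub>M\<^esub> \<pi> w = \<pi> (v \<oplus>\<^bsub>M\<^esub> w)"
  proof
    show "\<pi> v <+>\<^bsub>M\<^esub> \<pi> w \<subseteq> \<pi> (v \<oplus>\<^bsub>M\<^esub> w)"
    proof
      fix y assume "y \<in> \<pi> v <+>\<^bsub>M\<^esub> \<pi> w"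
      then obtain n m where nm: "n \<in> N" "m \<in> N" "y = (n \<oplus>\<^bsub>M\<^esub> v) \<oplus>\<^bsub>M\<^esub> (m \<oplus>\<^bsub>M\<^esub> w)" unfolding mem_sum \<pi>_def by blast
      then have "y = (n \<oplus>\<^bsub>M\<^esub> m) \<oplus>\<^bsub>M\<^esub> (v \<oplus>\<^bsub>M\<^esub> w)"
        using v w submod_carr[OF N nm(1)] submod_carr[OF N nm(2)] by (simp add: M.add.m_assoc M.add.m_lcomm)
      then show "y \<in> \<pi> (v \<oplus>\<^bsub>M\<^esub> w)" unfolding \<pi>_def using submoduleE(5)[OF N nm(1,2)] by blast
    qed
    show "\<pi> (v \<oplus>\<^bsub>M\<^esub> w) \<subseteq> \<pi> v <+>\<^bsub>M\<^esub> \<pi> w"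
    proof
      fix y assume "y \<in> \<pi> (v \<oplus>\<^bsub>M\<^esub> w)"
      then obtain n where n: "n \<in> N" "y = n \<oplus>\<^bsub>M\<^esub> (v \<oplus>\<^bsub>M\<^esub> w)" unfolding \<pi>_def by blast
      then have "y = (n \<oplus>\<^bsub>M\<^esub> v) \<oplus>\<^bsub>M\<^esub> w" using v w submod_carr[OF N n(1)] by (simp add: M.a_assoc)
      then show "y \<in> \<pi> v <+>\<^bsub>M\<^esub> \<pi> w"
        using n(1) \<pi>_self[OF w] by (auto simp: \<pi>_def[of v] intro!: sumI)
    qed
  qed
  then show ?thesis by (simp add: quot_module_def)
qed

text \<open>The union in \<open>quot_module\<close> runs over the representatives of one coset, and
  all of them contribute the same coset.\<close>

lemma Q_smult:
  assumes a: "a \<in> carrier R" and v: "v \<in> carrier M"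
  shows "a \<odot>\<^bsub>Q\<^esub> \<pi> v = \<pi> (a \<odot>\<^bsub>M\<^esub> v)"
proof -
  have "\<pi> (a \<odot>\<^bsub>M\<^esub> w) = \<pi> (a \<odot>\<^bsub>M\<^esub> v)" if w: "w \<in> \<pi> v" for w
  proof -
    obtain n where n: "n \<in> N" "w = n \<oplus>\<^bsub>M\<^esub> v" using w unfolding \<pi>_def by blast
    have nc: "n \<in> carrier M" by (rule submod_carr[OF N n(1)])
    have "a \<odot>\<^bsub>M\<^esub> w = a \<odot>\<^bsub>M\<^esub> n \<oplus>\<^bsub>M\<^esub> a \<odot>\<^bsub>M\<^esub> v" using n(2) nc a v by (simp add: smult_r_distr)
    then show ?thesis
      using submoduleE(4)[OF N a n(1)] a v nc n(2) by (subst \<pi>_eq_iff) auto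
  qed
  then have "(\<Union>w\<in>\<pi> v. \<pi> (a \<odot>\<^bsub>M\<^esub> w)) = (\<Union>w\<in>\<pi> v. \<pi> (a \<odot>\<^bsub>M\<^esub> v))" by (intro SUP_cong refl)
  also have "\<dots> = \<pi> (a \<odot>\<^bsub>M\<^esub> v)" using \<pi>_self[OF v] by blast
  finally show ?thesis by (simp add: quot_module_def)
qed

lemma Q_module: "module R Q"
proof (rule moduleI)
  show "cring R" by (rule R.is_cring)
  show "abelian_group Q"
  proof (rule abelian_groupI)
    show "x \<oplus>\<^bsub>Q\<^esub> y \<in> carrier Q" if "x \<in> carrier Q" "y \<in> carrier Q" for x y
      using that unfolding Q_carrier by (auto simp: Q_add)
    show "\<zero>\<^bsub>Q\<^esub> \<in> carrier Q" unfolding Q_carrier Q_zero(2) by blast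
    show "(x \<oplus>\<^bsub>Q\<^esub> y) \<oplus>\<^bsub>Q\<^esub> z = x \<oplus>\<^bsub>Q\<^esub> (y \<oplus>\<^bsub>Q\<^esub> z)" if "x \<in> carrier Q" "y \<in> carrier Q" "z \<in> carrier Q" for x y z
      using that unfolding Q_carrier by (auto simp: Q_add M.a_assoc)
    show "x \<oplus>\<^bsub>Q\<^esub> y = y \<oplus>\<^bsub>Q\<^esub> x" if "x \<in> carrier Q" "y \<in> carrier Q" for x y
      using that unfolding Q_carrier by (auto simp: Q_add M.a_comm)
    show "\<zero>\<^bsub>Q\<^esub> \<oplus>\<^bsub>Q\<^esub> x = x" if "x \<in> carrier Q" for x
      using that unfolding Q_carrier Q_zero(2) by (auto simp: Q_add)
    show "\<exists>y\<in>carrier Q. y \<oplus>\<^bsub>Q\<^esub> x = \<zero>\<^bsub>Q\<^esub>" if x: "x \<in> carrier Q" for x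
    proof -
      obtain v where v: "v \<in> carrier M" "x = \<pi> v" using x unfolding Q_carrier by blast
      then have "\<pi> (\<ominus>\<^bsub>M\<^esub> v) \<oplus>\<^bsub>Q\<^esub> x = \<zero>\<^bsub>Q\<^esub>" unfolding Q_zero(2) by (simp add: Q_add M.l_neg)
      then show ?thesis using v unfolding Q_carrier by blast
    qed
  qed
qed (auto simp: Q_carrier Q_smult Q_add smult_l_distr smult_r_distr smult_assoc1)

lemma submod_\<pi>_image:
  assumes H: "submodule H R M"
  shows "submodule (\<pi> ` H) R Q"
proof -
  interpret Q: module R Q by (rule Q_module)
  have c: "v \<in> carrier M" if "v \<in> H" for v by (rule submod_carr[OF H that])
  show ?thesis
  proof (rule Q.submoduleI_smult)
    show "\<pi> ` H \<subseteq> carrier Q" unfolding Q_carrier using c by blast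
    show "\<zero>\<^bsub>Q\<^esub> \<in> \<pi> ` H" unfolding Q_zero(2) using submod_zero[OF H] by blast
    show "x \<oplus>\<^bsub>Q\<^esub> y \<in> \<pi> ` H" if "x \<in> \<pi> ` H" "y \<in> \<pi> ` H" for x y
      using that c submoduleE(5)[OF H] by (auto simp: Q_add)
    show "a \<odot>\<^bsub>Q\<^esub> x \<in> \<pi> ` H" if "a \<in> carrier R" "x \<in> \<pi> ` H" for a x
      using that c submoduleE(4)[OF H] by (auto simp: Q_smult)
  qed
qed

lemma submod_\<pi>_preimage:
  assumes X: "submodule X R Q"
  shows "submodule {v \<in> carrier M. \<pi> v \<in> X} R M"
proof -
  interpret Q: module R Q by (rule Q_module)
  show ?thesis
    using Q.submod_zero[OF X] Q.submoduleE(4,5)[OF X]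
    by (intro submoduleI_smult) (auto simp: Q_zero(2) Q_add[symmetric] Q_smult[symmetric])
qed

lemma gen_submodule_\<pi>:
  assumes S: "S \<subseteq> carrier M"
  shows "gen_submodule R Q (\<pi> ` S) = \<pi> ` gen_submodule R M S"
proof -
  interpret Q: module R Q by (rule Q_module)
  show ?thesis
  proof
    show "gen_submodule R Q (\<pi> ` S) \<subseteq> \<pi> ` gen_submodule R M S"
      by (intro Q.gen_submodule_least submod_\<pi>_image gen_submodule_submod S image_mono gen_submodule_upper)
    have "\<pi> ` S \<subseteq> carrier Q" unfolding Q_carrier using S by blast
    then have X: "submodule (gen_submodule R Q (\<pi> ` S)) R Q" by (rule Q.gen_submodule_submod)
    have "S \<subseteq> {v \<in> carrier M. \<pi> v \<in> gen_submodule R Q (\<pi> ` S)}"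
      using S Q.gen_submodule_upper[of "\<pi> ` S"] by blast
    from gen_submodule_least[OF submod_\<pi>_preimage[OF X] this]
    show "\<pi> ` gen_submodule R M S \<subseteq> gen_submodule R Q (\<pi> ` S)" by blast
  qed
qed

lemma ideal_smult_\<pi>:
  assumes a: "\<aa> \<subseteq> carrier R" and H: "H \<subseteq> carrier M"
  shows "ideal_smult R Q \<aa> (\<pi> ` H) = \<pi> ` ideal_smult R M \<aa> H"
proof -
  have "{a \<odot>\<^bsub>Q\<^esub> V | a V. a \<in> \<aa> \<and> V \<in> \<pi> ` H} = \<pi> ` {a \<odot>\<^bsub>M\<^esub> v | a v. a \<in> \<aa> \<and> v \<in> H}"
  proof
    show "{a \<odot>\<^bsub>Q\<^esub> V | a V. a \<in> \<aa> \<and> V \<in> \<pi> ` H} \<subseteq> \<pi> ` {a \<odot>\<^bsub>M\<^esub> v | a v. a \<in> \<aa> \<and> v \<in> H}"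
    proof
      fix y assume "y \<in> {a \<odot>\<^bsub>Q\<^esub> V | a V. a \<in> \<aa> \<and> V \<in> \<pi> ` H}"
      then obtain b v where bv: "b \<in> \<aa>" "v \<in> H" "y = b \<odot>\<^bsub>Q\<^esub> \<pi> v" by blast
      then have "y = \<pi> (b \<odot>\<^bsub>M\<^esub> v)" using a H Q_smult[of b v] by auto
      then show "y \<in> \<pi> ` {a \<odot>\<^bsub>M\<^esub> v | a v. a \<in> \<aa> \<and> v \<in> H}" using bv by blast
    qed
    show "\<pi> ` {a \<odot>\<^bsub>M\<^esub> v | a v. a \<in> \<aa> \<and> v \<in> H} \<subseteq> {a \<odot>\<^bsub>Q\<^esub> V | a V. a \<in> \<aa> \<and> V \<in> \<pi> ` H}"
    proof
      fix y assume "y \<in> \<pi> ` {a \<odot>\<^bsub>M\<^esub> v | a v. a \<in> \<aa> \<and> v \<in> H}"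
      then obtain b v where bv: "b \<in> \<aa>" "v \<in> H" "y = \<pi> (b \<odot>\<^bsub>M\<^esub> v)" by blast
      then have "y = b \<odot>\<^bsub>Q\<^esub> \<pi> v" using a H Q_smult[of b v] by auto
      then show "y \<in> {a \<odot>\<^bsub>Q\<^esub> V | a V. a \<in> \<aa> \<and> V \<in> \<pi> ` H}" using bv by blast
    qed
  qed
  moreover have "{a \<odot>\<^bsub>M\<^esub> v | a v. a \<in> \<aa> \<and> v \<in> H} \<subseteq> carrier M" using a H by auto
  ultimately show ?thesis unfolding ideal_smult_def by (simp only: gen_submodule_\<pi>)
qed

lemma module_length_quot: "module_length R Q = rel_length N (carrier M)"
proof -
  interpret Q: module R Q by (rule Q_module)
  have "(\<exists>C :: nat \<Rightarrow> 'c set set. (\<forall>i\<le>l. submodule (C i) R Q) \<and> (\<forall>i<l. C i \<subset> C (Suc i))) \<longleftrightarrow>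
      has_chain N (carrier M) l" for l
  proof
    assume "\<exists>C :: nat \<Rightarrow> 'c set set. (\<forall>i\<le>l. submodule (C i) R Q) \<and> (\<forall>i<l. C i \<subset> C (Suc i))"
    then obtain C :: "nat \<Rightarrow> 'c set set" where C: "\<And>i. i \<le> l \<Longrightarrow> submodule (C i) R Q" "\<And>i. i < l \<Longrightarrow> C i \<subset> C (Suc i)" by blast
    let ?D = "\<lambda>i. {v \<in> carrier M. \<pi> v \<in> C i}"
    show "has_chain N (carrier M) l"
      unfolding has_chain_def
    proof (intro exI[of _ ?D] conjI allI impI)
      show "submodule (?D i) R M" if "i \<le> l" for i by (rule submod_\<pi>_preimage[OF C(1)[OF that]])
      show "N \<subseteq> ?D i" if "i \<le> l" for i
      proof
        fix v assume v: "v \<in> N"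
        then have "\<pi> v = \<zero>\<^bsub>Q\<^esub>" unfolding Q_zero(1) using \<pi>_eq_N submod_carr[OF N] by blast
        then show "v \<in> ?D i" using Q.submod_zero[OF C(1)[OF that]] submod_carr[OF N v] by simp
      qed
      show "?D i \<subset> ?D (Suc i)" if i: "i < l" for i
      proof -
        obtain V where V: "V \<in> C (Suc i)" "V \<notin> C i" using C(2)[OF i] by blast
        then have "V \<in> carrier Q" using Q.submod_carr[OF C(1)[of "Suc i"]] i by simp
        then obtain v where "v \<in> carrier M" "V = \<pi> v" unfolding Q_carrier by blast
        then show ?thesis using V C(2)[OF i] by blast
      qed
    qed auto
  next
    assume "has_chain N (carrier M) l"
    then obtain D where D: "\<And>i. i \<le> l \<Longrightarrow> submodule (D i) R M \<and> N \<subseteq> D i" "\<And>i. i < l \<Longrightarrow> D i \<subset> D (Suc i)"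
      unfolding has_chain_def by blast
    show "\<exists>C :: nat \<Rightarrow> 'c set set. (\<forall>i\<le>l. submodule (C i) R Q) \<and> (\<forall>i<l. C i \<subset> C (Suc i))"
    proof (intro exI[of _ "\<lambda>i. \<pi> ` D i"] conjI allI impI)
      show "submodule (\<pi> ` D i) R Q" if "i \<le> l" for i using submod_\<pi>_image D(1)[OF that] by blast
      show "\<pi> ` D i \<subset> \<pi> ` D (Suc i)" if i: "i < l" for i
      proof -
        have Di: "submodule (D i) R M" "N \<subseteq> D i" "submodule (D (Suc i)) R M" using D(1)[of i] D(1)[of "Suc i"] i by auto
        obtain v where v: "v \<in> D (Suc i)" "v \<notin> D i" using D(2)[OF i] by blast
        have vc: "v \<in> carrier M" by (rule submod_carr[OF Di(3) v(1)])
        have "\<pi> v \<notin> \<pi> ` D i"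
        proof
          assume "\<pi> v \<in> \<pi> ` D i"
          then obtain w where w: "w \<in> D i" "\<pi> v = \<pi> w" by blast
          have "\<exists>n\<in>N. v = n \<oplus>\<^bsub>M\<^esub> w"
            by (rule iffD1[OF \<pi>_eq_iff[OF vc submod_carr[OF Di(1) w(1)]] w(2)])
          then obtain n where "n \<in> N" "v = n \<oplus>\<^bsub>M\<^esub> w" ..
          then have "n \<in> D i" using Di(2) by blast
          then have "n \<oplus>\<^bsub>M\<^esub> w \<in> D i" using w(1) by (rule submoduleE(5)[OF Di(1)])
          then show False using v(2) \<open>v = n \<oplus>\<^bsub>M\<^esub> w\<close> by simp
        qed
        then show ?thesis using v(1) D(2)[OF i] by blast
      qed
    qed
  qed
  then show ?thesis unfolding module_length_def rel_length_def by simp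
qed

end

lemma (in module) module_length_subquotient:
  assumes H: "submodule H R M" and K: "submodule K R M" "K \<subseteq> H"
  shows "module_length R (quot_module (M\<lparr>carrier := H\<rparr>) K) = rel_length K H"
proof -
  have H': "module R (M\<lparr>carrier := H\<rparr>)" by (rule submodule.submodule_is_module[OF H module_axioms])
  interpret Q: module_quotient R "M\<lparr>carrier := H\<rparr>" K
    by (intro module_quotient.intro module_quotient_axioms.intro H')
       (simp add: submodule_carrier_update[OF H] K)
  have "(submodule X R M \<and> X \<subseteq> H) \<and> K \<subseteq> X \<and> X \<subseteq> H \<longleftrightarrow> submodule X R M \<and> K \<subseteq> X \<and> X \<subseteq> H" for X
    by blast
  then have "Q.has_chain K H l \<longleftrightarrow> has_chain K H l" for l
    unfolding Q.has_chain_def has_chain_def submodule_carrier_update[OF H] by (simp only:)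
  then have "Q.rel_length K H = rel_length K H" unfolding Q.rel_length_def rel_length_def by simp
  then show ?thesis using Q.module_length_quot by simp
qed

section \<open>Translation to quotients, joint reductions and weak-(FC)-sequences\<close>

context local_multi_ideals
begin

lemma W_quot:
  assumes N: "submodule N R M"
  shows "multi_power_mod R (quot_module M N) d F n = (\<lambda>v. N +>\<^bsub>M\<^esub> v) ` W n"
proof -
  interpret Q: module_quotient R M N by (intro module_quotient.intro module_axioms module_quotient_axioms.intro N)
  show ?thesis
    unfolding multi_power_mod_def Q.Q_carrier by (rule Q.ideal_smult_\<pi>[OF multi_power_subset order_refl])
qed

text \<open>Condition (FC2) is stated with powers of the product of all ideals; these are the
  \<open>\<F>\<close> at constant multi-indices, where largeness is easy to express.\<close>

lemma prod_power_eq: "(\<Otimes>\<^bsub>ideals_set R\<^esub>i\<in>{..d}. F i) [^]\<^bsub>ideals_set R\<^esub> (c::nat) = \<F> (\<lambda>_. c)"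
proof -
  interpret IS: comm_monoid "ideals_set R" by (rule ideals_set_is_comm_monoid)
  have "F i [^]\<^bsub>ideals_set R\<^esub> (1::nat) = F i" if "i \<le> d" for i
    using F_ideal[OF that] by (intro IS.nat_pow_eone) (simp add: ideals_set_def)
  then have 1: "(\<Otimes>\<^bsub>ideals_set R\<^esub>i\<in>{..d}. F i) = \<F> (\<lambda>_. 1)"
    unfolding multi_power_def using F_ideal
    by (intro IS.finprod_cong) (auto simp: simp_implies_def ideals_set_def simp del: IS.nat_pow_Suc)
  show ?thesis
  proof (induction c)
    case 0
    then show ?case by (simp add: multi_power_zero) (simp add: ideals_set_def)
  next
    case (Suc c)
    have "\<F> (\<lambda>_. Suc c) = ideal_prod R (\<F> (\<lambda>_. c)) (\<F> (\<lambda>_. 1))"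
      using multi_power_add[of "\<lambda>_. c" "\<lambda>_. 1"] by simp
    then show ?case unfolding IS.nat_pow_Suc IS_simps(2) Suc unfolding 1 by (rule sym)
  qed
qed

text \<open>(FC1) is \<open>good_FC1\<close> read in cosets of \<open>N\<close>. For (FC2), let
  \<open>x v\<close> lie in \<open>N\<close> and \<open>f\<close> in a sufficiently high power
  \<open>c\<close> of the product ideal. Then \<open>f v\<close> lies in
  \<open>W (c, ..., c)\<close> and \<open>x f v\<close> in \<open>N\<close>, so filter-regularity
  puts \<open>f v\<close> into \<open>N\<close>.\<close>

lemma good_weak_FC:
  assumes N: "submodule N R M" and good: "good N i x"
  shows "weak_FC_element R (quot_module M N) d F x"
proof -
  interpret Q: module_quotient R M N by (intro module_quotient.intro module_axioms module_quotient_axioms.intro N)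
  note x = goodD(3)[OF good] and i = goodD(1)[OF good] and xF = goodD(2)[OF good]
  have img: "(\<lambda>v. x \<odot>\<^bsub>Q.Q\<^esub> v) ` Q.\<pi> ` H = Q.\<pi> ` (\<odot>\<^bsub>M\<^esub>) x ` H" if "H \<subseteq> carrier M" for H
    unfolding image_image using that Q.Q_smult[OF x] by (intro image_cong) auto
  have "FC1 R Q.Q d F x"
    unfolding FC1_def for_all_large_iff
  proof (intro exI[of _ i] conjI i xF)
    show "eventually (\<lambda>n. (\<lambda>v. x \<odot>\<^bsub>Q.Q\<^esub> v) ` carrier Q.Q \<inter> multi_power_mod R Q.Q d F n =
        (\<lambda>v. x \<odot>\<^bsub>Q.Q\<^esub> v) ` multi_power_mod R Q.Q d F (dec i n)) (large d)"
      using good_FC1[OF N good] eventually_large_ge[of d 1]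
    proof eventually_elim
      case (elim n)
      have "1 \<le> n i" using elim(2) i by blast
      have WcM: "W m \<subseteq> carrier M" for m using W_carr by blast
      have "Q.\<pi> ` (\<odot>\<^bsub>M\<^esub>) x ` carrier M \<inter> Q.\<pi> ` W n = Q.\<pi> ` (\<odot>\<^bsub>M\<^esub>) x ` W (dec i n)"
      proof
        show "Q.\<pi> ` (\<odot>\<^bsub>M\<^esub>) x ` W (dec i n) \<subseteq> Q.\<pi> ` (\<odot>\<^bsub>M\<^esub>) x ` carrier M \<inter> Q.\<pi> ` W n"
          using F_W[OF i xF, of _ "dec i n"] W_carr unfolding inc_dec(1)[of n i, OF \<open>1 \<le> n i\<close>] by blast
        show "Q.\<pi> ` (\<odot>\<^bsub>M\<^esub>) x ` carrier M \<inter> Q.\<pi> ` W n \<subseteq> Q.\<pi> ` (\<odot>\<^bsub>M\<^esub>) x ` W (dec i n)"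
        proof
          fix V assume "V \<in> Q.\<pi> ` (\<odot>\<^bsub>M\<^esub>) x ` carrier M \<inter> Q.\<pi> ` W n"
          then obtain m w where mw: "m \<in> carrier M" "w \<in> W n" "V = Q.\<pi> (x \<odot>\<^bsub>M\<^esub> m)" "Q.\<pi> (x \<odot>\<^bsub>M\<^esub> m) = Q.\<pi> w" by blast
          have wc: "w \<in> carrier M" and xm: "x \<odot>\<^bsub>M\<^esub> m \<in> carrier M" using mw W_carr x by auto
          have "\<exists>t\<in>N. x \<odot>\<^bsub>M\<^esub> m = t \<oplus>\<^bsub>M\<^esub> w" by (rule iffD1[OF Q.\<pi>_eq_iff[OF xm wc] mw(4)])
          then obtain t where t: "t \<in> N" "x \<odot>\<^bsub>M\<^esub> m = t \<oplus>\<^bsub>M\<^esub> w" ..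
          have "x \<odot>\<^bsub>M\<^esub> m = w \<oplus>\<^bsub>M\<^esub> t" using t wc submod_carr[OF N t(1)] by (simp add: M.a_comm)
          then have "x \<odot>\<^bsub>M\<^esub> m \<in> W n <+>\<^bsub>M\<^esub> N" using sumI[OF mw(2) t(1)] by simp
          moreover have "x \<odot>\<^bsub>M\<^esub> m \<in> addx x N"
            using sum_upper1[OF submod_image[OF x carrier_is_submodule] N] mw(1) by blast
          ultimately have "x \<odot>\<^bsub>M\<^esub> m \<in> (\<odot>\<^bsub>M\<^esub>) x ` W (dec i n) <+>\<^bsub>M\<^esub> N" using elim(1) by blast
          then obtain y s where ys: "y \<in> (\<odot>\<^bsub>M\<^esub>) x ` W (dec i n)" "s \<in> N" "x \<odot>\<^bsub>M\<^esub> m = s \<oplus>\<^bsub>M\<^esub> y"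
            by (rule sumE_swapped[OF _ submod_image[OF x W_submod] N])
          have yc: "y \<in> carrier M" by (rule submod_carr[OF submod_image[OF x W_submod] ys(1)])
          have "Q.\<pi> (x \<odot>\<^bsub>M\<^esub> m) = Q.\<pi> y" by (rule iffD2[OF Q.\<pi>_eq_iff[OF xm yc]]) (use ys in blast)
          then show "V \<in> Q.\<pi> ` (\<odot>\<^bsub>M\<^esub>) x ` W (dec i n)" unfolding mw(3) using ys(1) by blast
        qed
      qed
      then show ?case unfolding W_quot[OF N] Q.Q_carrier img[OF WcM] img[OF order_refl] .
    qed
  qed
  moreover have "FC2 R Q.Q d F x"
    unfolding FC2_def
  proof
    fix V assume "V \<in> zero_colon Q.Q {x}"
    then have V: "V \<in> carrier Q.Q" "x \<odot>\<^bsub>Q.Q\<^esub> V = \<zero>\<^bsub>Q.Q\<^esub>" unfolding zero_colon_def by auto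
    then obtain v where v: "v \<in> carrier M" "V = Q.\<pi> v" unfolding Q.Q_carrier by blast
    have xv: "x \<odot>\<^bsub>M\<^esub> v \<in> N"
      using V(2) Q.\<pi>_eq_N[of "x \<odot>\<^bsub>M\<^esub> v"] x v(1) unfolding v(2) Q.Q_smult[OF x v(1)] Q.Q_zero(1) by simp
    obtain c where c: "\<And>n. \<forall>i\<le>d. c \<le> n i \<Longrightarrow> \<forall>u\<in>W n. x \<odot>\<^bsub>M\<^esub> u \<in> N \<longrightarrow> u \<in> N"
      using goodD(4)[OF good] unfolding eventually_large by blast
    have "f \<odot>\<^bsub>Q.Q\<^esub> V = \<zero>\<^bsub>Q.Q\<^esub>" if f: "f \<in> \<F> (\<lambda>_. c)" for f
    proof -
      have fc: "f \<in> carrier R" by (rule multi_power_carr[OF f])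
      have "f \<odot>\<^bsub>M\<^esub> v \<in> W (\<lambda>_. c)" unfolding W_eq by (rule ideal_smult_I[OF f v(1)])
      moreover have "x \<odot>\<^bsub>M\<^esub> (f \<odot>\<^bsub>M\<^esub> v) \<in> N"
        unfolding smult_comm[OF x fc v(1)] by (rule submoduleE(4)[OF N fc xv])
      ultimately have "f \<odot>\<^bsub>M\<^esub> v \<in> N" using c[of "\<lambda>_. c"] by blast
      then show ?thesis
        using Q.\<pi>_eq_N[of "f \<odot>\<^bsub>M\<^esub> v"] fc v(1) unfolding v(2) Q.Q_smult[OF fc v(1)] Q.Q_zero(1) by simp
    qed
    then have "V \<in> zero_colon Q.Q ((\<Otimes>\<^bsub>ideals_set R\<^esub>i\<in>{..d}. F i) [^]\<^bsub>ideals_set R\<^esub> c)"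
      unfolding prod_power_eq zero_colon_def using V(1) by blast
    then show "V \<in> zero_colon_inf R Q.Q (\<Otimes>\<^bsub>ideals_set R\<^esub>i\<in>{..d}. F i)" unfolding zero_colon_inf_def by blast
  qed
  ultimately show ?thesis unfolding weak_FC_element_def using x by blast
qed

section \<open>Kernels of good sequences as submodules generated by their elements\<close>

abbreviation "IM S \<equiv> ideal_smult R M (Idl S) (carrier M)"

lemma Idl_carrier: "S \<subseteq> carrier R \<Longrightarrow> Idl S \<subseteq> carrier R"
  using genideal_ideal[of S] ideal_carr by blast

lemma IM_submod: "S \<subseteq> carrier R \<Longrightarrow> submodule (IM S) R M"
  by (intro ideal_smult_submod Idl_carrier) auto

lemma IM_least:
  assumes "S \<subseteq> carrier R" "submodule K R M" "\<And>a v. a \<in> S \<Longrightarrow> v \<in> carrier M \<Longrightarrow> a \<odot>\<^bsub>M\<^esub> v \<in> K"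
  shows "IM S \<subseteq> K"
  by (rule ideal_smult_least[OF assms(2)]) (rule Idl_smult_mem[OF assms(1) _ carrier_is_submodule assms(2,3)])

lemma IM_mem: "S \<subseteq> carrier R \<Longrightarrow> a \<in> S \<Longrightarrow> v \<in> carrier M \<Longrightarrow> a \<odot>\<^bsub>M\<^esub> v \<in> IM S"
  using genideal_self[of S] by (intro ideal_smult_I) auto

lemma IM_empty: "IM {} = {\<zero>\<^bsub>M\<^esub>}"
  using IM_least[OF _ zero_submod, of "{}"] submod_zero[OF IM_submod[of "{}"]] by auto

lemma IM_insert:
  assumes S: "S \<subseteq> carrier R" and x: "x \<in> carrier R"
  shows "addx x (IM S) = IM (insert x S)"
proof
  have xS: "insert x S \<subseteq> carrier R" using S x by blast
  note sS = IM_submod[OF S] and sxS = IM_submod[OF xS] and xM = submod_image[OF x carrier_is_submodule]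
  show "addx x (IM S) \<subseteq> IM (insert x S)"
  proof (rule sum_least[OF sxS])
    show "(\<odot>\<^bsub>M\<^esub>) x ` carrier M \<subseteq> IM (insert x S)" using IM_mem[OF xS, of x] by blast
    show "IM S \<subseteq> IM (insert x S)" by (rule IM_least[OF S sxS IM_mem[OF xS]]) auto
  qed
  show "IM (insert x S) \<subseteq> addx x (IM S)"
  proof (rule IM_least[OF xS addx_submod[OF x sS]])
    fix a v assume a: "a \<in> insert x S" and v: "v \<in> carrier M"
    show "a \<odot>\<^bsub>M\<^esub> v \<in> addx x (IM S)"
    proof (cases "a = x")
      case True
      then show ?thesis using sum_upper1[OF xM sS] v by blast
    next
      case False
      then show ?thesis using IM_mem[OF S, of a v] a v sum_upper2[OF xM sS] by blast
    qed
  qed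
qed

text \<open>The kernels collected along a good sequence are the submodules
  \<open>(x_1, ..., x_l)M\<close> that occur in \<open>weak_FC_sequence\<close>.\<close>

lemma addseq_IM:
  "seq_in zs \<Longrightarrow> S \<subseteq> carrier R \<Longrightarrow> addseq zs (IM S) = IM (S \<union> set (map snd zs))"
proof (induction zs arbitrary: S)
  case (Cons z zs)
  obtain i x where z: "z = (i, x)" by force
  have x: "x \<in> carrier R" using Cons.prems(1) z F_carr by auto
  have "addseq zs (IM (insert x S)) = IM (insert x S \<union> set (map snd zs))"
    by (rule Cons.IH) (use Cons.prems x in auto)
  then show ?case unfolding z by (simp add: IM_insert[OF Cons.prems(2) x])
qed simp

lemma goodseq_nth:
  "goodseq zs N \<Longrightarrow> l < length zs \<Longrightarrow> good (addseq (take l zs) N) (fst (zs ! l)) (snd (zs ! l))"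
proof (induction zs N arbitrary: l rule: goodseq.induct)
  case (2 i x zs N)
  then show ?case by (cases l) auto
qed simp

lemma goodseq_weak_FC:
  assumes gs: "goodseq zs {\<zero>\<^bsub>M\<^esub>}"
  shows "weak_FC_sequence R M d F (map snd zs)"
  unfolding weak_FC_sequence_def
proof (intro allI impI)
  fix l assume l: "l < length (map snd zs)"
  have si: "seq_in (take l zs)" using goodseq_in[OF gs] by (auto dest: in_set_takeD)
  have "addseq (take l zs) {\<zero>\<^bsub>M\<^esub>} = IM (set (take l (map snd zs)))"
    using addseq_IM[OF si, of "{}"] by (simp add: IM_empty take_map)
  moreover have "good (addseq (take l zs) {\<zero>\<^bsub>M\<^esub>}) (fst (zs ! l)) (map snd zs ! l)"
    using goodseq_nth[OF gs, of l] l by simp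
  moreover have "submodule (addseq (take l zs) {\<zero>\<^bsub>M\<^esub>}) R M" by (rule addseq_submod[OF si zero_submod])
  ultimately show "weak_FC_element R (quot_module M (IM (set (take l (map snd zs))))) d F (map snd zs ! l)"
    using good_weak_FC by metis
qed

section \<open>Joint reductions as sums over single elements\<close>

lemma red_part_upper:
  "seq_in zs \<Longrightarrow> (i, x) \<in> set zs \<Longrightarrow> w \<in> W (dec i n) \<Longrightarrow> x \<odot>\<^bsub>M\<^esub> w \<in> red_part zs n"
proof (induction zs)
  case (Cons z zs)
  obtain j y where z: "z = (j, y)" by force
  have yc: "y \<in> carrier R" using Cons.prems(1) z F_carr by auto
  have si: "seq_in zs" using Cons.prems(1) by simp
  note sub = submod_image[OF yc W_submod] red_part_submod[OF si]
  show ?case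
  proof (cases "(i, x) = (j, y)")
    case True
    then show ?thesis unfolding z red_part.simps using sum_upper1[OF sub] Cons.prems(3) by blast
  next
    case False
    then have "x \<odot>\<^bsub>M\<^esub> w \<in> red_part zs n" using Cons z si by auto
    then show ?thesis unfolding z red_part.simps using sum_upper2[OF sub] by blast
  qed
qed simp

lemma red_part_least:
  "submodule K R M \<Longrightarrow> (\<And>i x w. (i, x) \<in> set zs \<Longrightarrow> w \<in> W (dec i n) \<Longrightarrow> x \<odot>\<^bsub>M\<^esub> w \<in> K) \<Longrightarrow> red_part zs n \<subseteq> K"
proof (induction zs)
  case Nil
  then show ?case using submod_zero by simp
next
  case (Cons z zs)
  obtain j y where z: "z = (j, y)" by force
  have "red_part zs n \<subseteq> K" by (rule Cons.IH[OF Cons.prems(1)]) (use Cons.prems(2) in auto)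
  moreover have "(\<odot>\<^bsub>M\<^esub>) y ` W (dec j n) \<subseteq> K" using Cons.prems(2)[of j y] z by auto
  ultimately show ?case unfolding z red_part.simps using sum_least[OF Cons.prems(1)] by blast
qed

lemma red_part_eq_gen:
  assumes si: "seq_in zs" and Y: "\<And>i. i \<le> d \<Longrightarrow> set (Y i) = {x. (i, x) \<in> set zs}"
  shows "gen_submodule R M (\<Union>i\<le>d. ideal_smult R M (Idl (set (Y i))) (W (dec i n))) = red_part zs n"
proof
  have rs: "submodule (red_part zs n) R M" by (rule red_part_submod[OF si])
  have YR: "set (Y i) \<subseteq> carrier R" if "i \<le> d" for i using Y[OF that] si F_carr that by auto
  have WcM: "W m \<subseteq> carrier M" for m using W_carr by blast
  have s: "submodule (ideal_smult R M (Idl (set (Y i))) (W (dec i n))) R M" if "i \<le> d" for i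
    by (rule ideal_smult_submod[OF Idl_carrier[OF YR[OF that]] WcM])
  have "ideal_smult R M (Idl (set (Y i))) (W (dec i n)) \<subseteq> red_part zs n" if i: "i \<le> d" for i
  proof (rule ideal_smult_least[OF rs])
    fix r v assume r: "r \<in> Idl (set (Y i))" and v: "v \<in> W (dec i n)"
    show "r \<odot>\<^bsub>M\<^esub> v \<in> red_part zs n"
      by (rule Idl_smult_mem[OF YR[OF i] r W_submod rs red_part_upper[OF si] v]) (use Y[OF i] in auto)
  qed
  then show "gen_submodule R M (\<Union>i\<le>d. ideal_smult R M (Idl (set (Y i))) (W (dec i n))) \<subseteq> red_part zs n"
    by (intro gen_submodule_least[OF rs]) blast
  have U: "(\<Union>i\<le>d. ideal_smult R M (Idl (set (Y i))) (W (dec i n))) \<subseteq> carrier M"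
  proof (rule UN_least)
    fix i assume "i \<in> {..d}"
    then have i: "i \<le> d" by simp
    show "ideal_smult R M (Idl (set (Y i))) (W (dec i n)) \<subseteq> carrier M"
      by (rule subsetI) (rule submod_carr[OF s[OF i]])
  qed
  show "red_part zs n \<subseteq> gen_submodule R M (\<Union>i\<le>d. ideal_smult R M (Idl (set (Y i))) (W (dec i n)))"
  proof (rule red_part_least[OF gen_submodule_submod[OF U]])
    fix i x w assume ix: "(i, x) \<in> set zs" and w: "w \<in> W (dec i n)"
    have i: "i \<le> d" using si ix by auto
    have "x \<in> Idl (set (Y i))" using genideal_self[OF YR[OF i]] Y[OF i] ix by blast
    then have "x \<odot>\<^bsub>M\<^esub> w \<in> ideal_smult R M (Idl (set (Y i))) (W (dec i n))" by (rule ideal_smult_I[OF _ w])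
    then have "x \<odot>\<^bsub>M\<^esub> w \<in> (\<Union>i\<le>d. ideal_smult R M (Idl (set (Y i))) (W (dec i n)))" using i by blast
    then show "x \<odot>\<^bsub>M\<^esub> w \<in> gen_submodule R M (\<Union>i\<le>d. ideal_smult R M (Idl (set (Y i))) (W (dec i n)))"
      by (rule subsetD[OF gen_submodule_upper])
  qed
qed

text \<open>In positive degrees the right-hand side of a joint reduction is contained in
  \<open>W n\<close> anyway, so for large \<open>n\<close> equality and inclusion agree.\<close>

lemma joint_reduction_iff_joint_red:
  assumes si: "seq_in zs" and Y: "\<And>i. i \<le> d \<Longrightarrow> set (Y i) = {x. (i, x) \<in> set zs}"
    and parts: "parts_of_type d F k Y"
  shows "joint_reduction R M d F k Y \<longleftrightarrow> joint_red zs {\<zero>\<^bsub>M\<^esub>}"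
proof -
  have g: "gen_submodule R M (\<Union>i\<le>d. ideal_smult R M (Idl (set (Y i))) (W (dec i n))) = red_part zs n" for n
    using red_part_eq_gen[of zs Y n] si Y by blast
  have r0: "red_part zs n <+>\<^bsub>M\<^esub> {\<zero>\<^bsub>M\<^esub>} = red_part zs n" for n
    using sum_absorb(1)[OF red_part_submod[OF si] zero_submod] submod_zero[OF red_part_submod[OF si]] by simp
  have "eventually (\<lambda>n. W n = red_part zs n \<longleftrightarrow> W n \<subseteq> red_part zs n) (large d)"
    using eventually_large_ge[of d 1]
    by (rule eventually_mono) (use red_part_subset[OF si] in blast)
  then have "eventually (\<lambda>n. W n = red_part zs n) (large d) \<longleftrightarrow> eventually (\<lambda>n. W n \<subseteq> red_part zs n) (large d)"
    by (rule eventually_cong)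
  then show ?thesis
    unfolding joint_reduction_def joint_red_def r0 for_all_large_iff using parts by (simp only: g simp_thms)
qed

text \<open>The length in the definition is \<open>hilbert_fun\<close> at the zero submodule, and
  the description by \<open>THE\<close> is then settled by existence and uniqueness of Hilbert
  polynomials.\<close>

lemma hilbert_polynomial_is_hilbert_poly: "is_hilbert_poly (hilbert_polynomial R M d F) {\<zero>\<^bsub>M\<^esub>}"
proof -
  have W0: "W n <+>\<^bsub>M\<^esub> {\<zero>\<^bsub>M\<^esub>} = W n" for n
    using sum_absorb(1)[OF W_submod zero_submod] submod_zero[OF W_submod] by simp
  have len: "module_length R (quot_module (M\<lparr>carrier := W n\<rparr>) (W (n(0 := n 0 + 1)))) = enat (hilbert_nat {\<zero>\<^bsub>M\<^esub>} n)" for n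
    using module_length_subquotient[OF W_submod W_submod W_inc_subset] hilbert_nat[OF zero_submod, of n]
    unfolding hilbert_fun_def W0 by simp
  have eq: "polynomial_fun d P \<and> for_all_large d (\<lambda>n. \<exists>l.
       module_length R (quot_module (M\<lparr>carrier := W n\<rparr>) (W (n(0 := n 0 + 1)))) = enat l \<and>
       P (\<lambda>i. int (n i)) = of_nat l) \<longleftrightarrow> is_hilbert_poly P {\<zero>\<^bsub>M\<^esub>}" for P :: "(nat \<Rightarrow> int) \<Rightarrow> rat"
    unfolding for_all_large_iff len is_hilbert_poly_def by simp
  obtain f where f: "is_hilbert_poly f {\<zero>\<^bsub>M\<^esub>}" using is_hilbert_poly_exists[OF zero_submod] by blast
  show ?thesis
    unfolding hilbert_polynomial_def eq by (rule theI[of "\<lambda>P. is_hilbert_poly P {\<zero>\<^bsub>M\<^esub>}", OF f]) (rule is_hilbert_poly_unique[OF _ f])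
qed

end

text \<open>The indices are listed with multiplicity in the order in which
  \<open>multi_difference\<close> folds over them, so a good sequence with these indices realises
  exactly that iterated difference.\<close>

definition type_list :: "nat \<Rightarrow> (nat \<Rightarrow> nat) \<Rightarrow> nat list" where
  "type_list d k = concat (map (\<lambda>i. replicate (k i) i) [0..<Suc d])"

lemma set_type_list: "set (type_list d k) \<subseteq> {..d}"
  unfolding type_list_def by auto

lemma fold_replicate: "fold f (replicate m i) = f i ^^ m"
  by (induction m) (simp_all add: fun_eq_iff funpow_swap1)

lemma fold_difference_type_list: "fold difference (type_list d k) f = multi_difference d k f"
proof -
  have "fold difference (concat (map (\<lambda>i. replicate (k i) i) xs)) f = fold (\<lambda>i. difference i ^^ k i) xs f" for xs
    by (induction xs arbitrary: f) (simp_all add: fold_replicate)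
  then show ?thesis unfolding type_list_def multi_difference_def .
qed

lemma length_filter_type_list:
  assumes "i \<le> d" shows "length (filter ((=) i) (type_list d k)) = k i"
proof -
  have "length (filter ((=) i) (concat (map (\<lambda>i. replicate (k i) i) xs))) = (if i \<in> set xs then k i else 0)"
    if "distinct xs" for xs
    using that by (induction xs) (auto simp: filter_replicate)
  then show ?thesis unfolding type_list_def using assms by simp
qed

lemma mset_parts:
  fixes zs :: "(nat \<times> 'x) list"
  assumes "\<forall>z\<in>set zs. fst z \<le> d"
  shows "mset (map snd zs) = (\<Sum>i\<le>d. mset (map snd (filter (\<lambda>z. fst z = i) zs)))"
  using assms
proof (induction zs)
  case (Cons z zs)
  have "(\<Sum>i\<le>d. mset (map snd (filter (\<lambda>y. fst y = i) (z # zs)))) =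
    (\<Sum>i\<le>d. (if fst z = i then {#snd z#} else {#}) + mset (map snd (filter (\<lambda>y. fst y = i) zs)))"
    by (intro sum.cong) auto
  also have "\<dots> = {#snd z#} + mset (map snd zs)"
    using Cons by (simp add: sum.distrib)
  finally show ?case by simp
qed simp

theorem proposition2p7:
  fixes A :: "('a, 'm) ring_scheme" and M :: "('a, 'b, 'n) module_scheme"
    and \<mm> J :: "'a set" and I :: "nat \<Rightarrow> 'a set"
    and d k0 :: nat and k :: "nat \<Rightarrow> nat"
  assumes "noetherian_ring A" and "local_ring A \<mm>"
    and "infinite (carrier (A Quot \<mm>))"
    and "fin_gen_module A M"
    and "primary_to A \<mm> J"
    and "\<And>i. 1 \<le> i \<Longrightarrow> i \<le> d \<Longrightarrow> ideal (I i) A"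
  shows "((\<exists>xs Y. weak_FC_sequence_of_type A M d (I(0 := J)) (k(0 := k0 + 1)) xs Y \<and>
                 joint_reduction A M d (I(0 := J)) (k(0 := k0 + 1)) Y)
          \<longleftrightarrow> (\<exists>Y. joint_reduction A M d (I(0 := J)) (k(0 := k0 + 1)) Y))
       \<and> ((\<exists>Y. joint_reduction A M d (I(0 := J)) (k(0 := k0 + 1)) Y)
          \<longleftrightarrow> (\<exists>c. \<forall>n. multi_difference d (k(0 := k0)) (hilbert_polynomial A M d (I(0 := J))) n = c))"
proof -
  define F where "F = I(0 := J)"
  define K where "K = k(0 := k0 + 1)"
  define K' where "K' = k(0 := k0)"
  have "module A M" using assms(4) unfolding fin_gen_module_def by blast
  moreover have "ideal (F i) A" if "i \<le> d" for i
    using assms(5,6) that unfolding F_def primary_to_def primary_ideal_def by (cases "i = 0") auto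
  moreover have "primary_to A \<mm> (F 0)" using assms(5) unfolding F_def by simp
  ultimately interpret local_multi_ideals A M d F \<mm>
    using assms by (intro local_multi_ideals.intro multi_ideals.intro multi_ideals_axioms.intro local_multi_ideals_axioms.intro)
  define P where "P = hilbert_polynomial A M d F"
  have P: "is_hilbert_poly P {\<zero>\<^bsub>M\<^esub>}" unfolding P_def by (rule hilbert_polynomial_is_hilbert_poly)
  \<comment> \<open>The type \<open>K\<close> has one element of \<open>J\<close> more than
    \<open>K'\<close>. A vanishing difference of type \<open>K\<close> thus means that the one of
    type \<open>K'\<close> does not depend on \<open>n_0\<close>.\<close>
  have step: "multi_difference d K P = difference 0 (multi_difference d K' P)"
    using multi_difference_step[of 0 d K P] unfolding K_def K'_def by simp
  have ii_iii: "\<exists>c. \<forall>n. multi_difference d K' P n = c" if joint_red: "joint_reduction A M d F K Y" for Y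
  proof -
    define zs where "zs = concat (map (\<lambda>i. map (Pair i) (Y i)) [0..<Suc d])"
    have parts: "parts_of_type d F K Y" using joint_red unfolding joint_reduction_def by blast
    have set_zs: "set zs = (\<Union>i\<in>{..d}. Pair i ` set (Y i))"
      unfolding zs_def by (simp del: upt_Suc add: atLeast0LessThan lessThan_Suc_atMost)
    then have Y: "set (Y i) = {x. (i, x) \<in> set zs}" if "i \<le> d" for i
      using that by auto
    have si: "seq_in zs"
    proof clarify
      fix i x assume "(i, x) \<in> set zs"
      then have "i \<le> d" "x \<in> set (Y i)" unfolding set_zs by auto
      then show "i \<le> d \<and> x \<in> F i" using parts unfolding parts_of_type_def by blast
    qed
    have fst: "map fst zs = type_list d K"
      unfolding zs_def type_list_def map_concat map_map
    proof (intro arg_cong[of _ _ concat] map_cong refl)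
      fix i assume "i \<in> set [0..<Suc d]"
      then have "length (Y i) = K i" using parts unfolding parts_of_type_def by auto
      then show "(map fst \<circ> (\<lambda>i. map (Pair i) (Y i))) i = replicate (K i) i"
        by (simp add: comp_def map_replicate_const)
    qed
    have "joint_red zs {\<zero>\<^bsub>M\<^esub>}" using joint_reduction_iff_joint_red[OF si Y parts] joint_red by blast
    then have "multi_difference d K P = (\<lambda>_. 0)"
      using joint_red_difference_zero[OF si zero_submod _ P] unfolding fst fold_difference_type_list by blast
    then have D: "difference 0 (multi_difference d K' P) = (\<lambda>_. 0)" using step by simp
    \<comment> \<open>A good sequence with one element of \<open>J\<close> less exhibits the
      difference of type \<open>K'\<close> as the Hilbert polynomial of a quotient, which is what
      \<open>is_hilbert_poly_constant\<close> needs.\<close>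
    obtain zs' where zs': "map fst zs' = type_list d K'" "goodseq zs' {\<zero>\<^bsub>M\<^esub>}"
      using goodseq_exists[OF set_type_list zero_submod] by blast
    have "is_hilbert_poly (multi_difference d K' P) (addseq zs' {\<zero>\<^bsub>M\<^esub>})"
      using is_hilbert_poly_goodseq[OF zs'(2) zero_submod P] unfolding zs'(1) fold_difference_type_list .
    then show ?thesis
      using is_hilbert_poly_constant[OF addseq_submod[OF goodseq_in[OF zs'(2)] zero_submod] _ D] by blast
  qed
  have iii_i: "\<exists>xs Y. weak_FC_sequence_of_type A M d F K xs Y \<and> joint_reduction A M d F K Y"
    if const: "\<forall>n. multi_difference d K' P n = c" for c
  proof -
    have zero: "multi_difference d K P = (\<lambda>_. 0)"
      unfolding step using const by (simp add: difference_def fun_eq_iff)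
    obtain zs where zs: "map fst zs = type_list d K" "goodseq zs {\<zero>\<^bsub>M\<^esub>}"
      using goodseq_exists[OF set_type_list zero_submod] by blast
    have si: "seq_in zs" by (rule goodseq_in[OF zs(2)])
    have "is_hilbert_poly (\<lambda>_. 0) (addseq zs {\<zero>\<^bsub>M\<^esub>})"
      using is_hilbert_poly_goodseq[OF zs(2) zero_submod P] unfolding zs(1) fold_difference_type_list zero .
    then have "eventually (\<lambda>n. W n \<subseteq> addseq zs {\<zero>\<^bsub>M\<^esub>}) (large d)"
      using is_hilbert_poly_zero_iff[OF addseq_submod[OF si zero_submod]] by blast
    then have joint_red: "joint_red zs {\<zero>\<^bsub>M\<^esub>}"
      unfolding joint_red_def using goodseq_red_part[OF zs(2) zero_submod] by eventually_elim blast
    define Y where "Y i = map snd (filter (\<lambda>z. fst z = i) zs)" for i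
    have Y: "set (Y i) = {x. (i, x) \<in> set zs}" for i unfolding Y_def by force
    have "length (Y i) = K i" if "i \<le> d" for i
    proof -
      have "length (Y i) = length (filter ((=) i) (map fst zs))"
        unfolding Y_def filter_map by (simp add: comp_def eq_commute)
      then show ?thesis unfolding zs(1) by (simp add: length_filter_type_list[OF that])
    qed
    then have parts: "parts_of_type d F K Y" unfolding parts_of_type_def using Y si by auto
    have "\<forall>z\<in>set zs. fst z \<le> d" using si by auto
    then have "mset (map snd zs) = (\<Sum>i\<le>d. mset (Y i))" unfolding Y_def by (rule mset_parts)
    then have "weak_FC_sequence_of_type A M d F K (map snd zs) Y"
      unfolding weak_FC_sequence_of_type_def using goodseq_weak_FC[OF zs(2)] parts by blast
    moreover have "joint_reduction A M d F K Y" using joint_reduction_iff_joint_red[OF si Y parts] joint_red by blast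
    ultimately show ?thesis by blast
  qed
  show ?thesis
    unfolding F_def[symmetric] K_def[symmetric] K'_def[symmetric] P_def[symmetric]
    using ii_iii iii_i by blast
qed

end
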